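(* Any nilpotent orbit of $\mathfrak{sl}(n,\mathbb H)$ is stable under negation (that is, if $\mathcal O$ is the adjoint orbit of a nilpotent element, then $-\mathcal O=\mathcal O$). In particular, no nonzero nilpotent orbit of $\mathfrak{sl}(n,\mathbb H)$ admits Gibbs states.
   Context: $\mathrm{SL}(n,\mathbb H)=\mathrm{GL}(n,\mathbb H)\cap\mathrm{SL}(2n,\mathbb C)=\mathrm{GL}(n,\mathbb H)\cap\mathrm{SL}(4n,\mathbb R)$ (for any algebra embedding $\mathbb C\hookrightarrow\mathbb H$), a connected group, and $\mathfrak{sl}(n,\mathbb H)$ is its Lie algebra. Adjoint orbits are taken under this connected group; a nilpotent orbit is the adjoint orbit of a nilpotent element. Gibbs states: for a real semisimple Lie algebra $\mathfrak g$ with Killing form $\kappa$, an adjoint orbit $\mathcal O$ carries the symplectic form $\omega_{\mathcal O}|_y([X,y],[Y,y])=\kappa(y,[X,Y])$ and the Liouville form $\lambda_{\mathcal O}=\omega_{\mathcal O}^{\dim\mathcal O/2}$. For $\beta\in\mathfrak g^*$ put $Z(\beta)=\int_{\mathcal O}e^{-\langle\beta,y\rangle}|\lambda_{\mathcal O}|(y)\in(0,+\infty]$. When $Z(\beta)<\infty$, the probability distribution $Z(\beta)^{-1}e^{-\langle\beta,y\rangle}|\lambda_{\mathcal O}|(y)$ is called a Gibbs state; $\mathcal O$ admits Gibbs states if $Z(\beta)<\infty$ for some $\beta$. *)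

theory Defs
  imports "HOL-Analysis.Analysis"
begin

section \<open>Quaternions\<close>

text \<open>\<open>Quat a b c d\<close> is \<open>a + b i + c j + d k\<close>, with \<open>i j = k\<close>.\<close>

datatype quat = Quat (qRe: real) (qI: real) (qJ: real) (qK: real)

lemma quat_eq_iff:
  "p = q \<longleftrightarrow> qRe p = qRe q \<and> qI p = qI q \<and> qJ p = qJ q \<and> qK p = qK q"
  by (cases p; cases q) simp

instantiation quat :: real_vector
begin

definition "0 = Quat 0 0 0 0"

definition "p + q = Quat (qRe p + qRe q) (qI p + qI q) (qJ p + qJ q) (qK p + qK q)"

definition "p - q = Quat (qRe p - qRe q) (qI p - qI q) (qJ p - qJ q) (qK p - qK q)"

definition "- p = Quat (- qRe p) (- qI p) (- qJ p) (- qK p)"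

definition "r *\<^sub>R p = Quat (r * qRe p) (r * qI p) (r * qJ p) (r * qK p)"

instance
  by standard
    (auto simp: quat_eq_iff zero_quat_def plus_quat_def minus_quat_def uminus_quat_def
      scaleR_quat_def algebra_simps)

end

instantiation quat :: real_algebra_1
begin

definition "1 = Quat 1 0 0 0"

definition "p * q = Quat
  (qRe p * qRe q - qI p * qI q - qJ p * qJ q - qK p * qK q)
  (qRe p * qI q + qI p * qRe q + qJ p * qK q - qK p * qJ q)
  (qRe p * qJ q - qI p * qK q + qJ p * qRe q + qK p * qI q)
  (qRe p * qK q + qI p * qJ q - qJ p * qI q + qK p * qRe q)"

instance
  by standard
    (auto simp: quat_eq_iff zero_quat_def one_quat_def plus_quat_def times_quat_def
      scaleR_quat_def algebra_simps)

end

instantiation quat :: real_inner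
begin

definition "inner p q = qRe p * qRe q + qI p * qI q + qJ p * qJ q + qK p * qK q"

definition "norm (p :: quat) = sqrt (inner p p)"

definition "sgn (p :: quat) = p /\<^sub>R norm p"

definition "dist (p :: quat) q = norm (p - q)"

definition "(uniformity :: (quat \<times> quat) filter) = (INF e\<in>{0<..}. principal {(x, y). dist x y < e})"

definition "open (U :: quat set) \<longleftrightarrow> (\<forall>x\<in>U. eventually (\<lambda>(x', y). x' = x \<longrightarrow> y \<in> U) uniformity)"

instance
proof
  fix p q s :: quat and r :: real
  show "inner p q = inner q p"
    by (simp add: inner_quat_def mult.commute)
  show "inner (p + q) s = inner p s + inner q s"
    by (simp add: inner_quat_def plus_quat_def algebra_simps)
  show "inner (r *\<^sub>R p) q = r * inner p q"
    by (simp add: inner_quat_def scaleR_quat_def algebra_simps)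
  show "0 \<le> inner p p"
    by (simp add: inner_quat_def)
  show "inner p p = 0 \<longleftrightarrow> p = 0"
    by (simp add: inner_quat_def quat_eq_iff zero_quat_def add_nonneg_eq_0_iff conj_assoc)
qed (rule norm_quat_def sgn_quat_def dist_quat_def uniformity_quat_def open_quat_def)+

end

instantiation quat :: euclidean_space
begin

definition "Basis = {Quat 1 0 0 0, Quat 0 1 0 0, Quat 0 0 1 0, Quat 0 0 0 1}"

instance
proof
  fix u v x :: quat
  show "(Basis :: quat set) \<noteq> {}" "finite (Basis :: quat set)"
    by (simp_all add: Basis_quat_def)
  show "inner u v = (if u = v then 1 else 0)" if "u \<in> Basis" "v \<in> Basis"
    using that unfolding Basis_quat_def
    by (elim insertE emptyE; hypsubst) (simp_all add: inner_quat_def)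
  show "(\<forall>u\<in>Basis. inner x u = 0) \<longleftrightarrow> x = 0"
    by (cases x) (simp add: Basis_quat_def inner_quat_def zero_quat_def)
qed

end

section \<open>The group \<open>SL(n,\<H>)\<close> and its Lie algebra\<close>

text \<open>
  Writing a quaternion as \<open>z + w j\<close> with \<open>z, w\<close> complex, the algebra embedding of the quaternions
  into the complex \<open>2 \<times> 2\<close> matrices sends it to \<open>[[z, w], [- cnj w, cnj z]]\<close>. Applied blockwise,
  it embeds \<open>n \<times> n\<close> quaternionic matrices into \<open>2n \<times> 2n\<close> complex ones.
\<close>

definition quat_fst :: "quat \<Rightarrow> complex"
  where "quat_fst q = Complex (qRe q) (qI q)"

definition quat_snd :: "quat \<Rightarrow> complex"
  where "quat_snd q = Complex (qJ q) (qK q)"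

definition complex_rep :: "quat^'n^'n \<Rightarrow> complex^('n + 'n)^('n + 'n)"
  where "complex_rep A = (\<chi> r c. case (r, c) of
      (Inl i, Inl j) \<Rightarrow> quat_fst (A $ i $ j)
    | (Inl i, Inr j) \<Rightarrow> quat_snd (A $ i $ j)
    | (Inr i, Inl j) \<Rightarrow> - cnj (quat_snd (A $ i $ j))
    | (Inr i, Inr j) \<Rightarrow> cnj (quat_fst (A $ i $ j)))"

definition SL_quat :: "(quat^'n^'n) set"
  where "SL_quat = {A. invertible A \<and> det (complex_rep A) = 1}"

text \<open>
  The Lie algebra of a closed matrix group is its tangent space at the identity. Curves that are
  merely differentiable at \<open>0\<close> have the same velocities there as smooth ones.
\<close>

definition lie_algebra_of :: "(quat^'n^'n) set \<Rightarrow> (quat^'n^'n) set"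
  where "lie_algebra_of G = {X. \<exists>\<gamma>. (\<forall>t. \<gamma> t \<in> G) \<and> \<gamma> 0 = mat 1 \<and>
    (\<gamma> has_vector_derivative X) (at 0)}"

definition sl_quat :: "(quat^'n^'n) set"
  where "sl_quat = lie_algebra_of SL_quat"

definition lie_bracket :: "quat^'n^'n \<Rightarrow> quat^'n^'n \<Rightarrow> quat^'n^'n"
  where "lie_bracket X Y = X ** Y - Y ** X"

definition adjoint_orbit :: "(quat^'n^'n) set \<Rightarrow> quat^'n^'n \<Rightarrow> (quat^'n^'n) set"
  where "adjoint_orbit G y = {g ** y ** matrix_inv g |g. g \<in> G}"

definition ad_nilpotent :: "(quat^'n^'n) set \<Rightarrow> quat^'n^'n \<Rightarrow> bool"
  where "ad_nilpotent \<gg> y \<longleftrightarrow> y \<in> \<gg> \<and> (\<exists>k. \<forall>X\<in>\<gg>. (lie_bracket y ^^ k) X = 0)"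

definition nilpotent_orbit :: "(quat^'n^'n) set \<Rightarrow> bool"
  where "nilpotent_orbit \<O> \<longleftrightarrow> (\<exists>y. ad_nilpotent sl_quat y \<and> \<O> = adjoint_orbit SL_quat y)"

section \<open>Killing form and symplectic form of an adjoint orbit\<close>

definition trace_on :: "'a::real_vector set \<Rightarrow> ('a \<Rightarrow> 'a) \<Rightarrow> real"
  where "trace_on S f = (let B = (SOME B. independent B \<and> span B = S)
    in \<Sum>b\<in>B. representation B (f b) b)"

definition killing_form :: "(quat^'n^'n) set \<Rightarrow> quat^'n^'n \<Rightarrow> quat^'n^'n \<Rightarrow> real"
  where "killing_form \<gg> X Y = trace_on \<gg> (\<lambda>Z. lie_bracket X (lie_bracket Y Z))"

definition orbit_tangent :: "(quat^'n^'n) set \<Rightarrow> quat^'n^'n \<Rightarrow> (quat^'n^'n) set"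
  where "orbit_tangent \<gg> y = {lie_bracket X y |X. X \<in> \<gg>}"

text \<open>The value does not depend on the choice of \<open>X\<close> and \<open>Y\<close>, by invariance of the Killing form.\<close>

definition orbit_symplectic_form ::
    "(quat^'n^'n) set \<Rightarrow> quat^'n^'n \<Rightarrow> quat^'n^'n \<Rightarrow> quat^'n^'n \<Rightarrow> real"
  where "orbit_symplectic_form \<gg> y u v = (THE c. \<exists>X\<in>\<gg>. \<exists>Y\<in>\<gg>.
    u = lie_bracket X y \<and> v = lie_bracket Y y \<and> c = killing_form \<gg> y (lie_bracket X Y))"

section \<open>Liouville measure and Gibbs states\<close>

text \<open>
  The \<open>m\<close>-fold exterior power of a 2-form, evaluated on the vectors \<open>v 0, \<dots>, v (2m - 1)\<close>. The
  normalisation is \<open>(\<alpha> \<and> \<beta>)(v\<^sub>1, \<dots>) = 1 / (p! q!) * \<Sum>\<sigma>. sgn \<sigma> * \<alpha> (v\<^sub>\<sigma>\<^sub>1, \<dots>) * \<beta> (\<dots>)\<close>.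
\<close>

definition two_form_power :: "('a \<Rightarrow> 'a \<Rightarrow> real) \<Rightarrow> nat \<Rightarrow> (nat \<Rightarrow> 'a) \<Rightarrow> real"
  where "two_form_power \<omega> m v = (\<Sum>\<sigma> | \<sigma> permutes {..<2 * m}.
    of_int (sign \<sigma>) * (\<Prod>k<m. \<omega> (v (\<sigma> (2 * k))) (v (\<sigma> (2 * k + 1))))) / 2 ^ m"

text \<open>
  The dimension of an orbit is not fixed by the type of its ambient space, so the coordinate space
  of dimension \<open>d\<close> is the space of extensional functions on \<open>{..<d}\<close>, with its product topology
  and with Lebesgue measure \<open>\<Pi>\<^sub>M i\<in>{..<d}. lborel\<close>.
\<close>

definition partial_deriv ::
    "((nat \<Rightarrow> real) \<Rightarrow> 'a::real_normed_vector) \<Rightarrow> nat \<Rightarrow> (nat \<Rightarrow> real) \<Rightarrow> 'a"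
  where "partial_deriv \<phi> i x = vector_derivative (\<lambda>t. \<phi> (x(i := t))) (at (x i))"

text \<open>
  Local parametrisations of an orbit: injective \<open>C\<^sup>1\<close> maps on an open set, with values in the orbit,
  whose partial derivatives form a basis of the tangent space (so \<open>d\<close> is the dimension of the
  orbit). Continuous differentiability is all that the change of variables formula needs, so that
  further smoothness of the charts would not change the measure below.
\<close>

definition orbit_chart :: "(quat^'n^'n) set \<Rightarrow> (quat^'n^'n) set \<Rightarrow> nat \<Rightarrow> (nat \<Rightarrow> real) set \<Rightarrow>
    ((nat \<Rightarrow> real) \<Rightarrow> quat^'n^'n) \<Rightarrow> bool"
  where "orbit_chart \<gg> \<O> d U \<phi> \<longleftrightarrow>
    openin (powertop_real {..<d}) U \<and> inj_on \<phi> U \<and> \<phi> ` U \<subseteq> \<O> \<and>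
    continuous_map (subtopology (powertop_real {..<d}) U) euclidean \<phi> \<and>
    (\<forall>i<d. (\<forall>x\<in>U. (\<lambda>t. \<phi> (x(i := t))) differentiable at (x i)) \<and>
      continuous_map (subtopology (powertop_real {..<d}) U) euclidean (partial_deriv \<phi> i)) \<and>
    (\<forall>x\<in>U. inj_on (\<lambda>i. partial_deriv \<phi> i x) {..<d} \<and>
      independent ((\<lambda>i. partial_deriv \<phi> i x) ` {..<d}) \<and>
      span ((\<lambda>i. partial_deriv \<phi> i x) ` {..<d}) = orbit_tangent \<gg> (\<phi> x))"

text \<open>The density, in the coordinates \<open>\<phi>\<close>, of the absolute value of the Liouville form.\<close>

definition liouville_density ::
    "(quat^'n^'n) set \<Rightarrow> nat \<Rightarrow> ((nat \<Rightarrow> real) \<Rightarrow> quat^'n^'n) \<Rightarrow> (nat \<Rightarrow> real) \<Rightarrow> real"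
  where "liouville_density \<gg> d \<phi> x =
    \<bar>two_form_power (orbit_symplectic_form \<gg> (\<phi> x)) (d div 2) (\<lambda>i. partial_deriv \<phi> i x)\<bar>"

text \<open>
  A chart piece is a Borel subset of a chart domain. The Liouville measure of \<open>A\<close> is the supremum
  of the total volumes of finite families of chart pieces with pairwise disjoint images in \<open>A\<close>.
  As an orbit is covered by countably many charts, this is the measure given by
  \<open>\<phi>(S) \<mapsto> \<integral>\<^sub>S liouville_density\<close> in every chart.
\<close>

type_synonym 'a piece = "nat \<times> (nat \<Rightarrow> real) set \<times> ((nat \<Rightarrow> real) \<Rightarrow> 'a)"

fun orbit_piece :: "(quat^'n^'n) set \<Rightarrow> (quat^'n^'n) set \<Rightarrow> (quat^'n^'n) piece \<Rightarrow> bool"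
  where "orbit_piece \<gg> \<O> (d, S, \<phi>) \<longleftrightarrow>
    S \<in> sets (\<Pi>\<^sub>M i\<in>{..<d}. lborel) \<and> (\<exists>U. orbit_chart \<gg> \<O> d U \<phi> \<and> S \<subseteq> U)"

fun piece_image :: "'a piece \<Rightarrow> 'a set"
  where "piece_image (d, S, \<phi>) = \<phi> ` S"

fun piece_volume :: "(quat^'n^'n) set \<Rightarrow> (quat^'n^'n) piece \<Rightarrow> ennreal"
  where "piece_volume \<gg> (d, S, \<phi>) =
    (\<integral>\<^sup>+x\<in>S. ennreal (liouville_density \<gg> d \<phi> x) \<partial>(\<Pi>\<^sub>M i\<in>{..<d}. lborel))"

definition piece_families ::
    "(quat^'n^'n) set \<Rightarrow> (quat^'n^'n) set \<Rightarrow> (quat^'n^'n) set \<Rightarrow> (quat^'n^'n) piece set set"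
  where "piece_families \<gg> \<O> A = {F. finite F \<and> (\<forall>p\<in>F. orbit_piece \<gg> \<O> p) \<and>
    disjoint_family_on piece_image F \<and> (\<Union>p\<in>F. piece_image p) \<subseteq> A}"

definition liouville_measure ::
    "(quat^'n^'n) set \<Rightarrow> (quat^'n^'n) set \<Rightarrow> (quat^'n^'n) measure"
  where "liouville_measure \<gg> \<O> = measure_of \<O> (sets (restrict_space borel \<O>))
    (\<lambda>A. SUP F\<in>piece_families \<gg> \<O> A. \<Sum>p\<in>F. piece_volume \<gg> p)"

definition partition_function ::
    "(quat^'n^'n) set \<Rightarrow> (quat^'n^'n) set \<Rightarrow> (quat^'n^'n \<Rightarrow> real) \<Rightarrow> ennreal"
  where "partition_function \<gg> \<O> \<beta> = (\<integral>\<^sup>+y. ennreal (exp (- \<beta> y)) \<partial>liouville_measure \<gg> \<O>)"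

text \<open>
  Every linear functional on \<open>\<gg>\<close> extends to the ambient matrix space, and the partition function
  only depends on the restriction to \<open>\<gg>\<close>.
\<close>

definition admits_gibbs_states :: "(quat^'n^'n) set \<Rightarrow> (quat^'n^'n) set \<Rightarrow> bool"
  where "admits_gibbs_states \<gg> \<O> \<longleftrightarrow> (\<exists>\<beta>. linear \<beta> \<and> partition_function \<gg> \<O> \<beta> < \<infinity>)"

end

theory Submission
  imports Defs "HOL-Computational_Algebra.Fundamental_Theorem_Algebra"
begin

text \<open>
  The determinant of \<open>complex_rep g\<close> is nonnegative, so a positive multiple of every invertible \<open>g\<close>
  lies in \<open>SL(n,\<H>)\<close>, and the orbits of \<open>SL(n,\<H>)\<close> are those of \<open>GL(n,\<H>)\<close>. A nilpotent complex
  matrix \<open>N\<close> is similar to \<open>t N\<close> for every \<open>t \<noteq> 0\<close>. If \<open>E N = t N E\<close> with \<open>N = complex_rep y\<close> and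
  \<open>E = complex_rep A + \<i> complex_rep B\<close>, then \<open>g y = t y g\<close> for all \<open>g = A + r B\<close> with \<open>r\<close> real, and
  \<open>det (complex_rep g)\<close> is a polynomial in \<open>r\<close> that does not vanish at \<open>r = \<i>\<close>, hence not at some
  real \<open>r\<close>. So a nilpotent orbit is stable under multiplication by every \<open>t \<noteq> 0\<close>, in particular
  under negation.

  Multiplication by \<open>t\<close> multiplies the Liouville density of an orbit of dimension \<open>2m\<close> by \<open>\<bar>t\<bar>^m\<close>. Given
  a linear functional \<open>\<beta>\<close>, a chart piece of positive volume contains one on which \<open>\<beta>\<close> has constant
  sign; scaling the latter by \<open>t\<close> or by \<open>- t\<close> moves it into the half space \<open>\<beta> \<le> 0\<close>, which therefore
  has infinite measure, while the integrand is at least \<open>1\<close> there.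
\<close>

section \<open>Quaternionic matrices as complex matrices\<close>

text \<open>Nonnegativity of the determinant is where the quaternions differ from the reals: in
  \<open>GL(n,R)\<close> a negative determinant cannot be removed by a positive factor, and already
  in \<open>sl(2,R)\<close> a nonzero nilpotent element and its negative have different
  \<open>SL\<close>-orbits. Nilpotency is given for the adjoint action on \<open>sl_quat\<close>,
  whereas the similarity with \<open>t N\<close> concerns a nilpotent matrix. The adjoint action
  determines a matrix only up to a scalar, so the trace condition has to enter. The volume argument
  works with lower bounds only: one chart around \<open>y\<close> whose density stays above a
  positive constant, together with its dilates. Such a chart comes from a symplectic basis for the
  form \<open>\<kappa>(y, [X, Y])\<close> in the variables \<open>X\<close> and \<open>Y\<close>.
  The radical of this form is the centralizer of \<open>y\<close>, so the basis spans a complement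
  of the centralizer, and at the centre of the chart the density is visibly positive.\<close>

lemma bounded_bilinear_matrix_mult:
  "bounded_bilinear ((**) :: 'a::{euclidean_space,real_algebra_1}^'n^'m \<Rightarrow> 'a^'p^'n \<Rightarrow> 'a^'p^'m)"
proof -
  have "bilinear ((**) :: 'a^'n^'m \<Rightarrow> 'a^'p^'n \<Rightarrow> 'a^'p^'m)"
    unfolding bilinear_def
  proof (intro conjI allI linearI)
    fix x y z and r :: real
    show "x ** (y + z) = x ** y + x ** (z :: 'a^'p^'n)" for x :: "'a^'n^'m"
      by (rule matrix_add_ldistrib)
    show "(x + y) ** z = x ** z + y ** z" for x y :: "'a^'n^'m" and z :: "'a^'p^'n"
      by (simp add: matrix_matrix_mult_def vec_eq_iff sum.distrib distrib_right)
    show "(r *\<^sub>R x) ** z = r *\<^sub>R (x ** z)" for x :: "'a^'n^'m" and z :: "'a^'p^'n"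
      by (rule scalar_matrix_assoc[symmetric])
    show "x ** (r *\<^sub>R z) = r *\<^sub>R (x ** z)" for x :: "'a^'n^'m" and z :: "'a^'p^'n"
      using matrix_scalar_ac[of x r z] scalar_matrix_assoc[of r x z] by simp
  qed
  then show ?thesis
    by (simp add: bilinear_conv_bounded_bilinear)
qed

interpretation qmm: bounded_bilinear "(**) :: quat^'n^'n \<Rightarrow> quat^'n^'n \<Rightarrow> quat^'n^'n"
  by (rule bounded_bilinear_matrix_mult)

interpretation cmm: bounded_bilinear "(**) :: complex^'n^'n \<Rightarrow> complex^'n^'n \<Rightarrow> complex^'n^'n"
  by (rule bounded_bilinear_matrix_mult)

lemmas qmm_distribs = qmm.add_left qmm.add_right qmm.diff_left qmm.diff_right
  qmm.scaleR_left qmm.scaleR_right qmm.minus_left qmm.minus_right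

lemmas cmm_distribs = cmm.add_left cmm.add_right cmm.diff_left cmm.diff_right
  cmm.scaleR_left cmm.scaleR_right cmm.minus_left cmm.minus_right

lemmas quat_sel_simps = zero_quat_def one_quat_def plus_quat_def minus_quat_def uminus_quat_def
  times_quat_def scaleR_quat_def

lemma quat_sel_sum:
  "qRe (sum f A) = (\<Sum>x\<in>A. qRe (f x))" "qI (sum f A) = (\<Sum>x\<in>A. qI (f x))"
  "qJ (sum f A) = (\<Sum>x\<in>A. qJ (f x))" "qK (sum f A) = (\<Sum>x\<in>A. qK (f x))"
  by (induction A rule: infinite_finite_induct) (auto simp: quat_sel_simps)

text \<open>Moving \<open>j\<close> past a complex number conjugates it, which produces the
  conjugates on the second factor.\<close>

lemma quat_fst_snd_mult:
  "quat_fst (p * q) = quat_fst p * quat_fst q - quat_snd p * cnj (quat_snd q)"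
  "quat_snd (p * q) = quat_fst p * quat_snd q + quat_snd p * cnj (quat_fst q)"
  by (auto simp: quat_fst_def quat_snd_def times_quat_def complex_eq_iff)

lemma quat_fst_snd_simps [simp]:
  "quat_fst (p + q) = quat_fst p + quat_fst q" "quat_snd (p + q) = quat_snd p + quat_snd q"
  "quat_fst (r *\<^sub>R p) = r *\<^sub>R quat_fst p" "quat_snd (r *\<^sub>R p) = r *\<^sub>R quat_snd p"
  "quat_fst 0 = 0" "quat_snd 0 = 0" "quat_fst 1 = 1" "quat_snd 1 = 0"
  by (auto simp: quat_fst_def quat_snd_def quat_sel_simps complex_eq_iff)

lemma quat_fst_snd_sum:
  "quat_fst (sum f A) = (\<Sum>x\<in>A. quat_fst (f x))" "quat_snd (sum f A) = (\<Sum>x\<in>A. quat_snd (f x))"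
  by (induction A rule: infinite_finite_induct) auto

lemma sum_UNIV_Plus:
  "sum f (UNIV :: ('a::finite + 'b::finite) set) = (\<Sum>i\<in>UNIV. f (Inl i)) + (\<Sum>i\<in>UNIV. f (Inr i))"
  by (simp add: UNIV_Plus_UNIV[symmetric] sum.Plus del: UNIV_Plus_UNIV)

lemma complex_rep_nth [simp]:
  "complex_rep A $ Inl i $ Inl j = quat_fst (A $ i $ j)"
  "complex_rep A $ Inl i $ Inr j = quat_snd (A $ i $ j)"
  "complex_rep A $ Inr i $ Inl j = - cnj (quat_snd (A $ i $ j))"
  "complex_rep A $ Inr i $ Inr j = cnj (quat_fst (A $ i $ j))"
  by (simp_all add: complex_rep_def)

lemma vec_eq_iff_Plus: "x = y \<longleftrightarrow> (\<forall>i. x $ Inl i = y $ Inl i) \<and> (\<forall>i. x $ Inr i = y $ Inr i)"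
  for x y :: "'c ^ ('a::finite + 'b::finite)"
  unfolding vec_eq_iff by (metis sum.exhaust)

lemma complex_rep_mult: "complex_rep (A ** B) = complex_rep A ** complex_rep B"
  by (auto simp: vec_eq_iff_Plus matrix_matrix_mult_def sum_UNIV_Plus quat_fst_snd_sum
      quat_fst_snd_mult sum_subtractf sum.distrib sum_negf algebra_simps)

lemma complex_rep_add: "complex_rep (A + B) = complex_rep A + complex_rep B"
  by (auto simp: vec_eq_iff_Plus)

lemma complex_rep_scaleR: "complex_rep (r *\<^sub>R A) = r *\<^sub>R complex_rep A"
  by (auto simp: vec_eq_iff_Plus)

lemma linear_complex_rep: "linear complex_rep"
  by (simp add: linearI complex_rep_add complex_rep_scaleR)

lemma complex_rep_mat_1: "complex_rep (mat 1 :: quat^'n^'n) = mat 1"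
  by (auto simp: vec_eq_iff_Plus mat_def)

text \<open>\<open>M = complex_rep (quat_part M) + \<i> complex_rep (quat_part (- \<i> M))\<close>: complex matrices are the
  complexification of the quaternionic ones.\<close>

definition quat_part :: "complex^('n::finite + 'n)^('n + 'n) \<Rightarrow> quat^'n^'n"
  where "quat_part M = (\<chi> i j. Quat
     ((Re (M $ Inl i $ Inl j) + Re (M $ Inr i $ Inr j)) / 2) ((Im (M $ Inl i $ Inl j) - Im (M $ Inr i $ Inr j)) / 2)
     ((Re (M $ Inl i $ Inr j) - Re (M $ Inr i $ Inl j)) / 2) ((Im (M $ Inl i $ Inr j) + Im (M $ Inr i $ Inl j)) / 2))"

definition cscale :: "complex \<Rightarrow> complex^'n^'m \<Rightarrow> complex^'n^'m"
  where "cscale z M = (\<chi> i j. z * M $ i $ j)"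

lemma cscale_nth [simp]: "cscale z M $ i $ j = z * M $ i $ j"
  by (simp add: cscale_def)

lemma cscale_mult: "cscale z A ** B = cscale z (A ** B)" "A ** cscale z B = cscale z (A ** B)"
  by (auto simp: vec_eq_iff matrix_matrix_mult_def sum_distrib_left mult_ac)

lemma complex_rep_quat_part:
  "complex_rep (quat_part M) + cscale \<i> (complex_rep (quat_part (cscale (- \<i>) M))) = M"
  by (auto simp: vec_eq_iff_Plus quat_part_def quat_fst_def quat_snd_def complex_eq_iff field_simps)

text \<open>\<open>quat_part\<close> annihilates \<open>\<i>\<close> times a quaternionic matrix, so
  it reads off both components. In this way a complex matrix equation descends to a pair of
  quaternionic ones.\<close>

lemma complex_rep_decomposition_unique:
  assumes "complex_rep A + cscale \<i> (complex_rep B) = complex_rep A' + cscale \<i> (complex_rep B')"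
  shows "A = A' \<and> B = B'"
proof -
  have "quat_part (complex_rep A + cscale \<i> (complex_rep B)) = A" for A B :: "quat^'n^'n"
    by (auto simp: vec_eq_iff quat_part_def quat_eq_iff quat_fst_def quat_snd_def)
  moreover have "quat_part (cscale (-\<i>) (complex_rep A + cscale \<i> (complex_rep B))) = B" for A B :: "quat^'n^'n"
    by (auto simp: vec_eq_iff quat_part_def quat_eq_iff quat_fst_def quat_snd_def)
  ultimately show ?thesis
    using assms by metis
qed

text \<open>The complex inverse \<open>h\<close> splits as \<open>a + \<i> b\<close>; comparing both
  products with \<open>mat 1 + \<i> 0\<close> shows that \<open>a\<close> is a two-sided
  quaternionic inverse.\<close>

lemma invertibleI_complex_rep:
  assumes "det (complex_rep g) \<noteq> 0"
  shows "invertible g"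
proof -
  obtain h where h: "complex_rep g ** h = mat 1" "h ** complex_rep g = mat 1"
    using assms unfolding invertible_det_nz[symmetric] invertible_def by blast
  define a where "a = quat_part h"
  define b where "b = quat_part (cscale (-\<i>) h)"
  have hab: "h = complex_rep a + cscale \<i> (complex_rep b)"
    by (simp add: a_def b_def complex_rep_quat_part)
  have "complex_rep (g ** a) + cscale \<i> (complex_rep (g ** b)) = complex_rep (mat 1) + cscale \<i> (complex_rep 0)"
    using h(1) by (simp add: hab cmm_distribs complex_rep_mult cscale_mult complex_rep_mat_1)
      (simp add: vec_eq_iff_Plus)
  then have 1: "g ** a = mat 1"
    using complex_rep_decomposition_unique by blast
  have "complex_rep (a ** g) + cscale \<i> (complex_rep (b ** g)) = complex_rep (mat 1) + cscale \<i> (complex_rep 0)"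
    using h(2) by (simp add: hab cmm_distribs complex_rep_mult cscale_mult complex_rep_mat_1)
      (simp add: vec_eq_iff_Plus)
  then have 2: "a ** g = mat 1"
    using complex_rep_decomposition_unique by blast
  show ?thesis
    using 1 2 unfolding invertible_def by blast
qed

lemma invertible_iff_complex_rep: "invertible g \<longleftrightarrow> det (complex_rep g) \<noteq> 0"
proof
  assume "invertible g"
  then obtain h where "g ** h = mat 1"
    unfolding invertible_def by blast
  then have "det (complex_rep g) * det (complex_rep h) = 1"
    by (metis complex_rep_mult complex_rep_mat_1 det_mul det_I)
  then show "det (complex_rep g) \<noteq> 0"
    by auto
qed (rule invertibleI_complex_rep)

lemma matrix_inv_props:
  assumes "invertible (A :: 'a::semiring_1^'n^'n)"
  shows "A ** matrix_inv A = mat 1" "matrix_inv A ** A = mat 1"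
proof -
  have "A ** matrix_inv A = mat 1 \<and> matrix_inv A ** A = mat 1"
    unfolding matrix_inv_def by (rule someI_ex) (use assms invertible_def in blast)
  then show "A ** matrix_inv A = mat 1" "matrix_inv A ** A = mat 1"
    by auto
qed

lemma matrix_inv_unique:
  assumes "A ** B = mat 1" "B ** (A :: 'a::semiring_1^'n^'n) = mat 1"
  shows "matrix_inv A = B"
  using assms matrix_inv_props[of A] unfolding invertible_def
  by (metis matrix_mul_assoc matrix_mul_lid matrix_mul_rid)

lemma det_cnj: "det (\<chi> i j. cnj (M $ i $ j)) = cnj (det M)"
  by (simp add: det_def)

text \<open>The diagonal matrix \<open>J\<close> with entries \<open>j\<close> intertwines
  \<open>complex_rep g\<close> with its entrywise conjugate, and \<open>det (complex_rep J)\<close>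
  is nonzero, so the two determinants agree.\<close>

lemma det_complex_rep_real: "cnj (det (complex_rep g)) = det (complex_rep g)"
proof -
  define J :: "quat^'a^'a" where "J = mat (Quat 0 0 1 0)"
  have J_nth: "J $ i $ j = (if i = j then Quat 0 0 1 0 else 0)" for i j
    by (simp add: J_def mat_def)
  have "J ** (- J) = mat 1"
  proof (simp add: vec_eq_iff, intro allI)
    fix i j
    have "(J ** (- J)) $ i $ j = (\<Sum>k\<in>UNIV. if k = i then (if i = j then 1 else 0) else 0)"
      unfolding matrix_matrix_mult_def vec_lambda_beta
      by (intro sum.cong refl) (auto simp: J_nth quat_eq_iff quat_sel_simps)
    then show "(J ** (- J)) $ i $ j = mat 1 $ i $ j"
      by (simp add: mat_def)
  qed
  then have JJ: "complex_rep J ** complex_rep (- J) = mat 1"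
    by (simp only: complex_rep_mult[symmetric] complex_rep_mat_1)
  have nz: "det (complex_rep J) \<noteq> 0"
    using arg_cong[OF JJ, of det] by (auto simp: det_mul)
  have "complex_rep g ** complex_rep J = complex_rep J ** (\<chi> i j. cnj (complex_rep g $ i $ j))"
  proof -
    have "quat_fst (J $ i $ j) = 0" "quat_snd (J $ i $ j) = (if i = j then 1 else 0)" for i j
      by (auto simp: J_nth quat_fst_def quat_snd_def quat_sel_simps complex_eq_iff)
    then show ?thesis
      by (auto simp: vec_eq_iff_Plus matrix_matrix_mult_def sum_UNIV_Plus if_distrib[of cnj]
          if_distrib[of uminus] if_distrib[of "\<lambda>x. x * _"] if_distrib[of "\<lambda>x. _ * x"] cong: if_cong)
  qed
  from arg_cong[OF this, of det] show ?thesis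
    using nz by (simp add: det_mul det_cnj)
qed

section \<open>Positivity of the determinant\<close>

lemma quat_right_inverse:
  assumes "q \<noteq> (0::quat)"
  obtains p where "q * p = 1" "p * q = 1"
proof -
  define N where "N = qRe q ^ 2 + qI q ^ 2 + qJ q ^ 2 + qK q ^ 2"
  have "N \<noteq> 0"
    using assms by (auto simp: N_def quat_eq_iff quat_sel_simps add_nonneg_eq_0_iff)
  then obtain c where "N * c = 1"
    by (metis right_inverse)
  then have "(qRe q * qRe q + qI q * qI q + qJ q * qJ q + qK q * qK q) * c = 1"
    by (simp add: N_def power2_eq_square)
  then show ?thesis
    by (intro that[of "c *\<^sub>R Quat (qRe q) (- qI q) (- qJ q) (- qK q)"])
      (simp_all add: quat_eq_iff quat_sel_simps algebra_simps)
qed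

text \<open>The root is taken in a copy of the complex plane containing \<open>p\<close>, by the
  half-angle formula \<open>(r + p) / sqrt (2 (r + Re p))\<close> with \<open>r = |p|\<close>; when
  \<open>p = - r\<close> the direction \<open>i\<close> is chosen. The bound on \<open>qRe s\<close>
  guarantees later that \<open>1 + s\<close> is invertible.\<close>

lemma quat_sqrt:
  obtains s :: quat where "s * s = p" "0 \<le> qRe s"
proof -
  define r where "r = sqrt (qRe p ^ 2 + qI p ^ 2 + qJ p ^ 2 + qK p ^ 2)"
  have r2: "r * r = qRe p ^ 2 + qI p ^ 2 + qJ p ^ 2 + qK p ^ 2"
    by (simp add: r_def)
  have le: "\<bar>qRe p\<bar> \<le> r"
    unfolding r_def by (rule real_le_rsqrt) simp
  show ?thesis
  proof (cases "r + qRe p = 0")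
    case True
    then have "qRe p ^ 2 = r * r"
      by (simp add: power2_eq_square add_eq_0_iff)
    then have "qI p ^ 2 + qJ p ^ 2 + qK p ^ 2 = 0"
      using r2 by simp
    then have "qI p = 0" "qJ p = 0" "qK p = 0"
      by (simp_all add: add_nonneg_eq_0_iff)
    moreover have "0 \<le> r" using le by simp
    ultimately show ?thesis
      using True by (intro that[of "Quat 0 (sqrt r) 0 0"]) (simp_all add: quat_eq_iff quat_sel_simps)
  next
    case False
    then have pos: "r + qRe p > 0"
      using le by linarith
    define h where "h = sqrt (2 * (r + qRe p))"
    have h2: "h * h = 2 * (r + qRe p)" and h: "h > 0"
      using pos by (simp_all add: h_def)
    define s where "s = (1 / h) *\<^sub>R Quat (r + qRe p) (qI p) (qJ p) (qK p)"
    have eq: "x / h * (y / h) = x * y / (2 * (r + qRe p))" for x y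
      by (simp add: h2)
    have "(r + qRe p) * (r + qRe p) - qI p * qI p - qJ p * qJ p - qK p * qK p = qRe p * (2 * (r + qRe p))"
      using r2 by (simp add: power2_eq_square algebra_simps)
    then have "s * s = p"
      using pos by (simp add: s_def quat_eq_iff quat_sel_simps eq diff_divide_distrib[symmetric]
        add_divide_distrib[symmetric] divide_eq_eq) (use h h2 in \<open>simp add: algebra_simps\<close>)
    moreover have "0 \<le> qRe s"
      using pos h by (simp add: s_def quat_sel_simps)
    ultimately show ?thesis
      using that by blast
  qed
qed

text \<open>Left multiplication by it is a step of Gauss elimination: multiples of row
  \<open>k\<close> are added to the other rows and row \<open>k\<close> is scaled.\<close>

definition column_mat :: "'n \<Rightarrow> ('n \<Rightarrow> quat) \<Rightarrow> quat^'n^'n"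
  where "column_mat k v = (\<chi> i j. if j = k then v i else if i = j then 1 else 0)"

lemma column_mat_mult:
  "(column_mat k v ** g) $ i $ j = (if i = k then 0 else g $ i $ j) + v i * g $ k $ j"
proof -
  have "(column_mat k v ** g) $ i $ j =
      (\<Sum>l\<in>UNIV. (if l = i then (if i = k then 0 else g $ i $ j) else 0) + (if l = k then v i * g $ k $ j else 0))"
    unfolding matrix_matrix_mult_def vec_lambda_beta
    by (intro sum.cong refl) (auto simp: column_mat_def)
  then show ?thesis
    by (simp add: sum.distrib)
qed

text \<open>A matrix that differs from the identity in one column has a square root of the same kind,
  because every quaternion has one; and the determinant of the root is real.\<close>

lemma det_complex_rep_column_mat: "0 \<le> Re (det (complex_rep (column_mat k v)))"
proof -
  obtain s where s: "s * s = v k" "0 \<le> qRe s"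
    by (rule quat_sqrt)
  then have "1 + s \<noteq> 0"
    by (auto simp: quat_eq_iff quat_sel_simps)
  then obtain u where u: "u * (1 + s) = 1"
    by (rule quat_right_inverse)
  \<comment> \<open>In the square, the entry of column \<open>k\<close> in row
    \<open>i \<noteq> k\<close> is \<open>w i * (1 + s)\<close> and the diagonal one is
    \<open>s * s\<close>; hence the division by \<open>1 + s\<close>.\<close>
  define w where "w = (\<lambda>i. if i = k then s else v i * u)"
  have w: "v i = w i + w i * s" if "i \<noteq> k" for i
    using u that by (simp add: w_def mult.assoc distrib_left[symmetric] del: distrib_left)
      (metis distrib_left mult.right_neutral)
  have "column_mat k v = column_mat k w ** column_mat k w"
    unfolding vec_eq_iff column_mat_mult using w s by (auto simp: column_mat_def w_def)
  then have "det (complex_rep (column_mat k v)) = det (complex_rep (column_mat k w)) ^ 2"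
    by (simp add: complex_rep_mult det_mul power2_eq_square)
  moreover have "Im (det (complex_rep (column_mat k w))) = 0"
    using arg_cong[OF det_complex_rep_real, of Im "column_mat k w"] by simp
  ultimately show ?thesis
    by (simp add: power2_eq_square)
qed

lemma continuous_on_det_complex [continuous_intros]:
  fixes f :: "'a::topological_space \<Rightarrow> complex^'n^'n"
  assumes "continuous_on S f"
  shows "continuous_on S (\<lambda>x. det (f x))"
  unfolding det_def by (intro continuous_intros assms)

lemma bounded_linear_complex_rep: "bounded_linear complex_rep"
  using linear_complex_rep linear_conv_bounded_linear by blast

lemma continuous_on_complex_rep [continuous_intros]:
  "continuous_on S f \<Longrightarrow> continuous_on S (\<lambda>x. complex_rep (f x))"
  by (rule bounded_linear.continuous_on[OF bounded_linear_complex_rep])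

text \<open>Induction on the set \<open>K\<close> of columns in which \<open>g\<close> may differ
  from the identity. A nonzero pivot allows a \<open>column_mat\<close> to be factored out, whose
  determinant is already known to be nonnegative; a zero pivot is reached as a limit. This takes the
  place of connectedness of \<open>GL(n,H)\<close>.\<close>

lemma det_complex_rep_nonneg: "0 \<le> Re (det (complex_rep (g :: quat^'n^'n)))"
proof -
  have "\<forall>g :: quat^'n^'n. (\<forall>j. j \<notin> K \<longrightarrow> (\<forall>i. g $ i $ j = (if i = j then 1 else 0))) \<longrightarrow>
     0 \<le> Re (det (complex_rep g))" for K :: "'n set"
  proof (induction K rule: finite_induct[OF finite])
    case 1
    show ?case
    proof (intro allI impI)
      fix g :: "quat^'n^'n"
      assume "\<forall>j. j \<notin> {} \<longrightarrow> (\<forall>i. g $ i $ j = (if i = j then 1 else 0))"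
      then have "g = mat 1"
        by (auto simp: vec_eq_iff mat_def)
      then show "0 \<le> Re (det (complex_rep g))"
        by (simp add: complex_rep_mat_1)
    qed
  next
    case (2 k K)
    have main: "0 \<le> Re (det (complex_rep g))"
      if g: "\<forall>j. j \<notin> insert k K \<longrightarrow> (\<forall>i. g $ i $ j = (if i = j then 1 else 0))" and nz: "g $ k $ k \<noteq> 0"
      for g :: "quat^'n^'n"
    proof -
      obtain q where q: "g $ k $ k * q = 1"
        using nz by (rule quat_right_inverse)
      \<comment> \<open>\<open>h\<close> is \<open>g\<close> after elimination with pivot
        \<open>g $ k $ k\<close>: its column \<open>k\<close> is that of the identity, and the unit
        columns of \<open>g\<close> outside \<open>insert k K\<close> are unchanged, so the
        induction hypothesis applies.\<close>
      define h :: "quat^'n^'n" where "h = (\<chi> i j. if j = k then (if i = k then 1 else 0)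
        else if i = k then q * g $ k $ j else g $ i $ j - g $ i $ k * (q * g $ k $ j))"
      have "g = column_mat k (\<lambda>i. g $ i $ k) ** h"
        unfolding vec_eq_iff column_mat_mult
        by (auto simp: h_def mult.assoc[symmetric] q)
      then have "det (complex_rep g) = det (complex_rep (column_mat k (\<lambda>i. g $ i $ k))) * det (complex_rep h)"
        by (metis complex_rep_mult det_mul)
      moreover have "0 \<le> Re (det (complex_rep h))"
        using g 2 by (auto simp: h_def)
      moreover have "Im (det (complex_rep h)) = 0"
        using arg_cong[OF det_complex_rep_real, of Im h] by simp
      ultimately show ?thesis
        using det_complex_rep_column_mat[of k "\<lambda>i. g $ i $ k"] by simp
    qed
    show ?case
    proof (intro allI impI)
      fix g :: "quat^'n^'n"
      assume g: "\<forall>j. j \<notin> insert k K \<longrightarrow> (\<forall>i. g $ i $ j = (if i = j then 1 else 0))"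
      show "0 \<le> Re (det (complex_rep g))"
      proof (cases "g $ k $ k = 0")
        case True
        \<comment> \<open>Perturbing the pivot alone changes no column outside
          \<open>insert k K\<close>; the inequality survives as \<open>e\<close> decreases to
          \<open>0\<close>.\<close>
        define E :: "quat^'n^'n" where "E = (\<chi> i j. if i = k \<and> j = k then 1 else 0)"
        define f where "f = (\<lambda>e::real. Re (det (complex_rep (g + e *\<^sub>R E))))"
        have pos: "0 \<le> f e" if "e > 0" for e
          unfolding f_def
          using that True g by (intro main) (auto simp: E_def)
        have "continuous_on UNIV f"
          unfolding f_def by (intro continuous_intros)
        then have "(f \<longlongrightarrow> f 0) (at_right 0)"
          by (simp add: continuous_on_def filterlim_at_split)
        then have "0 \<le> f 0"
          by (rule tendsto_lowerbound) (auto simp: eventually_at_right_less pos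
            intro: eventually_mono[OF eventually_at_right_less])
        then show ?thesis
          by (simp add: f_def)
      qed (use main g in blast)
    qed
  qed
  from this[of UNIV] show ?thesis
    by auto
qed

section \<open>The reduced trace and rescaling to determinant one\<close>

definition retr :: "quat^'n^'n \<Rightarrow> real"
  where "retr X = (\<Sum>i\<in>UNIV. qRe (X $ i $ i))"

lemma det_scaleR_complex: "det (r *\<^sub>R M) = of_real r ^ CARD('n) * det (M :: complex^'n^'n)"
proof -
  have "(r *\<^sub>R M) $ i $ j = complex_of_real r * M $ i $ j" for i j
    by (simp add: scaleR_conv_of_real[where 'a = complex])
  then show ?thesis
    by (simp add: det_def prod.distrib sum_distrib_left mult_ac del: vector_scaleR_component)
qed

lemma scaled_in_SL_quat:
  assumes "invertible (g :: quat^'n^'n)"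
  obtains r where "r > 0" "r *\<^sub>R g \<in> SL_quat"
proof -
  define D where "D = Re (det (complex_rep g))"
  have det: "det (complex_rep g) = of_real D"
    using arg_cong[OF det_complex_rep_real, of Im g] by (simp add: complex_eq_iff D_def)
  have D: "D > 0"
    using det_complex_rep_nonneg[of g] assms det unfolding invertible_iff_complex_rep D_def[symmetric]
    by (simp add: order_less_le)
  \<comment> \<open>The determinant of \<open>complex_rep\<close> is homogeneous of degree
    \<open>2n\<close> under real scaling.\<close>
  define r where "r = root (CARD('n + 'n)) (1 / D)"
  have n: "CARD('n + 'n) > 0"
    by simp
  have "r > 0"
    unfolding r_def using D n by (subst real_root_gt_0_iff) auto
  moreover have "r ^ CARD('n + 'n) = 1 / D"
    unfolding r_def using D n by (intro real_root_pow_pos2) auto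
  then have "det (complex_rep (r *\<^sub>R g)) = 1"
    unfolding complex_rep_scaleR det_scaleR_complex det of_real_power[symmetric]
    using D by simp
  then have "r *\<^sub>R g \<in> SL_quat"
    unfolding SL_quat_def using invertibleI_complex_rep[of "r *\<^sub>R g"] by simp
  ultimately show ?thesis
    by (rule that)
qed

lemma matrix_inv_scaleR:
  assumes "invertible (g :: quat^'n^'n)" "r \<noteq> 0"
  shows "matrix_inv (r *\<^sub>R g) = (1 / r) *\<^sub>R matrix_inv g"
  using matrix_inv_props[OF assms(1)] assms(2)
  by (intro matrix_inv_unique) (simp_all add: qmm_distribs)

lemma adjoint_orbit_SL_quat:
  "adjoint_orbit SL_quat (y :: quat^'n^'n) = {g ** y ** matrix_inv g |g. invertible g}"
proof (intro equalityI subsetI)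
  fix x :: "quat^'n^'n" assume "x \<in> {g ** y ** matrix_inv g |g. invertible g}"
  then obtain g where g: "invertible g" "x = g ** y ** matrix_inv g"
    by blast
  obtain r where r: "r > 0" "r *\<^sub>R g \<in> SL_quat"
    using g(1) by (rule scaled_in_SL_quat)
  have "x = (r *\<^sub>R g) ** y ** matrix_inv (r *\<^sub>R g)"
    using r g by (simp add: matrix_inv_scaleR qmm_distribs)
  then show "x \<in> adjoint_orbit SL_quat y"
    unfolding adjoint_orbit_def using r(2) by blast
qed (auto simp: adjoint_orbit_def SL_quat_def)

section \<open>Similarity of a nilpotent matrix to its multiples\<close>

lemma mat_vector_mult: "mat c *v x = c *s (x :: 'a::semiring_1^'n)"
  by (simp add: vec_eq_iff matrix_vector_mult_def mat_def if_distrib[of "\<lambda>x. x * _"] cong: if_cong)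

text \<open>An intertwiner of \<open>N\<close> and \<open>t N\<close> on \<open>N V\<close> extends to \<open>V\<close>: the defining equation determines it
  up to the kernel of \<open>N\<close>, and there it is taken to be the identity on a complement of \<open>N V\<close>.\<close>

lemma nilpotent_scaling_extend:
  fixes N F :: "'a::field^'n^'n"
  assumes t: "t \<noteq> 0" and V: "vec.subspace V" and W: "W = ((*v) N) ` V" "W \<subseteq> V"
    and F: "\<And>v. v \<in> W \<Longrightarrow> F *v v \<in> W" "\<And>v. v \<in> W \<Longrightarrow> F *v v = 0 \<Longrightarrow> v = 0"
      "\<And>v. v \<in> W \<Longrightarrow> F *v (N *v v) = t *s (N *v (F *v v))"
  obtains G where "\<And>v. v \<in> V \<Longrightarrow> G *v v \<in> V" "\<And>v. v \<in> V \<Longrightarrow> G *v v = 0 \<Longrightarrow> v = 0"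
    "\<And>v. v \<in> V \<Longrightarrow> G *v (N *v v) = t *s (N *v (G *v v))"
proof -
  define kV where "kV = {v \<in> V. N *v v = 0}"
  have subW: "vec.subspace W"
    unfolding W by (rule vec.linear_subspace_image[OF matrix_vector_mul_linear_gen V])
  have subK: "vec.subspace kV"
    using V by (auto simp: vec.subspace_def kV_def matrix_vector_right_distrib vec.scale)
  \<comment> \<open>\<open>W0\<close> is a basis of \<open>W\<close>, extended inside
    \<open>W0 \<union> kV\<close> to a basis \<open>B\<close> of \<open>W + kV\<close>. The added
    vectors \<open>C\<close> therefore lie in the kernel of \<open>N\<close> and span a complement
    of \<open>W\<close> in \<open>W + kV\<close>, which may be smaller than
    \<open>V\<close>.\<close>
  obtain W0 where W0: "W0 \<subseteq> W" "vec.independent W0" "W \<subseteq> vec.span W0"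
    by (rule vec.maximal_independent_subset)
  have spanW0: "vec.span W0 = W"
    using W0 subW by (metis vec.span_mono vec.span_eq_iff subset_antisym)
  obtain B where B: "W0 \<subseteq> B" "B \<subseteq> W0 \<union> kV" "vec.independent B" "W0 \<union> kV \<subseteq> vec.span B"
    using vec.maximal_independent_subset_extend[of W0 "W0 \<union> kV"] W0 by blast
  define C where "C = B - W0"
  have C: "C \<subseteq> kV"
    using B by (auto simp: C_def)
  have spanC: "vec.span C \<subseteq> kV"
    using C subK by (rule vec.span_minimal)
  have BWC: "B = W0 \<union> C"
    using B by (auto simp: C_def)
  \<comment> \<open>\<open>p\<close> and \<open>h\<close> are the projections of
    \<open>W + kV\<close> to \<open>W\<close> and to the span of \<open>C\<close>, extended to the
    whole space with the same ranges.\<close>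
  obtain p where p: "Vector_Spaces.linear (*s) (*s) p" "\<forall>x\<in>B. p x = (if x \<in> W0 then x else 0)"
    "range p = vec.span ((\<lambda>x. if x \<in> W0 then x else 0) ` B)"
    using vec.linear_independent_extend_subspace[OF B(3), of "\<lambda>x. if x \<in> W0 then x else 0"] by blast
  obtain h where h: "Vector_Spaces.linear (*s) (*s) h" "\<forall>x\<in>B. h x = (if x \<in> C then x else 0)"
    "range h = vec.span ((\<lambda>x. if x \<in> C then x else 0) ` B)"
    using vec.linear_independent_extend_subspace[OF B(3), of "\<lambda>x. if x \<in> C then x else 0"] by blast
  obtain s where s: "range s \<subseteq> V" "Vector_Spaces.linear (*s) (*s) s" "\<forall>v\<in>W. N *v (s v) = v"
    using vec.linear_exists_right_inverse_on[OF matrix_vector_mul_linear_gen[of N] V] W by blast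
  define P where "P = matrix p"
  define H where "H = matrix h"
  define S where "S = matrix s"
  have P: "P *v x = p x" and H: "H *v x = h x" and S: "S *v x = s x" for x
    by (simp_all add: P_def H_def S_def matrix_works p h s)
  have PW: "P *v x \<in> W" for x
  proof -
    have "range p \<subseteq> W"
      unfolding p(3) by (rule vec.span_minimal[OF _ subW])
        (use W0 vec.subspace_0[OF subW] in auto)
    then show ?thesis by (auto simp: P)
  qed
  have HC: "H *v x \<in> vec.span C" for x
  proof -
    have "range h \<subseteq> vec.span C"
      unfolding h(3) by (rule vec.span_minimal[OF _ vec.subspace_span])
        (auto simp: vec.span_base vec.span_zero)
    then show ?thesis by (auto simp: H)
  qed
  have eqs: "P *v w = w" "H *v w = 0" if "w \<in> W" for w
  proof -
    have *: "w \<in> vec.span W0" using that spanW0 by simp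
    have "P *v w - w = 0"
      by (rule vec.linear_eq_0_on_span[OF _ _ *, of "\<lambda>w. P *v w - w"])
        (use B p in \<open>auto intro!: vec.linear_compose_sub vec.linear_ident simp: P\<close>)
    then show "P *v w = w" by simp
    show "H *v w = 0"
      by (rule vec.linear_eq_0_on_span[OF _ _ *]) (use B h in \<open>auto simp: H C_def\<close>)
  qed
  have eqsC: "P *v c = 0" "H *v c = c" if *: "c \<in> vec.span C" for c
  proof -
    show "P *v c = 0"
      by (rule vec.linear_eq_0_on_span[OF _ _ *]) (use B p in \<open>auto simp: P C_def\<close>)
    have "H *v c - c = 0"
      by (rule vec.linear_eq_0_on_span[OF _ _ *, of "\<lambda>w. H *v w - w"])
        (use B h in \<open>auto intro!: vec.linear_compose_sub vec.linear_ident simp: H C_def\<close>)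
    then show "H *v c = c" by simp
  qed
  \<comment> \<open>On \<open>W\<close> this is \<open>F\<close>. The middle term, a preimage under
    \<open>N\<close>, makes up the defect of \<open>F P v\<close> in the equation
    \<open>F (N v) = t N (G v)\<close>. The last term \<open>H\<close> is the identity on the span
    of \<open>C\<close>, which keeps \<open>G\<close> injective on the kernel of
    \<open>N\<close>.\<close>
  define G where "G = F ** P + S ** mat (1 / t) ** F ** N ** (mat 1 - P) + H"
  have G: "G *v v = F *v (P *v v) + S *v ((1 / t) *s (F *v (N *v v - N *v (P *v v)))) + H *v v" for v
    by (simp add: G_def matrix_vector_mult_add_rdistrib matrix_vector_mul_assoc[symmetric] mat_vector_mult
        matrix_vector_mult_diff_rdistrib matrix_vector_mult_diff_distrib)
  have NV: "N *v v \<in> W" if "v \<in> V" for v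
    using that W by blast
  have GW: "G *v w = F *v w" if "w \<in> W" for w
    using that by (simp add: G eqs)
  have N_H: "N *v (H *v v) = 0" for v
    using HC[of v] spanC by (auto simp: kV_def)
  have NS: "N *v (S *v w) = w" if "w \<in> W" for w
    using s that by (simp add: S)
  show thesis
  proof
    fix v assume v: "v \<in> V"
    show "G *v v \<in> V"
      unfolding G
    proof (intro vec.subspace_add[OF V])
      show "F *v (P *v v) \<in> V"
        using F(1) PW W(2) by blast
      show "S *v ((1 / t) *s (F *v (N *v v - N *v (P *v v)))) \<in> V"
        using s by (auto simp: S)
      show "H *v v \<in> V"
        using HC spanC by (auto simp: kV_def)
    qed
    have 1: "F *v (N *v v - N *v (P *v v)) \<in> W"
      by (intro F(1) vec.subspace_diff[OF subW] NV v subsetD[OF W(2) PW])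
    have "N *v (G *v v) = N *v (F *v (P *v v)) + (1 / t) *s (F *v (N *v v - N *v (P *v v)))"
      using 1 by (simp add: G matrix_vector_right_distrib N_H NS vec.subspace_scale[OF subW])
    then have "t *s (N *v (G *v v)) = t *s (N *v (F *v (P *v v))) + F *v (N *v v - N *v (P *v v))"
      using t by (simp add: vec.scale_right_distrib)
    also have "\<dots> = F *v (N *v v)"
      using F(3)[OF PW, of v] by (simp add: matrix_vector_mult_diff_distrib)
    finally show com: "G *v (N *v v) = t *s (N *v (G *v v))"
      by (simp add: GW NV v)
    \<comment> \<open>Since \<open>F\<close> is injective on \<open>W\<close>, a vector killed by
      \<open>G\<close> lies in the kernel of \<open>N\<close>. There it splits as
      \<open>w + c\<close> with \<open>G v = F w + c\<close>, and \<open>W\<close> meets the span of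
      \<open>C\<close> only in \<open>0\<close>.\<close>
    assume 0: "G *v v = 0"
    then have "F *v (N *v v) = 0"
      using com by (simp add: GW NV v)
    then have "N *v v = 0"
      using F(2) NV v by blast
    then have "v \<in> vec.span B"
      using v B by (auto simp: kV_def)
    then obtain w c where wc: "v = w + c" "w \<in> W" "c \<in> vec.span C"
      unfolding BWC vec.span_Un spanW0 by auto
    have "N *v c = 0"
      using spanC wc by (auto simp: kV_def)
    then have "N *v w = 0"
      using \<open>N *v v = 0\<close> by (simp add: wc matrix_vector_right_distrib)
    have Pv: "P *v v = w" "H *v v = c"
      using wc by (simp_all add: matrix_vector_right_distrib eqs eqsC)
    have "F *v w + c = 0"
      using 0 unfolding G Pv \<open>N *v v = 0\<close> \<open>N *v w = 0\<close> by simp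
    then have "c = - (F *v w)"
      by (simp add: add_eq_0_iff)
    then have "c \<in> W"
      using F(1) wc vec.subspace_neg[OF subW] by blast
    then have "c = 0"
      using eqs(1)[of c] eqsC(1)[of c] wc by simp
    then show "v = 0"
      using \<open>F *v w + c = 0\<close> F(2) wc by simp
  qed
qed

text \<open>The images of the powers of \<open>N\<close> form a chain from the whole space down to
  zero. On the zero space the zero matrix is an injective intertwiner, and
  \<open>nilpotent_scaling_extend\<close> lifts it one image at a time up to the whole
  space.\<close>

lemma nilpotent_similar_scaled:
  fixes N :: "'a::field^'n^'n"
  assumes t: "t \<noteq> 0" and nil: "\<And>v. ((*v) N ^^ k) v = 0"
  obtains E where "det E \<noteq> 0" "\<And>v. E *v (N *v v) = t *s (N *v (E *v v))"
proof -
  define V where "V = (\<lambda>j. range ((*v) N ^^ j))"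
  have lin: "Vector_Spaces.linear (*s) (*s) ((*v) N ^^ j)" for j
  proof (induction j)
    case 0
    then show ?case by (simp add: id_def vec.linear_ident)
  next
    case (Suc j)
    from Vector_Spaces.linear_compose[OF this matrix_vector_mul_linear_gen[of N]] show ?case
      by (simp add: comp_def)
  qed
  have subV: "vec.subspace (V j)" for j
    unfolding V_def by (rule vec.linear_subspace_image[OF lin vec.subspace_UNIV])
  have VSuc: "V (Suc j) = ((*v) N) ` V j" for j
    by (simp add: V_def image_comp)
  have V_le: "V (Suc j) \<subseteq> V j" for j
    by (auto simp: V_def funpow_Suc_right simp del: funpow.simps)
  have "\<exists>G. (\<forall>v\<in>V (k - j). G *v v \<in> V (k - j)) \<and> (\<forall>v\<in>V (k - j). G *v v = 0 \<longrightarrow> v = 0) \<and>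
     (\<forall>v\<in>V (k - j). G *v (N *v v) = t *s (N *v (G *v v)))" if "j \<le> k" for j
    using that
  proof (induction j)
    case 0
    then show ?case
      using nil by (auto simp: V_def intro!: exI[of _ "0 :: 'a^'n^'n"])
  next
    case (Suc j)
    then have eq: "k - j = Suc (k - Suc j)" by simp
    obtain F where F: "(\<forall>v\<in>V (k - j). F *v v \<in> V (k - j))" "(\<forall>v\<in>V (k - j). F *v v = 0 \<longrightarrow> v = 0)"
     "(\<forall>v\<in>V (k - j). F *v (N *v v) = t *s (N *v (F *v v)))"
      using Suc by auto
    show ?case
      by (rule nilpotent_scaling_extend[OF t subV[of "k - Suc j"] VSuc V_le, of F])
        (use F eq in auto)
  qed
  from this[of k] obtain E where E: "\<And>v. E *v v = 0 \<Longrightarrow> v = 0" "\<And>v. E *v (N *v v) = t *s (N *v (E *v v))"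
    by (auto simp: V_def)
  have "\<exists>E'. E' ** E = mat 1"
    unfolding matrix_left_invertible_ker using E(1) by blast
  then have "det E \<noteq> 0"
    using invertible_left_inverse invertible_det_nz by blast
  then show thesis
    using E(2) by (rule that)
qed

text \<open>\<open>N\<close> is similar to \<open>2 N\<close>, so its trace equals twice
  itself.\<close>

lemma trace_nilpotent:
  fixes N :: "complex^'n^'n"
  assumes "\<And>v. ((*v) N ^^ k) v = 0"
  shows "trace N = 0"
proof -
  obtain E where E: "det E \<noteq> 0" "\<And>v. E *v (N *v v) = 2 *s (N *v (E *v v))"
    using nilpotent_similar_scaled[OF _ assms, of 2] by auto
  obtain E' where E': "E ** E' = mat 1" "E' ** E = mat 1"
    using E(1) unfolding invertible_det_nz[symmetric] invertible_def by blast
  have "E ** N = N ** E + N ** E"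
    unfolding matrix_eq matrix_vector_mult_add_rdistrib matrix_vector_mul_assoc[symmetric] E(2)
    by (simp add: vec_eq_iff)
  then have "E ** N ** E' = N ** (E ** E') + N ** (E ** E')"
    by (simp only: cmm.add_left matrix_mul_assoc)
  then have "trace (E ** N ** E') = trace N + trace N"
    by (simp only: E' trace_add matrix_mul_rid)
  moreover have "trace (E ** N ** E') = trace N"
    using trace_mul_sym[of "E ** N" E'] by (simp add: matrix_mul_assoc E')
  ultimately show ?thesis by simp
qed

section \<open>The Lie algebra\<close>

lemma has_derivative_prod_kronecker:
  fixes f :: "'i \<Rightarrow> real \<Rightarrow> complex"
  assumes "finite I" "\<And>i. i \<in> I \<Longrightarrow> (f i has_derivative (\<lambda>h. h *\<^sub>R a i)) (at 0)"
  shows "((\<lambda>t. \<Prod>i\<in>I. f i t) has_derivative (\<lambda>h. h *\<^sub>R (\<Sum>i\<in>I. a i * (\<Prod>j\<in>I - {i}. f j 0)))) (at 0)"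
  using has_derivative_prod[of I f "\<lambda>i h. h *\<^sub>R a i" 0 UNIV] assms
  by (simp add: scaleR_sum_right mult_ac)

text \<open>Jacobi's formula at the identity. A permutation other than \<open>id\<close> moves at
  least two indices, so after one factor is differentiated another off-diagonal entry of
  \<open>mat 1\<close> still kills the product.\<close>

lemma has_vector_derivative_det_at_mat_1:
  fixes M :: "real \<Rightarrow> complex^'n^'n"
  assumes M: "(M has_vector_derivative M') (at 0)" and M0: "M 0 = mat 1"
  shows "((\<lambda>t. det (M t)) has_vector_derivative trace M') (at 0)"
proof -
  have comp: "((\<lambda>t. M t $ i $ j) has_derivative (\<lambda>h. h *\<^sub>R (M' $ i $ j))) (at 0)" for i j
  proof -
    have bl: "bounded_linear (\<lambda>X :: complex^'n^'n. X $ i $ j)"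
      by (rule bounded_linear_compose[OF bounded_linear_vec_nth bounded_linear_vec_nth])
    show ?thesis
      using bounded_linear.has_derivative[OF bl M[unfolded has_vector_derivative_def]] by simp
  qed
  define D where "D = (\<lambda>p. \<Sum>i\<in>UNIV. M' $ i $ p i * (\<Prod>j\<in>UNIV - {i}. M 0 $ j $ p j))"
  have "((\<lambda>t. det (M t)) has_derivative (\<lambda>h. \<Sum>p | p permutes (UNIV :: 'n set). of_int (sign p) * (h *\<^sub>R D p))) (at 0)"
    unfolding det_def D_def
    by (intro has_derivative_sum has_derivative_mult_right has_derivative_prod_kronecker comp) auto
  moreover have "D p = 0" if p: "p permutes (UNIV :: 'n set)" "p \<noteq> id" for p
  proof -
    obtain k where k: "p k \<noteq> k"
      using p(2) by (auto simp: fun_eq_iff)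
    have "(\<Prod>j\<in>UNIV - {i}. M 0 $ j $ p j) = 0" for i
    proof (cases "i = k")
      case True
      have "p (p k) \<noteq> p k"
        using k p(1) by (metis permutes_inv_eq)
      then show ?thesis
        using k True by (intro prod_zero) (auto simp: M0 mat_def intro!: bexI[of _ "p k"])
    next
      case False
      then show ?thesis
        using k by (intro prod_zero) (auto simp: M0 mat_def intro!: bexI[of _ k])
    qed
    then show ?thesis
      by (simp only: D_def mult_zero_right sum.neutral_const)
  qed
  then have "(\<Sum>p | p permutes (UNIV :: 'n set). of_int (sign p) * (h *\<^sub>R D p)) = h *\<^sub>R D id" for h
    by (subst sum.remove[of _ id]) (auto simp: permutes_id sign_id)
  moreover have "D id = trace M'"
    by (simp add: D_def M0 mat_def trace_def)
  ultimately show ?thesis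
    by (simp add: has_vector_derivative_def)
qed

lemma trace_complex_rep: "trace (complex_rep X) = of_real (2 * retr X)"
  by (simp add: trace_def sum_UNIV_Plus retr_def sum.distrib[symmetric] sum_distrib_left)
    (simp add: quat_fst_def complex_eq_iff)

lemma linear_retr: "linear retr"
  by (rule linearI) (auto simp: retr_def quat_sel_simps sum.distrib sum_distrib_left)

lemma det_complex_rep_eq_Re: "det (complex_rep g) = of_real (Re (det (complex_rep g)))"
  using arg_cong[OF det_complex_rep_real, of Im g] by (simp add: complex_eq_iff)

text \<open>Differentiating \<open>det = 1\<close> gives one inclusion. Conversely the line
  \<open>mat 1 + t X\<close> is divided by the \<open>2n\<close>-th root of its determinant; the
  derivative of this determinant at \<open>0\<close> is a trace, which vanishes, so the correction
  leaves the velocity \<open>X\<close> unchanged.\<close>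

lemma sl_quat_eq: "sl_quat = {X :: quat^'n^'n. retr X = 0}"
proof (intro equalityI subsetI)
  fix X :: "quat^'n^'n"
  assume "X \<in> sl_quat"
  then obtain \<gamma> where g: "\<And>t. \<gamma> t \<in> SL_quat" "\<gamma> 0 = mat 1" "(\<gamma> has_vector_derivative X) (at 0)"
    unfolding sl_quat_def lie_algebra_of_def by blast
  have "((\<lambda>t. complex_rep (\<gamma> t)) has_vector_derivative complex_rep X) (at 0)"
    by (rule bounded_linear.has_vector_derivative[OF bounded_linear_complex_rep g(3)])
  from has_vector_derivative_det_at_mat_1[OF this]
  have "((\<lambda>t. det (complex_rep (\<gamma> t))) has_vector_derivative trace (complex_rep X)) (at 0)"
    by (simp add: g complex_rep_mat_1)
  moreover have "det (complex_rep (\<gamma> t)) = 1" for t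
    using g(1) by (simp add: SL_quat_def)
  ultimately have "((\<lambda>t::real. 1) has_vector_derivative trace (complex_rep X)) (at 0)"
    by simp
  then have "trace (complex_rep X) = 0"
    using has_vector_derivative_const[of "1::complex" "at (0::real)"] vector_derivative_unique_at by blast
  then show "X \<in> {X. retr X = 0}"
    by (simp add: trace_complex_rep)
next
  fix X :: "quat^'n^'n"
  assume "X \<in> {X. retr X = 0}"
  then have X: "retr X = 0" by simp
  define d where "d = (\<lambda>t::real. Re (det (complex_rep (mat 1 + t *\<^sub>R X))))"
  have lin: "((\<lambda>t::real. mat 1 + t *\<^sub>R X) has_vector_derivative X) (at 0)"
    by (auto intro!: derivative_eq_intros)
  have "((\<lambda>t. det (complex_rep (mat 1 + t *\<^sub>R X))) has_vector_derivative 0) (at 0)"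
    using has_vector_derivative_det_at_mat_1[OF bounded_linear.has_vector_derivative[OF bounded_linear_complex_rep lin]]
    by (simp add: trace_complex_rep X complex_rep_mat_1)
  from bounded_linear.has_vector_derivative[OF bounded_linear_Re this]
  have d': "(d has_real_derivative 0) (at 0)"
    by (simp add: d_def has_real_derivative_iff_has_vector_derivative)
  have d0: "d 0 = 1"
    by (simp add: d_def complex_rep_mat_1)
  have "isCont d 0"
    using d' DERIV_isCont by blast
  then have "(d \<longlongrightarrow> 1) (nhds 0)"
    unfolding isCont_def using tendsto_at_iff_tendsto_nhds[of d 0] d0 by simp
  then have "eventually (\<lambda>t. d t > 0) (nhds 0)"
    by (rule order_tendstoD) simp
  then obtain T where T: "open T" "0 \<in> T" "\<And>t. t \<in> T \<Longrightarrow> d t > 0"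
    unfolding eventually_nhds by blast
  define N where "N = real (CARD('n + 'n))"
  define f where "f = (\<lambda>t. d t powr (- 1 / N))"
  have f0: "f 0 = 1"
    by (simp add: f_def d0)
  have "(f has_real_derivative 0) (at 0)"
    unfolding f_def using DERIV_chain2[OF has_real_derivative_powr d', of "- 1 / N"] d0 by simp
  then have lin': "((\<lambda>t. f t *\<^sub>R (mat 1 + t *\<^sub>R X)) has_vector_derivative X) (at 0)"
    using lin by (auto intro!: derivative_eq_intros simp: f0)
  \<comment> \<open>The curve must stay in the group for all real \<open>t\<close>; where the
    determinant is not positive it is set to the identity, which happens only away from
    \<open>0\<close>.\<close>
  define \<gamma> where "\<gamma> = (\<lambda>t. if d t > 0 then f t *\<^sub>R (mat 1 + t *\<^sub>R X) else mat 1)"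
  have "(\<gamma> has_vector_derivative X) (at 0)"
    by (rule has_vector_derivative_transform_within_open[OF lin' T(1,2)]) (simp add: \<gamma>_def T)
  moreover have "\<gamma> 0 = mat 1"
    by (simp add: \<gamma>_def d0 f0)
  moreover have "\<gamma> t \<in> SL_quat" for t
  proof (cases "d t > 0")
    case True
    have "f t ^ CARD('n + 'n) = d t powr (- 1)"
      using True by (simp add: f_def powr_realpow[symmetric] powr_powr N_def del: card_sum)
    then have "f t ^ CARD('n + 'n) * d t = 1"
      using True by (simp add: powr_minus del: card_sum)
    have "det (complex_rep (\<gamma> t)) = of_real (f t) ^ CARD('n + 'n) * of_real (d t)"
      unfolding \<gamma>_def d_def det_complex_rep_eq_Re[symmetric]
      using True by (simp add: complex_rep_scaleR det_scaleR_complex d_def del: card_sum)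
    also have "\<dots> = of_real (f t ^ CARD('n + 'n) * d t)"
      by (simp only: of_real_mult of_real_power)
    also have "\<dots> = 1"
      by (simp only: \<open>f t ^ CARD('n + 'n) * d t = 1\<close> of_real_1)
    finally have "det (complex_rep (\<gamma> t)) = 1" .
    then show ?thesis
      using invertibleI_complex_rep[of "\<gamma> t"] by (simp add: SL_quat_def)
  next
    case False
    then show ?thesis
      by (simp add: \<gamma>_def SL_quat_def complex_rep_mat_1 invertibleI_complex_rep)
  qed
  ultimately show "X \<in> sl_quat"
    unfolding sl_quat_def lie_algebra_of_def by blast
qed

section \<open>Nilpotent orbits are cones\<close>

text \<open>On a matrix with one nonzero column, given by an eigenvector, \<open>ad N\<close> acts through the row
  by \<open>\<mu> - N\<close>.\<close>

lemma ad_nilpotent_imp_shift_nilpotent: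
  fixes N :: "complex^'n^'n"
  assumes ad: "\<And>X. ((\<lambda>X. N ** X - X ** N) ^^ k) X = 0" and v: "N *v v = \<mu> *s v" "v \<noteq> 0"
  shows "((*v) (transpose N - mat \<mu>) ^^ k) \<phi> = 0"
proof -
  define R :: "complex^'n \<Rightarrow> complex^'n^'n" where "R = (\<lambda>\<psi>. \<chi> i j. v $ i * \<psi> $ j)"
  have step: "N ** R \<psi> - R \<psi> ** N = R (- ((transpose N - mat \<mu>) *v \<psi>))" for \<psi>
  proof -
    have "(N ** R \<psi>) $ i $ j = \<mu> * v $ i * \<psi> $ j" for i j
    proof -
      have "(N ** R \<psi>) $ i $ j = (N *v v) $ i * \<psi> $ j"
        by (simp add: R_def matrix_matrix_mult_def matrix_vector_mult_def sum_distrib_right mult.assoc)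
      then show ?thesis by (simp add: v)
    qed
    moreover have "(R \<psi> ** N) $ i $ j = v $ i * (transpose N *v \<psi>) $ j" for i j
      by (simp add: R_def matrix_matrix_mult_def matrix_vector_mult_def transpose_def sum_distrib_left mult.assoc mult.commute[of "\<psi> $ _"])
    moreover have "(R (- ((transpose N - mat \<mu>) *v \<psi>))) $ i $ j
        = \<mu> * v $ i * \<psi> $ j - v $ i * (transpose N *v \<psi>) $ j" for i j
      unfolding matrix_vector_mult_diff_rdistrib mat_vector_mult R_def
      by (simp add: right_diff_distrib)
    ultimately show ?thesis
      unfolding vec_eq_iff by simp
  qed
  \<comment> \<open>The sign \<open>\<epsilon>\<close> absorbs the power of \<open>- 1\<close>, as
    each bracket acts by \<open>\<mu> - transpose N\<close>.\<close>
  have "\<exists>\<epsilon>. \<epsilon> \<noteq> 0 \<and> ((\<lambda>X. N ** X - X ** N) ^^ m) (R \<phi>) = R (\<epsilon> *s ((*v) (transpose N - mat \<mu>) ^^ m) \<phi>)" for m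
  proof (induction m)
    case 0
    then show ?case by (intro exI[of _ 1]) simp
  next
    case (Suc m)
    then obtain \<epsilon> where "\<epsilon> \<noteq> 0"
      "((\<lambda>X. N ** X - X ** N) ^^ m) (R \<phi>) = R (\<epsilon> *s ((*v) (transpose N - mat \<mu>) ^^ m) \<phi>)"
      by blast
    moreover have "- ((transpose N - mat \<mu>) *v (\<epsilon> *s \<psi>)) = (- \<epsilon>) *s ((transpose N - mat \<mu>) *v \<psi>)" for \<psi>
      by (simp add: vec_eq_iff matrix_vector_mult_def sum_distrib_left mult_ac sum_negf)
    ultimately show ?case
      by (intro exI[of _ "- \<epsilon>"]) (simp add: step)
  qed
  from this[of k, unfolded ad] obtain \<epsilon>
    where e: "\<epsilon> \<noteq> 0" "0 = R (\<epsilon> *s ((*v) (transpose N - mat \<mu>) ^^ k) \<phi>)"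
    by blast
  obtain i where i: "v $ i \<noteq> 0"
    using v(2) by (auto simp: vec_eq_iff)
  have "v $ i * (\<epsilon> * ((*v) (transpose N - mat \<mu>) ^^ k) \<phi> $ j) = 0" for j
    using arg_cong[OF e(2), of "\<lambda>X. X $ i $ j"] by (simp add: R_def)
  then show ?thesis
    using e(1) i by (simp add: vec_eq_iff)
qed

text \<open>The characteristic polynomial is not constant, so it has a root. Nonconstancy is seen at
  infinity: substituting \<open>1 / t\<close> and clearing denominators would equate
  \<open>det (mat 1 - t N)\<close>, which tends to \<open>1\<close> as \<open>t\<close> decreases to
  \<open>0\<close>, with a multiple of \<open>t^n\<close>, which tends to \<open>0\<close>.\<close>

lemma complex_matrix_eigenvector:
  fixes N :: "complex^'n^'n"
  obtains \<mu> v where "N *v v = \<mu> *s v" "v \<noteq> 0"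
proof -
  define P :: "complex poly^'n^'n" where "P = (\<chi> i j. [: N $ i $ j, if i = j then - 1 else 0 :])"
  have "poly (P $ i $ j) x = (N - mat x) $ i $ j" for i j x
    by (simp add: P_def mat_def)
  then have poly_det: "poly (det P) x = det (N - mat x)" for x
    by (simp add: det_def poly_sum poly_prod)
  have "\<not> (\<forall>x. poly (det P) x = poly (det P) 0)"
  proof
    assume c: "\<forall>x. poly (det P) x = poly (det P) 0"
    define f where "f = (\<lambda>t::real. det (mat 1 - t *\<^sub>R N) - poly (det P) 0 * of_real (- t) ^ CARD('n))"
    have "f t = 0" if "t > 0" for t
    proof -
      have "N - mat (of_real (1 / t)) = (- (1 / t)) *\<^sub>R (mat 1 - t *\<^sub>R N)"
        using that by (auto simp: vec_eq_iff mat_def scaleR_conv_of_real[where 'a = complex] field_simps)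
      then have "det (N - mat (of_real (1 / t))) = of_real (- (1 / t)) ^ CARD('n) * det (mat 1 - t *\<^sub>R N)"
        by (simp only: det_scaleR_complex)
      then have "of_real (- (1 / t)) ^ CARD('n) * det (mat 1 - t *\<^sub>R N) = poly (det P) 0"
        using c[rule_format, of "of_real (1 / t)"] poly_det[of "of_real (1 / t)"] by simp
      then have "poly (det P) 0 * of_real (- t) ^ CARD('n)
          = det (mat 1 - t *\<^sub>R N) * (of_real (- (1 / t)) * of_real (- t)) ^ CARD('n)"
        by (simp only: power_mult_distrib mult.assoc mult.left_commute mult.commute)
      then show ?thesis
        using that by (simp add: f_def of_real_mult[symmetric] del: of_real_mult)
    qed
    then have "eventually (\<lambda>t. f t = 0) (at_right 0)"
      by (auto intro: eventually_mono[OF eventually_at_right_less])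
    moreover have "continuous_on UNIV f"
      unfolding f_def by (intro continuous_intros)
    then have "(f \<longlongrightarrow> f 0) (at_right 0)"
      by (simp add: continuous_on_def filterlim_at_split)
    ultimately have "f 0 = 0"
      using tendsto_unique[OF trivial_limit_at_right_real _ tendsto_eventually] by blast
    then show False
      by (simp add: f_def zero_power)
  qed
  then have "\<not> constant (poly (det P))"
    unfolding constant_def by blast
  from fundamental_theorem_of_algebra[OF this] obtain \<mu> where "det (N - mat \<mu>) = 0"
    unfolding poly_det by blast
  then have "\<not> (\<exists>B. B ** (N - mat \<mu>) = mat 1)"
    using invertible_left_inverse invertible_det_nz by blast
  then obtain v where "(N - mat \<mu>) *v v = 0" "v \<noteq> 0"
    unfolding matrix_left_invertible_ker by blast
  then show thesis
    by (intro that[of v \<mu>]) (simp_all add: matrix_vector_mult_diff_rdistrib mat_vector_mult)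
qed

text \<open>The quaternionic sum of the diagonal entries is not symmetric in the factors; its real
  part is, being half of a complex trace.\<close>

lemma retr_mult_commute: "retr (X ** Y) = retr (Y ** (X :: quat^'n^'n))"
proof -
  have "complex_of_real (2 * retr (X ** Y)) = of_real (2 * retr (Y ** X))"
    unfolding trace_complex_rep[symmetric] complex_rep_mult by (rule trace_mul_sym)
  then show ?thesis
    by (simp only: of_real_eq_iff)
qed

lemma retr_lie_bracket: "retr (lie_bracket X Y) = 0"
  by (simp add: lie_bracket_def linear_diff[OF linear_retr] retr_mult_commute[of X])

lemma trace_transpose: "trace (transpose A) = trace A"
  by (simp add: trace_def transpose_def)

text \<open>By complexification the bracket with \<open>N\<close> is nilpotent on all complex
  matrices. An eigenvector of \<open>N\<close> turns this into nilpotency of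
  \<open>transpose N - \<mu>\<close>; both this matrix and \<open>N\<close> have trace zero, which
  forces \<open>\<mu> = 0\<close>. The transpose comes from letting \<open>N\<close> act on
  rows.\<close>

lemma ad_nilpotent_imp_transpose_nilpotent:
  fixes y :: "quat^'n^'n"
  assumes "ad_nilpotent sl_quat y"
  obtains k where "\<And>v. ((*v) (transpose (complex_rep y)) ^^ k) v = 0"
proof -
  obtain k where k: "\<And>X. retr X = 0 \<Longrightarrow> (lie_bracket y ^^ k) X = 0" and ry: "retr y = 0"
    using assms by (auto simp: ad_nilpotent_def sl_quat_eq)
  define N where "N = complex_rep y"
  have ad: "((\<lambda>X. N ** X - X ** N) ^^ m) (complex_rep A + cscale \<i> (complex_rep B))
     = complex_rep ((lie_bracket y ^^ m) A) + cscale \<i> (complex_rep ((lie_bracket y ^^ m) B))" for m A B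
  proof (induction m)
    case (Suc m)
    have "N ** (complex_rep A + cscale \<i> (complex_rep B)) - (complex_rep A + cscale \<i> (complex_rep B)) ** N
      = complex_rep (lie_bracket y A) + cscale \<i> (complex_rep (lie_bracket y B))" for A B
    proof -
      have "cscale z X - cscale z Y = cscale z (X - Y)" for z and X Y :: "complex^('n + 'n)^('n + 'n)"
        by (simp add: vec_eq_iff right_diff_distrib)
      then show ?thesis
        unfolding lie_bracket_def linear_diff[OF linear_complex_rep] complex_rep_mult N_def[symmetric]
        by (simp add: cmm.add_left cmm.add_right cscale_mult)
    qed
    then show ?case
      by (simp add: Suc.IH)
  qed simp
  \<comment> \<open>The first bracket already lands in the trace-free matrices, so one additional
    bracket covers every \<open>X\<close>.\<close>
  have ad0: "(lie_bracket y ^^ Suc k) X = 0" for X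
    unfolding funpow_Suc_right comp_def by (rule k) (rule retr_lie_bracket)
  then have 1: "((\<lambda>X. N ** X - X ** N) ^^ Suc k) X = 0" for X
    using ad[of "Suc k" "quat_part X" "quat_part (cscale (- \<i>) X)"]
    unfolding complex_rep_quat_part ad0 linear_0[OF linear_complex_rep] by (simp add: vec_eq_iff del: funpow.simps)
  obtain \<mu> v where v: "N *v v = \<mu> *s v" "v \<noteq> 0"
    by (rule complex_matrix_eigenvector)
  have 2: "((*v) (transpose N - mat \<mu>) ^^ Suc k) \<phi> = 0" for \<phi>
    by (rule ad_nilpotent_imp_shift_nilpotent[OF 1 v])
  have "trace (transpose N - mat \<mu>) = 0"
    by (rule trace_nilpotent[OF 2])
  moreover have "trace (mat \<mu> :: complex^('n+'n)^('n+'n)) = of_nat (CARD('n + 'n)) * \<mu>"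
    by (simp add: trace_def mat_def)
  ultimately have "\<mu> = 0"
    by (simp add: trace_sub trace_transpose N_def trace_complex_rep ry)
  then have "transpose N - mat \<mu> = transpose N"
    by (simp add: vec_eq_iff mat_def)
  with 2 show thesis
    unfolding N_def by (intro that[of "Suc k"]) simp
qed

lemma ad_nilpotent_conjugate_scaled:
  fixes y :: "quat^'n^'n"
  assumes "ad_nilpotent sl_quat y" and t: "t \<noteq> 0"
  obtains g where "invertible g" "g ** y = t *\<^sub>R (y ** g)"
proof -
  define N where "N = complex_rep y"
  obtain k where "\<And>v. ((*v) (transpose (complex_rep y)) ^^ k) v = 0"
    using ad_nilpotent_imp_transpose_nilpotent[OF assms(1)] by blast
  \<comment> \<open>Transposition reverses the sides of the intertwining relation, so the factor
    \<open>1 / t\<close> for \<open>transpose N\<close> becomes \<open>t\<close> for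
    \<open>N\<close>.\<close>
  then obtain E0 where E0: "det E0 \<noteq> 0"
     "\<And>v. E0 *v (transpose N *v v) = of_real (1 / t) *s (transpose N *v (E0 *v v))"
    using nilpotent_similar_scaled[where t = "of_real (1 / t)" and N = "transpose N" and k = k] t unfolding N_def by auto
  have "(E0 ** transpose N) *v v = cscale (of_real (1 / t)) (transpose N ** E0) *v v" for v
  proof -
    have "cscale z A *v w = z *s (A *v w)" for z and A :: "complex^('n+'n)^('n+'n)" and w
      by (simp add: vec_eq_iff matrix_vector_mult_def sum_distrib_left mult.assoc)
    then show ?thesis
      by (simp only: E0(2) matrix_vector_mul_assoc[symmetric])
  qed
  then have "E0 ** transpose N = cscale (of_real (1 / t)) (transpose N ** E0)"
    unfolding matrix_eq by blast
  from arg_cong[OF this, of transpose]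
  have "N ** transpose E0 = transpose (cscale (of_real (1 / t)) (transpose N ** E0))"
    by (simp add: matrix_transpose_mul)
  also have "\<dots> = cscale (of_real (1 / t)) (transpose (transpose N ** E0))"
    by (simp add: vec_eq_iff transpose_def)
  finally have "N ** transpose E0 = cscale (of_real (1 / t)) (transpose E0 ** N)"
    by (simp add: matrix_transpose_mul)
  then have E1: "transpose E0 ** N = cscale (of_real t) (N ** transpose E0)"
    using t by (simp add: vec_eq_iff)
  define E where "E = transpose E0"
  define A where "A = quat_part E"
  define B where "B = quat_part (cscale (- \<i>) E)"
  have E: "E = complex_rep A + cscale \<i> (complex_rep B)"
    by (simp add: A_def B_def complex_rep_quat_part)
  have "E ** N = complex_rep (A ** y) + cscale \<i> (complex_rep (B ** y))"
    by (simp add: E N_def complex_rep_mult cmm.add_left cscale_mult)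
  moreover have "cscale (of_real t) (N ** E)
      = complex_rep (t *\<^sub>R (y ** A)) + cscale \<i> (complex_rep (t *\<^sub>R (y ** B)))"
    unfolding E N_def complex_rep_mult complex_rep_scaleR cmm.add_right cscale_mult
    by (simp add: vec_eq_iff scaleR_conv_of_real[where 'a = complex] algebra_simps)
  ultimately have AB: "A ** y = t *\<^sub>R (y ** A)" "B ** y = t *\<^sub>R (y ** B)"
    using complex_rep_decomposition_unique E1 unfolding E_def by metis+
  define P :: "complex poly^('n+'n)^('n+'n)"
    where "P = (\<chi> i j. [: complex_rep A $ i $ j, complex_rep B $ i $ j :])"
  have "poly (P $ i $ j) x = (complex_rep A + cscale x (complex_rep B)) $ i $ j" for i j x
    by (simp add: P_def)
  then have poly_det: "poly (det P) x = det (complex_rep A + cscale x (complex_rep B))" for x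
    by (simp add: det_def poly_sum poly_prod)
  have "poly (det P) \<i> \<noteq> 0"
    unfolding poly_det E[symmetric] E_def using E0(1) by (simp add: det_transpose)
  then have "finite {x. poly (det P) x = 0}"
    by (intro poly_roots_finite) auto
  moreover have "infinite (range complex_of_real)"
    by (simp add: finite_image_iff inj_of_real infinite_UNIV_char_0)
  ultimately obtain r :: real where "poly (det P) (of_real r) \<noteq> 0"
    using finite_subset[of "range complex_of_real" "{x. poly (det P) x = 0}"] by blast
  moreover have "cscale (of_real r) (complex_rep B) = complex_rep (r *\<^sub>R B)"
    unfolding complex_rep_scaleR by (simp add: vec_eq_iff scaleR_conv_of_real[where 'a = complex])
  ultimately have "det (complex_rep (A + r *\<^sub>R B)) \<noteq> 0"
    by (simp add: poly_det complex_rep_add)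
  then have "invertible (A + r *\<^sub>R B)"
    by (rule invertibleI_complex_rep)
  moreover have "(A + r *\<^sub>R B) ** y = t *\<^sub>R (y ** (A + r *\<^sub>R B))"
    by (simp add: qmm_distribs AB scaleR_add_right scaleR_left_commute)
  ultimately show thesis
    by (rule that)
qed

lemma matrix_inv_mult:
  assumes "invertible (g :: 'a^'n^'n)" "invertible (h :: 'a::semiring_1^'n^'n)"
  shows "matrix_inv (g ** h) = matrix_inv h ** matrix_inv g"
proof (rule matrix_inv_unique)
  have "g ** h ** (matrix_inv h ** matrix_inv g) = g ** (h ** matrix_inv h) ** matrix_inv g"
    by (simp add: matrix_mul_assoc)
  then show "g ** h ** (matrix_inv h ** matrix_inv g) = mat 1"
    by (simp add: matrix_inv_props assms)
  have "matrix_inv h ** matrix_inv g ** (g ** h) = matrix_inv h ** (matrix_inv g ** g) ** h"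
    by (simp add: matrix_mul_assoc)
  then show "matrix_inv h ** matrix_inv g ** (g ** h) = mat 1"
    by (simp add: matrix_inv_props assms)
qed

lemma nilpotent_adjoint_orbit_scaleR:
  fixes y :: "quat^'n^'n"
  assumes "ad_nilpotent sl_quat y" "t \<noteq> 0" "x \<in> adjoint_orbit SL_quat y"
  shows "t *\<^sub>R x \<in> adjoint_orbit SL_quat y"
proof -
  obtain h where h: "invertible h" "x = h ** y ** matrix_inv h"
    using assms(3) unfolding adjoint_orbit_SL_quat by blast
  obtain g where g: "invertible g" "g ** y = t *\<^sub>R (y ** g)"
    using assms(1,2) by (rule ad_nilpotent_conjugate_scaled)
  have "(h ** g) ** y ** matrix_inv (h ** g) = h ** (g ** y) ** (matrix_inv g ** matrix_inv h)"
    unfolding matrix_inv_mult[OF h(1) g(1)] by (simp only: matrix_mul_assoc)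
  also have "\<dots> = t *\<^sub>R (h ** y ** (g ** matrix_inv g) ** matrix_inv h)"
    unfolding g(2) by (simp add: qmm_distribs matrix_mul_assoc)
  also have "\<dots> = t *\<^sub>R x"
    by (simp add: matrix_inv_props g h)
  finally show ?thesis
    unfolding adjoint_orbit_SL_quat using invertible_mult[OF h(1) g(1)] by (metis (mono_tags, lifting) mem_Collect_eq)
qed

section \<open>The Killing form\<close>

text \<open>With the inclusion of \<open>span B\<close> into \<open>span C\<close> and
  \<open>f\<close> as a map back, this is the equality of the traces of the two composites: both are
  the same double sum over \<open>B\<close> and \<open>C\<close>.\<close>

lemma trace_basis_change:
  fixes f :: "'a::euclidean_space \<Rightarrow> 'a"
  assumes f: "linear f" and B: "independent B" and C: "independent C"
    and sub: "span B \<subseteq> span C" and im: "f ` span C \<subseteq> span B"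
  shows "(\<Sum>b\<in>B. representation B (f b) b) = (\<Sum>c\<in>C. representation C (f c) c)"
proof -
  have fin: "finite B" "finite C"
    using B C by (auto simp: finiteI_independent)
  have expand: "f x = (\<Sum>b\<in>B. representation B (f x) b *\<^sub>R b)" if "x \<in> span C" for x
    using real_vector.sum_representation_eq[OF B _ fin(1), of "f x"] im that by force
  have "(\<Sum>c\<in>C. representation C (f c) c)
      = (\<Sum>c\<in>C. \<Sum>b\<in>B. representation B (f c) b * representation C b c)"
  proof (rule sum.cong[OF refl])
    fix c assume c: "c \<in> C"
    have "representation C (f c) c = representation C (\<Sum>b\<in>B. representation B (f c) b *\<^sub>R b) c"
      using expand[of c] c by (simp add: span_base)
    also have "\<dots> = (\<Sum>b\<in>B. representation C (representation B (f c) b *\<^sub>R b) c)"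
      by (intro fun_cong[OF real_vector.representation_sum[OF C]] span_scale subsetD[OF sub] span_base)
    also have "\<dots> = (\<Sum>b\<in>B. representation B (f c) b * representation C b c)"
      by (intro sum.cong refl) (simp add: real_vector.representation_scale[OF C] subsetD[OF sub] span_base)
    finally show "representation C (f c) c = \<dots>" .
  qed
  also have "\<dots> = (\<Sum>b\<in>B. \<Sum>c\<in>C. representation B (f c) b * representation C b c)"
    by (rule sum.swap)
  also have "\<dots> = (\<Sum>b\<in>B. representation B (f b) b)"
  proof (rule sum.cong[OF refl])
    fix b assume b: "b \<in> B"
    then have bC: "b \<in> span C"
      using sub span_base by blast
    have "f b = f (\<Sum>c\<in>C. representation C b c *\<^sub>R c)"
      using real_vector.sum_representation_eq[OF C bC fin(2)] by simp
    also have "\<dots> = (\<Sum>c\<in>C. representation C b c *\<^sub>R f c)"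
      by (simp add: linear_sum[OF f] linear_scale[OF f])
    finally have "representation B (f b) b = representation B (\<Sum>c\<in>C. representation C b c *\<^sub>R f c) b"
      by simp
    also have "\<dots> = (\<Sum>c\<in>C. representation B (representation C b c *\<^sub>R f c) b)"
      by (intro fun_cong[OF real_vector.representation_sum[OF B]] span_scale subsetD[OF im] imageI span_base)
    also have "\<dots> = (\<Sum>c\<in>C. representation B (f c) b * representation C b c)"
      by (intro sum.cong refl)
        (simp add: real_vector.representation_scale[OF B] subsetD[OF im] span_base mult.commute)
    finally show "(\<Sum>c\<in>C. representation B (f c) b * representation C b c) = representation B (f b) b"
      by simp
  qed
  finally show ?thesis by simp
qed

lemma representation_Basis:
  assumes "b \<in> Basis"
  shows "representation Basis v b = inner (v :: 'a::euclidean_space) b"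
proof -
  have "representation Basis v = (\<lambda>b. if b \<in> Basis then inner v b else 0)"
  proof (rule real_vector.representation_eqI)
    have "(\<Sum>b\<in>Basis. inner v b *\<^sub>R b) = (\<Sum>b | (if b \<in> Basis then inner v b else 0) \<noteq> 0.
        (if b \<in> Basis then inner v b else 0) *\<^sub>R b)"
      by (rule sum.mono_neutral_cong_right) auto
    then show "(\<Sum>b | (if b \<in> Basis then inner v b else 0) \<noteq> 0. (if b \<in> Basis then inner v b else 0) *\<^sub>R b) = v"
      by (simp add: euclidean_representation)
    show "finite {b. (if b \<in> Basis then inner v b else 0) \<noteq> 0}"
      by (rule finite_subset[of _ Basis]) auto
  qed (auto simp: independent_Basis split: if_splits)
  then show ?thesis
    using assms by simp
qed

text \<open>A map with values in \<open>S\<close> has the same trace on \<open>S\<close> as on the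
  whole space; this removes the chosen basis in \<open>trace_on\<close>.\<close>

lemma trace_on_eq_sum_Basis:
  fixes f :: "'a::euclidean_space \<Rightarrow> 'a"
  assumes f: "linear f" and S: "subspace S" and im: "range f \<subseteq> S"
  shows "trace_on S f = (\<Sum>b\<in>Basis. inner (f b) b)"
proof -
  define B where "B = (SOME B. independent B \<and> span B = S)"
  have "\<exists>B. independent B \<and> span B = S"
    by (metis S basis_exists span_eq_iff span_mono subset_antisym)
  then have B: "independent B" "span B = S"
    unfolding B_def by (metis (mono_tags, lifting) someI_ex)+
  have "trace_on S f = (\<Sum>b\<in>B. representation B (f b) b)"
    by (simp add: trace_on_def B_def Let_def)
  also have "\<dots> = (\<Sum>c\<in>Basis. representation Basis (f c) c)"
    using im by (intro trace_basis_change f B independent_Basis) (auto simp: B)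
  finally show ?thesis
    by (simp add: representation_Basis)
qed

lemma sum_Basis_vec:
  "(\<Sum>b\<in>Basis. f b) = (\<Sum>i\<in>UNIV. \<Sum>u\<in>Basis. f (axis i u :: 'a::euclidean_space^'n))"
proof -
  have B: "Basis = (\<lambda>(i, u). axis i u :: 'a^'n) ` (UNIV \<times> Basis)"
    by (auto simp: Basis_vec_def)
  have "inj_on (\<lambda>(i, u). axis i u :: 'a^'n) (UNIV \<times> Basis)"
    by (auto simp: inj_on_def axis_eq_axis)
  from sum.reindex[OF this, of f] show ?thesis
    unfolding B[symmetric] by (simp add: sum.cartesian_product comp_def case_prod_unfold)
qed

text \<open>The diagonal coefficients at position \<open>(i, j)\<close> involve only
  \<open>A $ i $ i\<close> and \<open>C $ j $ j\<close>, and the map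
  \<open>u \<mapsto> a u c\<close> on the quaternions has trace \<open>4 Re a Re c\<close>; the sum
  over \<open>i\<close> and \<open>j\<close> then factors.\<close>

lemma trace_two_sided_mult:
  fixes A C :: "quat^'n^'n"
  shows "(\<Sum>b\<in>Basis. inner (A ** b ** C) b) = 4 * retr A * retr C"
proof -
  have entry: "inner (A ** axis i (axis j u) ** C) (axis i (axis j u)) = inner (A $ i $ i * u * C $ j $ j) u"
    for i j u
  proof -
    have "(A ** axis i (axis j u)) $ i $ l = (if l = j then A $ i $ i * u else 0)" for l
    proof -
      have "(A ** axis i (axis j u)) $ i $ l = (\<Sum>k\<in>UNIV. if k = i then (if l = j then A $ i $ i * u else 0) else 0)"
        unfolding matrix_matrix_mult_def vec_lambda_beta by (intro sum.cong refl) (auto simp: axis_def)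
      then show ?thesis by simp
    qed
    then have "(A ** axis i (axis j u) ** C) $ i $ j = (\<Sum>l\<in>UNIV. if l = j then A $ i $ i * u * C $ j $ j else 0)"
      unfolding matrix_matrix_mult_def[of "A ** axis i (axis j u)"] vec_lambda_beta by (intro sum.cong refl) auto
    then show ?thesis
      by (simp add: inner_axis)
  qed
  have quat: "(\<Sum>u\<in>Basis. inner (a * u * c) u) = 4 * qRe a * qRe c" for a c :: quat
    by (simp add: Basis_quat_def inner_quat_def times_quat_def algebra_simps)
  show ?thesis
    unfolding sum_Basis_vec entry quat retr_def by (simp add: mult.assoc sum_product) (simp add: sum_distrib_left)
qed

lemma retr_add: "retr (X + Y) = retr X + retr Y"
  and retr_diff: "retr (X - Y) = retr X - retr Y"
  and retr_scaleR: "retr (r *\<^sub>R X) = r * retr X"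
  using linear_add[OF linear_retr] linear_diff[OF linear_retr] linear_scale[OF linear_retr] by auto

lemma retr_mat_1: "retr (mat 1 :: quat^'n^'n) = real CARD('n)"
  by (simp add: retr_def mat_def one_quat_def)

text \<open>The iterated bracket is a sum of four two-sided multiplications and has values in
  \<open>sl_quat\<close>, so its trace may be taken on all matrices. The two outer terms give
  \<open>8 n retr (X Y)\<close>, the mixed ones the product of the traces.\<close>

lemma killing_form_sl_quat:
  "killing_form sl_quat X (Y :: quat^'n^'n) = 8 * real CARD('n) * retr (X ** Y) - 8 * retr X * retr Y"
proof -
  define f where "f = (\<lambda>Z. lie_bracket X (lie_bracket Y Z))"
  have f: "f Z = X ** Y ** Z ** mat 1 - X ** Z ** Y - Y ** Z ** X + mat 1 ** Z ** (Y ** X)" for Z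
    by (simp add: f_def lie_bracket_def qmm_distribs matrix_mul_assoc)
  have "linear f"
    by (rule linearI) (simp_all add: f_def lie_bracket_def qmm_distribs scaleR_diff_right)
  moreover have "subspace (sl_quat :: (quat^'n^'n) set)"
    by (auto simp: sl_quat_eq subspace_def retr_add retr_scaleR linear_0[OF linear_retr])
  moreover have "range f \<subseteq> sl_quat"
    by (auto simp: f_def sl_quat_eq retr_lie_bracket)
  ultimately have "killing_form sl_quat X Y = (\<Sum>b\<in>Basis. inner (f b) b)"
    unfolding killing_form_def f_def[symmetric] by (rule trace_on_eq_sum_Basis)
  also have "\<dots> = 4 * retr (X ** Y) * retr (mat 1 :: quat^'n^'n) - 4 * retr X * retr Y - 4 * retr Y * retr X
      + 4 * retr (mat 1 :: quat^'n^'n) * retr (Y ** X)"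
    unfolding f trace_two_sided_mult[symmetric] inner_add_left inner_diff_left sum.distrib sum_subtractf ..
  finally show ?thesis
    by (simp add: retr_mat_1 retr_mult_commute[of Y])
qed

section \<open>The symplectic form of an orbit in terms of representatives\<close>

definition orbit_form :: "quat^'n^'n \<Rightarrow> quat^'n^'n \<Rightarrow> quat^'n^'n \<Rightarrow> real"
  where "orbit_form y X Y = 8 * real CARD('n) * retr (y ** lie_bracket X Y)"

text \<open>Invariance of the trace form, in the two shapes that show dependence on \<open>X\<close>
  only through \<open>lie_bracket X y\<close> and on \<open>Y\<close> only through
  \<open>lie_bracket Y y\<close>.\<close>

lemma retr_mult_lie_bracket:
  "retr (y ** lie_bracket X Y) = - retr (lie_bracket X y ** Y)"
  "retr (y ** lie_bracket X Y) = retr (X ** lie_bracket Y y)"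
proof -
  have "retr (y ** Y ** X) = retr (X ** y ** Y)"
    using retr_mult_commute[of "y ** Y" X] by (simp add: matrix_mul_assoc)
  moreover have "retr (y ** X ** Y) = retr (X ** Y ** y)"
    using retr_mult_commute[of y "X ** Y"] by (simp add: matrix_mul_assoc)
  ultimately show "retr (y ** lie_bracket X Y) = - retr (lie_bracket X y ** Y)"
    "retr (y ** lie_bracket X Y) = retr (X ** lie_bracket Y y)"
    by (simp_all add: lie_bracket_def qmm_distribs retr_diff matrix_mul_assoc)
qed

text \<open>Real multiples of the identity matrix are central, so one of them can be subtracted to
  remove the trace. Tangent vectors may therefore be represented by arbitrary matrices.\<close>

lemma sl_quat_representative:
  obtains X' where "X' \<in> sl_quat" "\<And>y. lie_bracket X' y = lie_bracket (X :: quat^'n^'n) y"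
proof
  define X' where "X' = X - (retr X / real CARD('n)) *\<^sub>R mat 1"
  show "X' \<in> sl_quat"
    by (simp add: X'_def sl_quat_eq retr_diff retr_scaleR retr_mat_1)
  show "lie_bracket X' y = lie_bracket X y" for y
    by (simp add: X'_def lie_bracket_def qmm_distribs)
qed

lemma orbit_symplectic_form_sl_quat:
  "orbit_symplectic_form sl_quat y (lie_bracket X y) (lie_bracket Y y) = orbit_form y X Y"
  unfolding orbit_symplectic_form_def
proof (rule the_equality)
  obtain X' where X': "X' \<in> sl_quat" "\<And>y. lie_bracket X' y = lie_bracket X y"
    using sl_quat_representative[of X] by blast
  obtain Y' where Y': "Y' \<in> sl_quat" "\<And>y. lie_bracket Y' y = lie_bracket Y y"
    using sl_quat_representative[of Y] by blast
  have eq: "killing_form sl_quat y (lie_bracket A B) = orbit_form y X Y"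
    if "lie_bracket X y = lie_bracket A y" "lie_bracket Y y = lie_bracket B y" for A B
  proof -
    \<comment> \<open>The first identity replaces \<open>A\<close> by \<open>X\<close>, the second
      \<open>B\<close> by \<open>Y\<close>.\<close>
    have "retr (y ** lie_bracket A B) = retr (y ** lie_bracket X Y)"
      using that retr_mult_lie_bracket by metis
    then show ?thesis
      by (simp add: killing_form_sl_quat retr_lie_bracket orbit_form_def)
  qed
  show "\<exists>A\<in>sl_quat. \<exists>B\<in>sl_quat. lie_bracket X y = lie_bracket A y \<and> lie_bracket Y y = lie_bracket B y \<and>
      orbit_form y X Y = killing_form sl_quat y (lie_bracket A B)"
    by (intro bexI[OF _ X'(1)] bexI[OF _ Y'(1)] conjI eq[symmetric]) (simp_all add: X' Y')
  fix c
  assume "\<exists>A\<in>sl_quat. \<exists>B\<in>sl_quat. lie_bracket X y = lie_bracket A y \<and> lie_bracket Y y = lie_bracket B y \<and>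
      c = killing_form sl_quat y (lie_bracket A B)"
  then show "c = orbit_form y X Y"
    using eq by blast
qed

lemma orbit_tangent_sl_quat: "orbit_tangent sl_quat y = range (\<lambda>X. lie_bracket X y)"
proof (intro equalityI subsetI)
  fix v assume "v \<in> range (\<lambda>X. lie_bracket X y)"
  then obtain X where X: "v = lie_bracket X y" by blast
  obtain X' where "X' \<in> sl_quat" "\<And>y. lie_bracket X' y = lie_bracket X y"
    using sl_quat_representative[of X] by blast
  then show "v \<in> orbit_tangent sl_quat y"
    unfolding orbit_tangent_def using X by (auto intro!: exI[of _ X'])
qed (auto simp: orbit_tangent_def)

section \<open>The Liouville measure\<close>

text \<open>Boxes from a countable base of the reals suffice: an open set is the union of those
  inside it, and the extensional choices of base sets over \<open>{..<d}\<close> are countably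
  many.\<close>

lemma openin_powertop_imp_sets_PiM:
  fixes d :: nat
  assumes "openin (powertop_real {..<d}) U"
  shows "U \<in> sets (\<Pi>\<^sub>M i\<in>{..<d}. lborel)"
proof -
  obtain B :: "real set set" where B: "countable B" "topological_basis B"
    using ex_countable_basis by blast
  define Q where "Q = {q \<in> {..<d} \<rightarrow>\<^sub>E B. Pi\<^sub>E {..<d} q \<subseteq> U}"
  have eq: "U = (\<Union>q\<in>Q. Pi\<^sub>E {..<d} q)"
  proof (intro equalityI subsetI)
    fix x assume "x \<in> U"
    then obtain V where V': "\<forall>i\<in>{..<d}. openin euclideanreal (V i)"
      and V: "x \<in> Pi\<^sub>E {..<d} V" "Pi\<^sub>E {..<d} V \<subseteq> U"
      using bspec[OF iffD1[OF openin_product_topology_alt assms] \<open>x \<in> U\<close>] by (elim exE conjE) (rule that)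
    have V_open: "open (V i)" if "i < d" for i
      using V' that open_openin by blast
    have "\<exists>b\<in>B. x i \<in> b \<and> b \<subseteq> V i" if "i < d" for i
    proof -
      have "x i \<in> V i"
        using V(1) that by (auto simp: PiE_iff)
      with topological_basisE[OF B(2) V_open[OF that]] show ?thesis
        by metis
    qed
    then obtain q where q: "\<And>i. i < d \<Longrightarrow> q i \<in> B \<and> x i \<in> q i \<and> q i \<subseteq> V i"
      by metis
    have "Pi\<^sub>E {..<d} (restrict q {..<d}) \<subseteq> Pi\<^sub>E {..<d} V"
      using q by (intro PiE_mono) auto
    then have "restrict q {..<d} \<in> Q"
      using q V(2) by (auto simp: Q_def)
    moreover have "x \<in> Pi\<^sub>E {..<d} (restrict q {..<d})"
      using q V(1) by (auto simp: PiE_iff)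
    ultimately show "x \<in> (\<Union>q\<in>Q. Pi\<^sub>E {..<d} q)"
      by blast
  qed (auto simp: Q_def)
  have "countable Q"
    unfolding Q_def using B(1) by (intro countable_subset[OF _ countable_PiE[of "{..<d}" "\<lambda>_. B"]]) auto
  moreover have "Pi\<^sub>E {..<d} q \<in> sets (\<Pi>\<^sub>M i\<in>{..<d}. lborel)" if "q \<in> Q" for q
    using that B(2) by (intro sets_PiM_I_finite) (auto simp: Q_def topological_basis_open PiE_iff)
  ultimately show ?thesis
    by (subst eq) (auto intro!: sets.countable_UN')
qed

text \<open>Continuity of the chart is given on \<open>U\<close>, so measurability is obtained on
  the space restricted to \<open>U\<close> and transferred by intersecting with
  \<open>U\<close>.\<close>

lemma chart_preimage_measurable:
  fixes d :: nat
  assumes U: "openin (powertop_real {..<d}) U"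
    and \<phi>: "continuous_map (subtopology (powertop_real {..<d}) U) euclidean \<phi>"
    and S: "S \<in> sets (\<Pi>\<^sub>M i\<in>{..<d}. lborel)" "S \<subseteq> U" and A: "A \<in> sets borel"
  shows "S \<inter> \<phi> -` A \<in> sets (\<Pi>\<^sub>M i\<in>{..<d}. lborel)"
proof -
  define M where "M = (\<Pi>\<^sub>M i\<in>{..<d}. lborel :: real measure)"
  have UM: "U \<in> sets M"
    unfolding M_def by (rule openin_powertop_imp_sets_PiM[OF U])
  have U': "U \<subseteq> space M"
    using sets.sets_into_space[OF UM] .
  have "\<phi> \<in> borel_measurable (restrict_space M U)"
  proof (rule borel_measurableI)
    fix T :: "'a set" assume "open T"
    then have "openin (subtopology (powertop_real {..<d}) U) {x \<in> topspace (subtopology (powertop_real {..<d}) U). \<phi> x \<in> T}"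
      using \<phi> by (auto simp: continuous_map)
    moreover have "{x \<in> topspace (subtopology (powertop_real {..<d}) U). \<phi> x \<in> T} = \<phi> -` T \<inter> U"
      using openin_subset[OF U] by auto
    ultimately have "openin (powertop_real {..<d}) (\<phi> -` T \<inter> U)"
      using U by (metis openin_trans_full)
    then have "\<phi> -` T \<inter> U \<in> sets M"
      unfolding M_def by (rule openin_powertop_imp_sets_PiM)
    then show "\<phi> -` T \<inter> space (restrict_space M U) \<in> sets (restrict_space M U)"
      using UM U' by (simp add: sets_restrict_space_iff space_restrict_space Int_absorb2)
  qed
  from measurable_sets[OF this A] have "\<phi> -` A \<inter> U \<in> sets M"
    using UM U' by (simp add: sets_restrict_space_iff space_restrict_space Int_absorb2)
  then have "S \<inter> (\<phi> -` A \<inter> U) \<in> sets M"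
    using S by (simp add: M_def)
  moreover have "S \<inter> (\<phi> -` A \<inter> U) = S \<inter> \<phi> -` A"
    using S by auto
  ultimately show ?thesis
    by (simp add: M_def)
qed

text \<open>The density of a chart need not be known to be measurable: \<^const>\<open>nn_integral\<close> is a lower
  integral, which is countably additive over disjoint measurable sets for every integrand.\<close>

lemma nn_integral_set_countable_subadditive:
  assumes S: "\<And>i::nat. S i \<in> sets M" and disj: "disjoint_family S"
  shows "(\<integral>\<^sup>+x\<in>(\<Union>i. S i). f x \<partial>M) \<le> (\<Sum>i. \<integral>\<^sup>+x\<in>S i. f x \<partial>M)"
proof -
  have "integral\<^sup>S M g \<le> (\<Sum>i. \<integral>\<^sup>+x\<in>S i. f x \<partial>M)"
    if g: "simple_function M g" "g \<le> (\<lambda>x. f x * indicator (\<Union>i. S i) x)" for g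
  proof -
    have meas: "g \<in> borel_measurable M"
      using g(1) by (rule borel_measurable_simple_function)
    have "g x = (\<Sum>i. g x * indicator (S i) x)" for x
    proof (cases "x \<in> (\<Union>i. S i)")
      case True
      then obtain j where j: "x \<in> S j" by blast
      then have "x \<notin> S i" if "i \<noteq> j" for i
        using that disj by (auto simp: disjoint_family_on_def)
      then have "(\<Sum>i. g x * indicator (S i) x) = (\<Sum>i\<in>{j}. g x * indicator (S i) x)"
        by (intro suminf_finite) auto
      then show ?thesis
        using j by simp
    next
      case False
      then have "g x = 0"
        using le_funD[OF g(2), of x] by simp
      then show ?thesis by simp
    qed
    then have "integral\<^sup>S M g = (\<integral>\<^sup>+x. (\<Sum>i. g x * indicator (S i) x) \<partial>M)"
      using nn_integral_eq_simple_integral[OF g(1)] by simp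
    also have "\<dots> = (\<Sum>i. \<integral>\<^sup>+x\<in>S i. g x \<partial>M)"
      using meas S by (intro nn_integral_suminf) auto
    also have "\<dots> \<le> (\<Sum>i. \<integral>\<^sup>+x\<in>S i. f x \<partial>M)"
    proof (intro suminf_le nn_integral_mono)
      fix i x
      have "g x \<le> f x"
        using order_trans[OF le_funD[OF g(2), of x]] by (auto simp: indicator_def split: if_splits)
      then show "g x * indicator (S i) x \<le> f x * indicator (S i) x"
        by (auto simp: indicator_def)
    qed auto
    finally show ?thesis .
  qed
  then show ?thesis
    unfolding nn_integral_def[of M "\<lambda>x. f x * indicator (\<Union>i. S i) x"] by (auto intro!: SUP_least)
qed

section \<open>The Liouville content and its additivity\<close>

fun restrict_piece :: "'a set \<Rightarrow> 'a piece \<Rightarrow> 'a piece"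
  where "restrict_piece A (d, S, \<phi>) = (d, S \<inter> \<phi> -` A, \<phi>)"

definition liouville_content :: "(quat^'n^'n) set \<Rightarrow> (quat^'n^'n) set \<Rightarrow> (quat^'n^'n) set \<Rightarrow> ennreal"
  where "liouville_content \<gg> \<O> A = (SUP F\<in>piece_families \<gg> \<O> A. \<Sum>p\<in>F. piece_volume \<gg> p)"

lemma piece_image_restrict: "piece_image (restrict_piece A p) = piece_image p \<inter> A"
  by (cases p) auto

lemma piece_volume_empty:
  assumes "piece_image p = {}"
  shows "piece_volume \<gg> p = 0"
  using assms by (cases p) auto

lemma piece_families_empty: "{} \<in> piece_families \<gg> \<O> A"
  by (simp add: piece_families_def disjoint_family_on_def)

text \<open>Disjointness of images does not tell apart pieces with empty image. Once these are
  removed, families over disjoint sets have no common member, so their volumes add.\<close>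

lemma piece_family_reduce:
  assumes "F \<in> piece_families \<gg> \<O> A"
  obtains F' where "F' \<in> piece_families \<gg> \<O> A" "\<And>p. p \<in> F' \<Longrightarrow> piece_image p \<noteq> {}"
    "(\<Sum>p\<in>F. piece_volume \<gg> p) = (\<Sum>p\<in>F'. piece_volume \<gg> p)"
proof
  define F' where "F' = {p \<in> F. piece_image p \<noteq> {}}"
  show "F' \<in> piece_families \<gg> \<O> A"
    using assms by (auto simp: piece_families_def F'_def disjoint_family_on_def)
  show "piece_image p \<noteq> {}" if "p \<in> F'" for p
    using that by (simp add: F'_def)
  show "(\<Sum>p\<in>F. piece_volume \<gg> p) = (\<Sum>p\<in>F'. piece_volume \<gg> p)"
    using assms by (intro sum.mono_neutral_right) (auto simp: F'_def piece_families_def piece_volume_empty)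
qed

lemma liouville_content_mono: "A \<subseteq> B \<Longrightarrow> liouville_content \<gg> \<O> A \<le> liouville_content \<gg> \<O> B"
  unfolding liouville_content_def by (rule SUP_subset_mono) (auto simp: piece_families_def)

lemma liouville_content_superadditive:
  assumes "A \<inter> B = {}"
  shows "liouville_content \<gg> \<O> A + liouville_content \<gg> \<O> B \<le> liouville_content \<gg> \<O> (A \<union> B)"
proof -
  have *: "(\<Sum>p\<in>F. piece_volume \<gg> p) + (\<Sum>p\<in>G. piece_volume \<gg> p) \<le> liouville_content \<gg> \<O> (A \<union> B)"
    if F: "F \<in> piece_families \<gg> \<O> A" and G: "G \<in> piece_families \<gg> \<O> B" for F G
  proof -
    obtain F' where F': "F' \<in> piece_families \<gg> \<O> A" "\<And>p. p \<in> F' \<Longrightarrow> piece_image p \<noteq> {}"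
      "(\<Sum>p\<in>F. piece_volume \<gg> p) = (\<Sum>p\<in>F'. piece_volume \<gg> p)"
      using piece_family_reduce[OF F] by blast
    obtain G' where G': "G' \<in> piece_families \<gg> \<O> B" "\<And>p. p \<in> G' \<Longrightarrow> piece_image p \<noteq> {}"
      "(\<Sum>p\<in>G. piece_volume \<gg> p) = (\<Sum>p\<in>G'. piece_volume \<gg> p)"
      using piece_family_reduce[OF G] by blast
    have cross: "piece_image p \<inter> piece_image q = {}" if "p \<in> F'" "q \<in> G'" for p q
      using that F'(1) G'(1) assms by (fastforce simp: piece_families_def)
    have "F' \<inter> G' = {}"
      using cross F'(2) by fastforce
    then have "(\<Sum>p\<in>F'. piece_volume \<gg> p) + (\<Sum>p\<in>G'. piece_volume \<gg> p) = (\<Sum>p\<in>F' \<union> G'. piece_volume \<gg> p)"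
      using F'(1) G'(1) by (intro sum.union_disjoint[symmetric]) (auto simp: piece_families_def)
    moreover have "F' \<union> G' \<in> piece_families \<gg> \<O> (A \<union> B)"
    proof -
      have "disjoint_family_on piece_image (F' \<union> G')"
        unfolding disjoint_family_on_def
      proof (intro ballI impI)
        fix p q assume pq: "p \<in> F' \<union> G'" "q \<in> F' \<union> G'" "p \<noteq> q"
        have "disjoint_family_on piece_image F'" "disjoint_family_on piece_image G'"
          using F'(1) G'(1) by (auto simp: piece_families_def)
        then have d: "piece_image p \<inter> piece_image q = {}" if "p \<in> F' \<and> q \<in> F' \<or> p \<in> G' \<and> q \<in> G'"
          using that pq(3) unfolding disjoint_family_on_def by blast
        from pq(1,2) consider "p \<in> F' \<and> q \<in> F' \<or> p \<in> G' \<and> q \<in> G'" | "p \<in> F'" "q \<in> G'" | "q \<in> F'" "p \<in> G'"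
          by blast
        then show "piece_image p \<inter> piece_image q = {}"
          using cross[of p q] cross[of q p] d by cases (simp_all add: Int_commute)
      qed
      then show ?thesis
        using F'(1) G'(1) unfolding piece_families_def by blast
    qed
    ultimately show ?thesis
      unfolding F'(3) G'(3) liouville_content_def by (auto intro: SUP_upper)
  qed
  have ne: "piece_families \<gg> \<O> C \<noteq> {}" for C
    using piece_families_empty by blast
  have "(\<Sum>p\<in>F. piece_volume \<gg> p) + liouville_content \<gg> \<O> B \<le> liouville_content \<gg> \<O> (A \<union> B)"
    if F: "F \<in> piece_families \<gg> \<O> A" for F
    unfolding liouville_content_def[of _ _ B]
    by (subst ennreal_SUP_add_right[OF ne]) (intro SUP_least * F)
  then show ?thesis
    unfolding liouville_content_def[of _ _ A]
    by (subst ennreal_SUP_add_left[OF ne, symmetric]) (intro SUP_least)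
qed

lemma liouville_content_sum_le:
  assumes "disjoint_family A"
  shows "(\<Sum>i<(n::nat). liouville_content \<gg> \<O> (A i)) \<le> liouville_content \<gg> \<O> (\<Union>i<n. A i)"
proof (induction n)
  case (Suc n)
  have "A i \<inter> A n = {}" if "i < n" for i
    using assms that by (simp add: disjoint_family_on_def)
  then have "(\<Union>i<n. A i) \<inter> A n = {}"
    by blast
  have "(\<Sum>i<Suc n. liouville_content \<gg> \<O> (A i)) \<le> liouville_content \<gg> \<O> (\<Union>i<n. A i) + liouville_content \<gg> \<O> (A n)"
    using Suc by (simp add: add_right_mono)
  also have "\<dots> \<le> liouville_content \<gg> \<O> ((\<Union>i<n. A i) \<union> A n)"
    by (rule liouville_content_superadditive) fact
  also have "(\<Union>i<n. A i) \<union> A n = (\<Union>i<Suc n. A i)"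
    by (auto simp: lessThan_Suc)
  finally show ?case .
qed simp

lemma orbit_piece_restrict:
  assumes p: "orbit_piece \<gg> \<O> p" and A: "A \<in> sets (restrict_space borel \<O>)"
  shows "orbit_piece \<gg> \<O> (restrict_piece A p)"
proof (cases p)
  case (fields d S \<phi>)
  from A obtain B where B: "B \<in> sets borel" "A = \<O> \<inter> B"
    unfolding sets_restrict_space by blast
  from p fields obtain U where U: "S \<in> sets (\<Pi>\<^sub>M i\<in>{..<d}. lborel)" "orbit_chart \<gg> \<O> d U \<phi>" "S \<subseteq> U"
    by auto
  then have *: "openin (powertop_real {..<d}) U" "\<phi> ` U \<subseteq> \<O>"
    "continuous_map (subtopology (powertop_real {..<d}) U) euclidean \<phi>"
    by (auto simp: orbit_chart_def)
  have "S \<inter> \<phi> -` B \<in> sets (\<Pi>\<^sub>M i\<in>{..<d}. lborel)"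
    by (rule chart_preimage_measurable[OF *(1,3) U(1,3) B(1)])
  moreover have "S \<inter> \<phi> -` A = S \<inter> \<phi> -` B"
    using *(2) U(3) B(2) by blast
  ultimately show ?thesis
    using U fields by auto
qed

lemma piece_volume_le_suminf:
  assumes p: "orbit_piece \<gg> \<O> p" and A: "range A \<subseteq> sets (restrict_space borel \<O>)" "disjoint_family A"
    and im: "piece_image p \<subseteq> (\<Union>i. A i)"
  shows "piece_volume \<gg> p \<le> (\<Sum>i::nat. piece_volume \<gg> (restrict_piece (A i) p))"
proof (cases p)
  case (fields d S \<phi>)
  have "S \<inter> \<phi> -` A i \<in> sets (\<Pi>\<^sub>M i\<in>{..<d}. lborel)" for i
    using orbit_piece_restrict[OF p, of "A i"] A(1) fields by auto
  moreover have "disjoint_family (\<lambda>i. S \<inter> \<phi> -` A i)"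
    using A(2) by (auto simp: disjoint_family_on_def)
  ultimately have "(\<integral>\<^sup>+x\<in>(\<Union>i. S \<inter> \<phi> -` A i). ennreal (liouville_density \<gg> d \<phi> x) \<partial>(\<Pi>\<^sub>M i\<in>{..<d}. lborel))
    \<le> (\<Sum>i. \<integral>\<^sup>+x\<in>S \<inter> \<phi> -` A i. ennreal (liouville_density \<gg> d \<phi> x) \<partial>(\<Pi>\<^sub>M i\<in>{..<d}. lborel))"
    by (rule nn_integral_set_countable_subadditive)
  moreover have "\<phi> ` S \<subseteq> (\<Union>i. A i)"
    using im fields by simp
  then have "(\<Union>i. S \<inter> \<phi> -` A i) = S"
    by blast
  ultimately show ?thesis
    using fields by simp
qed

lemma sum_restrict_piece_le_content:
  assumes F: "F \<in> piece_families \<gg> \<O> B" and A: "A \<in> sets (restrict_space borel \<O>)"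
  shows "(\<Sum>p\<in>F. piece_volume \<gg> (restrict_piece A p)) \<le> liouville_content \<gg> \<O> A"
proof -
  \<comment> \<open>Distinct pieces can have equal restrictions, but only with empty image; these
    are dropped before reindexing.\<close>
  define G where "G = {p \<in> F. piece_image (restrict_piece A p) \<noteq> {}}"
  have fin: "finite F" and pieces: "\<And>p. p \<in> F \<Longrightarrow> orbit_piece \<gg> \<O> p"
    and disj: "\<And>p q. p \<in> F \<Longrightarrow> q \<in> F \<Longrightarrow> p \<noteq> q \<Longrightarrow> piece_image p \<inter> piece_image q = {}"
    using F unfolding piece_families_def disjoint_family_on_def by blast+
  have inj: "inj_on (restrict_piece A) G"
  proof (rule inj_onI, rule ccontr)
    fix p q assume "p \<in> G" "q \<in> G" and eq: "restrict_piece A p = restrict_piece A q" and "p \<noteq> q"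
    then have "piece_image p \<inter> piece_image q = {}" "piece_image (restrict_piece A p) \<noteq> {}"
      using disj by (auto simp: G_def)
    then show False
      using arg_cong[OF eq, of piece_image] unfolding piece_image_restrict by blast
  qed
  have "(\<Sum>p\<in>F. piece_volume \<gg> (restrict_piece A p)) = (\<Sum>p\<in>G. piece_volume \<gg> (restrict_piece A p))"
    using fin by (intro sum.mono_neutral_right) (auto simp: G_def piece_volume_empty)
  also have "\<dots> = (\<Sum>p\<in>restrict_piece A ` G. piece_volume \<gg> p)"
    using inj by (simp add: sum.reindex)
  also have "\<dots> \<le> liouville_content \<gg> \<O> A"
    unfolding liouville_content_def
  proof (rule SUP_upper)
    have "disjoint_family_on piece_image (restrict_piece A ` G)"
      unfolding disjoint_family_on_def
    proof (intro ballI impI)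
      fix p' q' assume "p' \<in> restrict_piece A ` G" "q' \<in> restrict_piece A ` G" "p' \<noteq> q'"
      then obtain p q where "p' = restrict_piece A p" "q' = restrict_piece A q" "p \<in> F" "q \<in> F" "p \<noteq> q"
        unfolding G_def by blast
      then show "piece_image p' \<inter> piece_image q' = {}"
        using disj[of p q] by (auto simp: piece_image_restrict)
    qed
    then show "restrict_piece A ` G \<in> piece_families \<gg> \<O> A"
      using fin orbit_piece_restrict[OF pieces A]
      by (simp add: piece_families_def G_def piece_image_restrict)
  qed
  finally show ?thesis .
qed

text \<open>Countable additivity is essential here, because \<open>measure_of\<close> returns the
  zero measure for a set function without it. One inequality comes from joining finite families, the
  other from cutting every piece along the sets \<open>A i\<close>.\<close>

lemma emeasure_liouville_measure:
  assumes "A \<in> sets (restrict_space borel \<O>)"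
  shows "emeasure (liouville_measure \<gg> \<O>) A = liouville_content \<gg> \<O> A"
proof -
  define M where "M = sets (restrict_space borel \<O>)"
  have sig: "sigma_algebra \<O> M"
    using sets.sigma_algebra_axioms[of "restrict_space borel \<O>"] by (simp add: M_def space_restrict_space)
  have "positive M (liouville_content \<gg> \<O>)"
  proof -
    have "(\<Sum>p\<in>F. piece_volume \<gg> p) = 0" if "F \<in> piece_families \<gg> \<O> {}" for F
      using that by (intro sum.neutral ballI piece_volume_empty) (auto simp: piece_families_def)
    then have "liouville_content \<gg> \<O> {} \<le> 0"
      unfolding liouville_content_def by (intro SUP_least) simp
    then show ?thesis
      by (simp add: positive_def)
  qed
  moreover have "countably_additive M (liouville_content \<gg> \<O>)"
    unfolding countably_additive_def
  proof (intro allI impI antisym)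
    fix A :: "nat \<Rightarrow> (quat^'a^'a) set"
    assume A: "range A \<subseteq> M" "disjoint_family A" "\<Union> (range A) \<in> M"
    show "(\<Sum>i. liouville_content \<gg> \<O> (A i)) \<le> liouville_content \<gg> \<O> (\<Union>i. A i)"
      unfolding suminf_eq_SUP
    proof (rule SUP_least)
      fix n
      have "(\<Sum>i<n. liouville_content \<gg> \<O> (A i)) \<le> liouville_content \<gg> \<O> (\<Union>i<n. A i)"
        by (rule liouville_content_sum_le[OF A(2)])
      also have "\<dots> \<le> liouville_content \<gg> \<O> (\<Union>i. A i)"
        by (rule liouville_content_mono) auto
      finally show "(\<Sum>i<n. liouville_content \<gg> \<O> (A i)) \<le> liouville_content \<gg> \<O> (\<Union>i. A i)" .
    qed
    show "liouville_content \<gg> \<O> (\<Union>i. A i) \<le> (\<Sum>i. liouville_content \<gg> \<O> (A i))"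
      unfolding liouville_content_def[of _ _ "\<Union>i. A i"]
    proof (rule SUP_least)
      fix F assume F: "F \<in> piece_families \<gg> \<O> (\<Union>i. A i)"
      have "(\<Sum>p\<in>F. piece_volume \<gg> p) \<le> (\<Sum>p\<in>F. \<Sum>i. piece_volume \<gg> (restrict_piece (A i) p))"
        using F A by (intro sum_mono piece_volume_le_suminf) (auto simp: piece_families_def M_def)
      also have "\<dots> = (\<Sum>i. \<Sum>p\<in>F. piece_volume \<gg> (restrict_piece (A i) p))"
        by (intro suminf_sum[symmetric]) simp
      also have "\<dots> \<le> (\<Sum>i. liouville_content \<gg> \<O> (A i))"
        using A by (intro suminf_le sum_restrict_piece_le_content[OF F]) (auto simp: M_def)
      finally show "(\<Sum>p\<in>F. piece_volume \<gg> p) \<le> (\<Sum>i. liouville_content \<gg> \<O> (A i))" .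
    qed
  qed
  moreover have "liouville_measure \<gg> \<O> = measure_of \<O> M (liouville_content \<gg> \<O>)"
    unfolding liouville_measure_def M_def liouville_content_def[abs_def] ..
  ultimately show ?thesis
    using assms by (simp add: emeasure_measure_of_sigma[OF sig] M_def[symmetric])
qed

section \<open>Symplectic bases\<close>

text \<open>Basis vectors are ordered in adjacent pairs \<open>2k, 2k + 1\<close>, matching the
  arguments that \<open>two_form_power\<close> feeds to the form.\<close>

definition partner :: "nat \<Rightarrow> nat"
  where "partner i = (if even i then Suc i else i - 1)"

definition parity_sign :: "nat \<Rightarrow> real"
  where "parity_sign i = (if even i then 1 else - 1)"

text \<open>The Gram matrix of a symplectic basis in this ordering.\<close>

definition std_symplectic :: "nat \<Rightarrow> nat \<Rightarrow> real"
  where "std_symplectic i j = (if j = partner i then parity_sign i else 0)"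

lemma partner_partner [simp]: "partner (partner i) = i"
  by (auto simp: partner_def elim: oddE)

lemma even_partner [simp]: "even (partner i) \<longleftrightarrow> odd i"
  by (auto simp: partner_def elim: oddE)

lemma partner_div_2 [simp]: "partner i div 2 = i div 2"
  by (auto simp: partner_def elim: oddE)

lemma partner_less [simp]: "partner i < 2 * m \<longleftrightarrow> i < 2 * m"
  by (metis partner_div_2 div_less_iff_less_mult mult.commute zero_less_numeral)

lemma parity_sign_partner [simp]: "parity_sign (partner i) = - parity_sign i"
  by (simp add: parity_sign_def)

lemma parity_sign_square [simp]: "parity_sign i * parity_sign i = 1"
  by (simp add: parity_sign_def)

text \<open>The product of the transpositions of \<open>2k\<close> and \<open>2k + 1\<close> over
  \<open>k\<close> in \<open>E\<close>.\<close>

definition swap_pairs :: "nat set \<Rightarrow> nat \<Rightarrow> nat"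
  where "swap_pairs E i = (if i div 2 \<in> E then partner i else i)"

lemma swap_pairs_swap_pairs [simp]: "swap_pairs E (swap_pairs E i) = i"
  by (simp add: swap_pairs_def)

lemma swap_pairs_permutes:
  assumes "E \<subseteq> {..<m}"
  shows "swap_pairs E permutes {..<2 * m}"
proof (rule bij_imp_permutes)
  show "bij_betw (swap_pairs E) {..<2 * m} {..<2 * m}"
    by (rule bij_betw_byWitness[where f' = "swap_pairs E"]) (auto simp: swap_pairs_def)
  show "swap_pairs E x = x" if "x \<notin> {..<2 * m}" for x
    using that assms by (auto simp: swap_pairs_def)
qed

lemma swap_pairs_permutation:
  assumes "finite E"
  shows "permutation (swap_pairs E)"
proof -
  obtain m where "E \<subseteq> {..<m}"
    using assms finite_nat_iff_bounded by blast
  then show ?thesis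
    using swap_pairs_permutes permutation_permutes by blast
qed

lemma sign_swap_pairs:
  assumes "finite E"
  shows "sign (swap_pairs E) = (- 1) ^ card E"
  using assms
proof (induction E)
  case empty
  have "swap_pairs {} = id"
    by (simp add: swap_pairs_def fun_eq_iff)
  then show ?case by (simp add: sign_id)
next
  case (insert k E)
  have "swap_pairs (insert k E) = Transposition.transpose (2 * k) (Suc (2 * k)) \<circ> swap_pairs E"
  proof
    fix i
    have "i = 2 * k \<or> i = Suc (2 * k)" if "i div 2 = k"
      using that by linarith
    then show "swap_pairs (insert k E) i = (Transposition.transpose (2 * k) (Suc (2 * k)) \<circ> swap_pairs E) i"
      using insert.hyps by (auto simp: swap_pairs_def Transposition.transpose_def partner_def elim: oddE)
  qed
  then have "sign (swap_pairs (insert k E)) = sign (Transposition.transpose (2 * k) (Suc (2 * k))) * sign (swap_pairs E)"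
    using insert.hyps by (simp add: sign_compose permutation_swap_id swap_pairs_permutation)
  then show ?case
    using insert by (simp add: sign_swap_id)
qed

text \<open>A permutation that preserves the pairs \<open>{2k, 2k+1}\<close> is, up to swapping some pairs, a
  permutation of the even numbers together with its copy on the odd ones, so that the sign only
  counts the swapped pairs.\<close>

lemma sign_pair_preserving:
  assumes \<sigma>: "\<sigma> permutes {..<2 * m}" and pair: "\<And>k. k < m \<Longrightarrow> \<sigma> (2 * k + 1) = partner (\<sigma> (2 * k))"
  shows "of_int (sign \<sigma>) = (\<Prod>k<m. parity_sign (\<sigma> (2 * k)))"
proof -
  have comm: "\<sigma> (partner i) = partner (\<sigma> i)" if "i < 2 * m" for i
  proof (cases "even i")
    case True
    then show ?thesis
      using that pair[of "i div 2"] by (auto simp: partner_def elim!: evenE)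
  next
    case False
    then obtain k where "i = 2 * k + 1" by (rule oddE)
    then show ?thesis
      using that pair[of k] by (simp add: partner_def[of "Suc (2 * k)"])
  qed
  have lt: "\<sigma> i < 2 * m \<longleftrightarrow> i < 2 * m" for i
    using permutes_in_image[OF \<sigma>, of i] by simp
  \<comment> \<open>These are the pairs whose first element goes to an odd number; swapping them
    beforehand makes \<open>\<sigma>'\<close> preserve parity.\<close>
  define E where "E = {k. k < m \<and> odd (\<sigma> (2 * k))}"
  have fE: "finite E" and Em: "E \<subseteq> {..<m}"
    by (auto simp: E_def)
  define \<sigma>' where "\<sigma>' = \<sigma> \<circ> swap_pairs E"
  have \<sigma>': "\<sigma>' permutes {..<2 * m}"
    unfolding \<sigma>'_def by (rule permutes_compose[OF swap_pairs_permutes[OF Em] \<sigma>])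
  have lt': "\<sigma>' i < 2 * m \<longleftrightarrow> i < 2 * m" for i
    using permutes_in_image[OF \<sigma>', of i] by simp
  have fix': "\<sigma>' i = i" if "\<not> i < 2 * m" for i
    using \<sigma>' that by (simp add: permutes_def)
  have comm': "\<sigma>' (partner i) = partner (\<sigma>' i)" if "i < 2 * m" for i
    using that comm by (simp add: \<sigma>'_def swap_pairs_def)
  have par_even: "even (\<sigma>' i)" if "even i" for i
  proof (cases "i < 2 * m")
    case True
    then show ?thesis
      using that comm[of i] by (auto simp: \<sigma>'_def swap_pairs_def E_def elim!: evenE)
  qed (use that fix' in simp)
  have par: "even (\<sigma>' i) \<longleftrightarrow> even i" for i
  proof (cases "i < 2 * m")
    case True
    then show ?thesis
      using par_even[of i] par_even[of "partner i"] comm'[of i] by auto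
  qed (use fix' in simp)
  define A where "A = (\<lambda>i. if even i then \<sigma>' i else i)"
  define B where "B = (\<lambda>i. if odd i then \<sigma>' i else i)"
  define T where "T = swap_pairs {..<m}"
  have inj': "\<sigma>' i = \<sigma>' j \<longleftrightarrow> i = j" for i j
    using permutes_inj[OF \<sigma>'] by (auto simp: inj_def)
  have A: "A permutes {..<2 * m}"
  proof (rule bij_imp_permutes)
    have "inj_on A {..<2 * m}"
      by (rule inj_onI) (auto simp: A_def inj' split: if_splits dest: arg_cong[of _ _ even] simp: par)
    moreover have "A ` {..<2 * m} \<subseteq> {..<2 * m}"
      by (auto simp: A_def lt')
    ultimately show "bij_betw A {..<2 * m} {..<2 * m}"
      by (simp add: bij_betw_def endo_inj_surj)
    show "A x = x" if "x \<notin> {..<2 * m}" for x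
      using that fix' by (simp add: A_def)
  qed
  have T: "T permutes {..<2 * m}"
    unfolding T_def by (rule swap_pairs_permutes) simp
  have T_eq: "T i = (if i < 2 * m then partner i else i)" for i
    by (auto simp: T_def swap_pairs_def)
  \<comment> \<open>The involution \<open>T\<close> exchanges even and odd numbers below
    \<open>2 * m\<close>, so \<open>B\<close> is a conjugate of \<open>A\<close> and has the same
    sign; hence \<open>\<sigma>'\<close> is an even permutation.\<close>
  have "B = T \<circ> (A \<circ> T)"
  proof
    fix i
    show "B i = (T \<circ> (A \<circ> T)) i"
      using comm'[of i] lt'[of i] fix'[of i] by (auto simp: A_def B_def T_eq)
  qed
  have perm: "permutation p" if "p permutes {..<2 * m}" for p
    using that permutation_permutes by blast
  have "\<sigma>' = A \<circ> B"
    using par by (auto simp: A_def B_def fun_eq_iff)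
  then have "sign \<sigma>' = sign A * (sign T * (sign A * sign T))"
    using perm[OF A] perm[OF T] \<open>B = T \<circ> (A \<circ> T)\<close> by (simp add: sign_compose permutation_compose)
  also have "\<dots> = 1"
    by (metis mult.commute mult.left_commute mult_1_right sign_idempotent)
  finally have "sign \<sigma>' = 1" .
  moreover have "sign \<sigma>' = sign \<sigma> * (- 1) ^ card E"
    unfolding \<sigma>'_def using perm[OF \<sigma>] by (simp add: sign_compose swap_pairs_permutation fE sign_swap_pairs)
  ultimately have "sign \<sigma> = (- 1) ^ card E"
    by (cases "even (card E)") auto
  moreover have "(\<Prod>k<m. parity_sign (\<sigma> (2 * k))) = (\<Prod>k\<in>E. - 1)"
    by (rule prod.mono_neutral_cong_right) (auto simp: E_def parity_sign_def)
  ultimately show ?thesis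
    by simp
qed

text \<open>Every permutation contributes \<open>0\<close> or \<open>1\<close>: a nonzero product of
  matrix entries requires it to preserve the pairs, and then the product equals its sign. The
  identity contributes \<open>1\<close>.\<close>

lemma two_form_power_std_symplectic_pos:
  assumes "\<And>i j. i < 2 * m \<Longrightarrow> j < 2 * m \<Longrightarrow> \<omega> (v i) (v j) = std_symplectic i j"
  shows "two_form_power \<omega> m v > 0"
proof -
  have summand: "of_int (sign \<sigma>) * (\<Prod>k<m. \<omega> (v (\<sigma> (2 * k))) (v (\<sigma> (2 * k + 1))))
     = (if \<forall>k<m. \<sigma> (2 * k + 1) = partner (\<sigma> (2 * k)) then 1 else 0)" (is "?t \<sigma> = _")
    if \<sigma>: "\<sigma> permutes {..<2 * m}" for \<sigma>
  proof -
    have lt: "\<sigma> i < 2 * m" if "i < 2 * m" for i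
      using permutes_in_image[OF \<sigma>, of i] that by simp
    have "(\<Prod>k<m. \<omega> (v (\<sigma> (2 * k))) (v (\<sigma> (2 * k + 1)))) = (\<Prod>k<m. std_symplectic (\<sigma> (2 * k)) (\<sigma> (2 * k + 1)))"
      by (intro prod.cong refl assms lt) auto
    also have "of_int (sign \<sigma>) * \<dots> = (if \<forall>k<m. \<sigma> (2 * k + 1) = partner (\<sigma> (2 * k)) then 1 else 0)"
    proof (cases "\<forall>k<m. \<sigma> (2 * k + 1) = partner (\<sigma> (2 * k))")
      case True
      then have "(\<Prod>k<m. std_symplectic (\<sigma> (2 * k)) (\<sigma> (2 * k + 1))) = of_int (sign \<sigma>)"
        by (simp add: sign_pair_preserving[OF \<sigma>] std_symplectic_def)
      then show ?thesis
        using True by (simp add: of_int_mult[symmetric] sign_idempotent del: of_int_mult)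
    next
      case False
      then have "(\<Prod>k<m. std_symplectic (\<sigma> (2 * k)) (\<sigma> (2 * k + 1))) = 0"
        by (intro prod_zero) (auto simp: std_symplectic_def)
      then show ?thesis
        by (simp only: False if_False mult_zero_right)
    qed
    finally show ?thesis .
  qed
  have "0 < (\<Sum>\<sigma> | \<sigma> permutes {..<2 * m}. ?t \<sigma>)"
  proof (rule sum_pos2[of _ id])
    show "finite {\<sigma>. \<sigma> permutes {..<2 * m}}"
      by (simp add: finite_permutations)
    show "0 < ?t id"
      by (subst summand) (auto simp: permutes_id partner_def)
    show "0 \<le> ?t \<sigma>" if "\<sigma> \<in> {\<sigma>. \<sigma> permutes {..<2 * m}}" for \<sigma>
      using that by (subst summand) auto
  qed (auto simp: permutes_id)
  then show ?thesis
    unfolding two_form_power_def by simp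
qed

text \<open>A family with the standard Gram matrix is independent, so a longest one exists. What
  remains of a vector after its components along the family are removed must pair to zero with
  everything, since otherwise it would start a further pair. The form may be degenerate: the
  remainder is a projection onto its radical.\<close>

lemma symplectic_projection_exists:
  fixes \<omega> :: "'a::euclidean_space \<Rightarrow> 'a \<Rightarrow> real"
  assumes "bounded_bilinear \<omega>" and alt: "\<And>x. \<omega> x x = 0"
  obtains m X where "\<And>i j. i < 2 * m \<Longrightarrow> j < 2 * m \<Longrightarrow> \<omega> (X i) (X j) = std_symplectic i j"
    "\<And>v u. \<omega> (v - (\<Sum>i<2 * m. (parity_sign i * \<omega> v (X (partner i))) *\<^sub>R X i)) u = 0"
proof -
  interpret w: bounded_bilinear \<omega> by fact
  have skew: "\<omega> x y = - \<omega> y x" for x y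
    using alt[of "x + y"] unfolding w.add_left w.add_right by (simp add: alt)
  define P where "P = (\<lambda>m. \<exists>X. \<forall>i<2 * m. \<forall>j<2 * m. \<omega> (X i) (X j) = std_symplectic i j)"
  have pair: "\<omega> (\<Sum>i<2 * m. a i *\<^sub>R X i) (X j) = - parity_sign j * a (partner j)"
    if X: "\<forall>i<2 * m. \<forall>j<2 * m. \<omega> (X i) (X j) = std_symplectic i j" and j: "j < 2 * m" for X a j m
  proof -
    have "\<omega> (\<Sum>i<2 * m. a i *\<^sub>R X i) (X j) = (\<Sum>i<2 * m. if i = partner j then - parity_sign j * a (partner j) else 0)"
      unfolding w.sum_left using X j
      by (intro sum.cong refl) (auto simp: w.scaleR_left std_symplectic_def)
    then show ?thesis
      using j by simp
  qed
  have bound: "m \<le> DIM('a)" if Pm: "P m" for m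
  proof -
    obtain X where X: "\<forall>i<2 * m. \<forall>j<2 * m. \<omega> (X i) (X j) = std_symplectic i j"
      using Pm unfolding P_def by blast
    have inj: "inj_on X {..<2 * m}"
    proof (rule inj_onI)
      fix i j assume ij: "i \<in> {..<2 * m}" "j \<in> {..<2 * m}" "X i = X j"
      then have "std_symplectic i (partner i) = std_symplectic j (partner i)"
        using X by (metis lessThan_iff partner_less)
      then show "i = j"
        by (auto simp: std_symplectic_def parity_sign_def split: if_splits) (metis partner_partner)+
    qed
    have "independent (X ` {..<2 * m})"
    proof (rule independent_if_scalars_zero)
      fix f x assume "(\<Sum>x\<in>X ` {..<2 * m}. f x *\<^sub>R x) = 0" and x: "x \<in> X ` {..<2 * m}"
      then have 0: "(\<Sum>i<2 * m. f (X i) *\<^sub>R X i) = 0"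
        by (simp add: sum.reindex[OF inj])
      obtain i where i: "i < 2 * m" "x = X i"
        using x by blast
      then have "- parity_sign (partner i) * f (X i) = 0"
        using pair[OF X, of "partner i" "\<lambda>i. f (X i)"] by (simp add: 0 w.zero_left)
      then show "f x = 0"
        using i by (auto simp: parity_sign_def split: if_splits)
    qed simp
    then have "card (X ` {..<2 * m}) \<le> DIM('a)"
      using independent_bound by blast
    then show ?thesis
      by (simp add: card_image[OF inj])
  qed
  have "P 0"
    by (simp add: P_def)
  then obtain m where m: "P m" "\<And>n. P n \<Longrightarrow> n \<le> m"
    using Nat.ex_has_greatest_nat[of P 0 "DIM('a)"] bound by auto
  then obtain X where X: "\<forall>i<2 * m. \<forall>j<2 * m. \<omega> (X i) (X j) = std_symplectic i j"
    unfolding P_def by blast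
  define Q where "Q = (\<lambda>v. v - (\<Sum>i<2 * m. (parity_sign i * \<omega> v (X (partner i))) *\<^sub>R X i))"
  have orth: "\<omega> (Q v) (X j) = 0" if "j < 2 * m" for v j
    unfolding Q_def w.diff_left pair[OF X that] by (simp add: mult.assoc[symmetric])
  have "\<omega> (Q v) u = 0" for v u
  proof (rule ccontr)
    assume nz: "\<omega> (Q v) u \<noteq> 0"
    have "\<omega> (Q v) (\<Sum>i<2 * m. a i *\<^sub>R X i) = 0" for a
      by (simp add: w.sum_right w.scaleR_right orth)
    moreover have "Q u = u - (\<Sum>i<2 * m. (parity_sign i * \<omega> u (X (partner i))) *\<^sub>R X i)"
      by (simp add: Q_def)
    \<comment> \<open>\<open>Q v\<close> is orthogonal to the family, so \<open>u\<close> may be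
      replaced by \<open>Q u\<close>, which is orthogonal to it too and can serve as the partner of
      a multiple of \<open>Q v\<close>.\<close>
    ultimately have vu: "\<omega> (Q v) (Q u) = \<omega> (Q v) u"
      by (metis w.diff_right diff_zero)
    define Y where "Y = (\<lambda>i. if i < 2 * m then X i else if i = 2 * m then (1 / \<omega> (Q v) u) *\<^sub>R Q v else Q u)"
    have "\<omega> (Y i) (Y j) = std_symplectic i j" if ij: "i < 2 * Suc m" "j < 2 * Suc m" for i j
    proof -
      have orth': "\<omega> (X j) (Q v) = 0" if "j < 2 * m" for v j
        using orth[OF that] skew[of "X j"] by simp
      have cases: "i < 2 * m \<or> i = 2 * m \<or> i = Suc (2 * m)" "j < 2 * m \<or> j = 2 * m \<or> j = Suc (2 * m)"
        using ij by auto
      have p: "partner (2 * m) = Suc (2 * m)" "partner (Suc (2 * m)) = 2 * m"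
        by (simp_all add: partner_def)
      have np: "2 * m \<noteq> partner k" "Suc (2 * m) \<noteq> partner k" if "k < 2 * m" for k
        using partner_less[of k m] that by linarith+
      show ?thesis
        using cases X nz np[of i]
        by (elim disjE) (auto simp: Y_def orth orth' w.scaleR_left w.scaleR_right alt vu skew[of "Q u"]
            std_symplectic_def p parity_sign_def)
    qed
    then have "P (Suc m)"
      unfolding P_def by blast
    then show False
      using m(2) by fastforce
  qed
  with X that show thesis
    unfolding Q_def by blast
qed

section \<open>Charts of an adjoint orbit\<close>

lemma matrix_inv_near_mat_1:
  obtains \<rho> :: real where "0 < \<rho>" "\<And>Z :: quat^'n^'n. norm Z < \<rho> \<Longrightarrow> invertible (mat 1 + Z)"
    "continuous_on (ball 0 \<rho>) (\<lambda>Z :: quat^'n^'n. matrix_inv (mat 1 + Z))"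
proof -
  obtain K where K: "K > 0" "\<And>(A :: quat^'n^'n) (B :: quat^'n^'n). norm (A ** B) \<le> norm A * norm B * K"
    using qmm.pos_bounded by metis
  \<comment> \<open>\<open>K\<close> bounds the matrix product, so within this radius multiplication
    by \<open>Z\<close> at least halves the norm.\<close>
  define \<rho> where "\<rho> = 1 / (2 * K)"
  have half: "norm (Z ** A) \<le> norm A / 2" if "norm Z < \<rho>" for Z A :: "quat^'n^'n"
  proof -
    have "norm (Z ** A) \<le> norm A * (norm Z * K)"
      using K(2)[of Z A] by (simp add: mult_ac)
    also have "\<dots> \<le> norm A * (1 / 2)"
      using that K(1) by (intro mult_left_mono) (auto simp: \<rho>_def field_simps)
    finally show ?thesis by simp
  qed
  have ker: "A = 0" if "norm Z < \<rho>" "(mat 1 + Z) ** A = 0" for Z A :: "quat^'n^'n"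
  proof -
    have "A = - (Z ** A)"
      using that(2) by (simp add: qmm.add_left eq_neg_iff_add_eq_0)
    then have "norm A \<le> norm A / 2"
      using half[OF that(1), of A] by (metis norm_minus_cancel)
    then show ?thesis by simp
  qed
  have inv: "invertible (mat 1 + Z)" if Z: "norm Z < \<rho>" for Z :: "quat^'n^'n"
  proof -
    have lin: "linear (\<lambda>A :: quat^'n^'n. (mat 1 + Z) ** A)"
      by (rule linearI) (simp_all add: qmm.add_right qmm.scaleR_right)
    have "inj (\<lambda>A :: quat^'n^'n. (mat 1 + Z) ** A)"
      unfolding linear_injective_0[OF lin] using ker[OF Z] by blast
    then have "surj (\<lambda>A :: quat^'n^'n. (mat 1 + Z) ** A)"
      using linear_injective_imp_surjective[OF lin] by simp
    then obtain B :: "quat^'n^'n" where B: "(mat 1 + Z) ** B = mat 1"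
      by (metis surjD)
    have "(mat 1 + Z) ** (B ** (mat 1 + Z) - mat 1) = 0"
      by (simp add: qmm.diff_right matrix_mul_assoc B)
    then have "B ** (mat 1 + Z) - mat 1 = 0"
      by (rule ker[OF Z])
    then show ?thesis
      using B unfolding invertible_def by (intro exI[of _ B]) simp
  qed
  \<comment> \<open>From \<open>H = mat 1 - Z ** H\<close> the norm of the inverse is at most that
    of \<open>mat 1\<close> plus half of itself.\<close>
  define C where "C = 2 * norm (mat 1 :: quat^'n^'n)"
  have bound: "norm (matrix_inv (mat 1 + Z)) \<le> C" if Z: "norm Z < \<rho>" for Z :: "quat^'n^'n"
  proof -
    define H where "H = matrix_inv (mat 1 + Z)"
    have "(mat 1 + Z) ** H = mat 1"
      unfolding H_def by (rule matrix_inv_props[OF inv[OF Z]])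
    then have "H = mat 1 - Z ** H"
      by (simp add: qmm.add_left algebra_simps)
    then have "norm H \<le> norm (mat 1 :: quat^'n^'n) + norm (Z ** H)"
      by (metis norm_triangle_ineq4)
    then show ?thesis
      using half[OF Z, of H] by (simp add: C_def H_def)
  qed
  have "continuous_on (ball 0 \<rho>) (\<lambda>Z :: quat^'n^'n. matrix_inv (mat 1 + Z))"
  proof (rule lipschitz_on_continuous_on)
    show "(C * C * K * K)-lipschitz_on (ball 0 \<rho>) (\<lambda>Z :: quat^'n^'n. matrix_inv (mat 1 + Z))"
    proof (rule lipschitz_onI)
      fix Z Z' :: "quat^'n^'n" assume "Z \<in> ball 0 \<rho>" "Z' \<in> ball 0 \<rho>"
      then have Z: "norm Z < \<rho>" and Z': "norm Z' < \<rho>" by auto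
      define H where "H = matrix_inv (mat 1 + Z)"
      define H' where "H' = matrix_inv (mat 1 + Z')"
      have "H ** (mat 1 + Z) = mat 1" "(mat 1 + Z') ** H' = mat 1"
        unfolding H_def H'_def using matrix_inv_props[OF inv[OF Z]] matrix_inv_props[OF inv[OF Z']] by auto
      moreover have "H ** (Z' - Z) ** H' = H ** ((mat 1 + Z') ** H') - (H ** (mat 1 + Z)) ** H'"
        by (simp add: qmm_distribs matrix_mul_assoc)
      \<comment> \<open>The resolvent identity yields the Lipschitz constant: a factor
        \<open>C\<close> for each inverse and a factor \<open>K\<close> for each product.\<close>
      ultimately have "H - H' = H ** (Z' - Z) ** H'"
        by simp
      then have "dist H H' \<le> norm (H ** (Z' - Z)) * norm H' * K"
        using K(2)[of "H ** (Z' - Z)" H'] by (simp add: dist_norm)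
      also have "\<dots> \<le> (norm H * norm (Z' - Z) * K) * norm H' * K"
        using K by (intro mult_right_mono) auto
      also have "\<dots> \<le> (C * norm (Z' - Z) * K) * C * K"
        using K(1) bound[OF Z] bound[OF Z'] unfolding H_def H'_def
        by (intro mult_mono mult_right_mono mult_nonneg_nonneg) (auto simp: C_def)
      finally show "dist H H' \<le> C * C * K * K * dist Z Z'"
        by (simp add: dist_norm norm_minus_commute mult_ac)
    qed (use K in \<open>simp add: C_def\<close>)
  qed
  moreover have "0 < \<rho>"
    using K by (simp add: \<rho>_def)
  ultimately show thesis
    using inv that by blast
qed

text \<open>Caratheodory's form of differentiability: \<open>k\<close> is the difference quotient,
  continuously extended to \<open>a\<close>.\<close>

lemma has_vector_derivative_scaleR_continuous:
  fixes k :: "real \<Rightarrow> 'a::real_normed_vector"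
  assumes "isCont k a"
  shows "((\<lambda>t. c + (t - a) *\<^sub>R k t) has_vector_derivative k a) (at a)"
  unfolding has_vector_derivative_def has_derivative_iff_norm
proof
  have "((\<lambda>t. norm (k t - k a)) \<longlongrightarrow> 0) (at a)"
    using assms unfolding isCont_def by (simp add: LIM_zero_iff tendsto_norm_zero_iff)
  moreover have "norm (k t - k a) = norm (c + (t - a) *\<^sub>R k t - (c + (a - a) *\<^sub>R k a) - (t - a) *\<^sub>R k a) / norm (t - a)"
    if "t \<noteq> a" for t
    using that by (simp add: scaleR_diff_right[symmetric])
  then have "\<forall>\<^sub>F t in at a. norm (k t - k a)
      = norm (c + (t - a) *\<^sub>R k t - (c + (a - a) *\<^sub>R k a) - (t - a) *\<^sub>R k a) / norm (t - a)"
    unfolding eventually_at_filter by (intro always_eventually) blast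
  ultimately show "((\<lambda>t. norm (c + (t - a) *\<^sub>R k t - (c + (a - a) *\<^sub>R k a) - (t - a) *\<^sub>R k a) / norm (t - a)) \<longlongrightarrow> 0) (at a)"
    by (rule Lim_transform_eventually)
qed (rule bounded_linear_scaleR_left)

lemma inj_on_independent_if_scalars_zero:
  fixes b :: "nat \<Rightarrow> 'a::real_vector"
  assumes "\<And>a i. (\<Sum>i<d. a i *\<^sub>R b i) = 0 \<Longrightarrow> i < d \<Longrightarrow> a i = (0::real)"
  shows "inj_on b {..<d}" "independent (b ` {..<d})"
proof -
  show inj: "inj_on b {..<d}"
  proof (rule inj_onI, rule ccontr)
    fix i j assume ij: "i \<in> {..<d}" "j \<in> {..<d}" "b i = b j" "i \<noteq> j"
    define a :: "nat \<Rightarrow> real" where "a = (\<lambda>k. (if k = i then 1 else 0) - (if k = j then 1 else 0))"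
    have "(\<Sum>k<d. a k *\<^sub>R b k) = (\<Sum>k<d. (if k = i then b i else 0) - (if k = j then b j else 0))"
      by (intro sum.cong refl) (auto simp: a_def)
    also have "\<dots> = 0"
      using ij by (simp add: sum_subtractf)
    finally have "a i = 0"
      using assms ij by auto
    then show False
      using ij by (simp add: a_def)
  qed
  show "independent (b ` {..<d})"
  proof (rule independent_if_scalars_zero)
    fix f x assume "(\<Sum>x\<in>b ` {..<d}. f x *\<^sub>R x) = 0" "x \<in> b ` {..<d}"
    then show "f x = 0"
      using assms[of "\<lambda>i. f (b i)"] by (auto simp: sum.reindex[OF inj])
  qed simp
qed

lemma lie_bracket_conjugate:
  assumes "h ** g = mat 1" "g ** (h :: quat^'n^'n) = mat 1"
  shows "lie_bracket (g ** w ** h) (g ** y ** h) = g ** lie_bracket w y ** h"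
proof -
  have "g ** w ** h ** (g ** y ** h) = g ** w ** (h ** g) ** y ** h"
    "g ** y ** h ** (g ** w ** h) = g ** y ** (h ** g) ** w ** h"
    by (simp_all only: matrix_mul_assoc)
  then show ?thesis
    by (simp add: lie_bracket_def assms qmm_distribs matrix_mul_assoc)
qed

text \<open>The chart is \<open>x \<mapsto> g y g\<^sup>-\<^sup>1\<close> with \<open>g = 1 + \<Sum>i. x i X i\<close>. It is injective and regular near \<open>0\<close>
  as soon as \<open>g\<close> keeps the centralizer of \<open>y\<close> complementary to the span of the \<open>X i\<close>: from
  \<open>g y g\<^sup>-\<^sup>1 = g' y g'\<^sup>-\<^sup>1\<close> it follows that \<open>w = g'\<^sup>-\<^sup>1 g - 1\<close> centralizes \<open>y\<close> while \<open>g' w = g - g'\<close> lies in that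
  span. This avoids the inverse function theorem.\<close>

locale transversal_chart =
  fixes y :: "quat^'n^'n" and X :: "nat \<Rightarrow> quat^'n^'n" and d :: nat and \<rho> :: real
  assumes invertible_near: "\<And>Z :: quat^'n^'n. norm Z < \<rho> \<Longrightarrow> invertible (mat 1 + Z)"
    and continuous_inv: "continuous_on (ball 0 \<rho>) (\<lambda>Z :: quat^'n^'n. matrix_inv (mat 1 + Z))"
    and scalars_zero: "\<And>a i. (\<Sum>i<d. a i *\<^sub>R X i) = 0 \<Longrightarrow> i < d \<Longrightarrow> a i = 0"
    and transversal: "\<And>Z w a. norm Z < \<rho> \<Longrightarrow> lie_bracket w y = 0 \<Longrightarrow>
      (mat 1 + Z) ** w = (\<Sum>i<d. a i *\<^sub>R X i) \<Longrightarrow> w = 0"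
    and complement: "\<And>Z u. norm Z < \<rho> \<Longrightarrow>
      \<exists>w a. lie_bracket w y = 0 \<and> u = (mat 1 + Z) ** w + (\<Sum>i<d. a i *\<^sub>R X i)"
begin

definition coord :: "(nat \<Rightarrow> real) \<Rightarrow> quat^'n^'n"
  where "coord x = (\<Sum>i<d. x i *\<^sub>R X i)"

definition conj_inv :: "(nat \<Rightarrow> real) \<Rightarrow> quat^'n^'n"
  where "conj_inv x = matrix_inv (mat 1 + coord x)"

definition conj_chart :: "(nat \<Rightarrow> real) \<Rightarrow> quat^'n^'n"
  where "conj_chart x = (mat 1 + coord x) ** y ** conj_inv x"

lemma conj_inv:
  assumes "norm (coord x) < \<rho>"
  shows "(mat 1 + coord x) ** conj_inv x = mat 1" "conj_inv x ** (mat 1 + coord x) = mat 1"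
  unfolding conj_inv_def using matrix_inv_props[OF invertible_near[OF assms]] by auto

lemma coord_upd: "i < d \<Longrightarrow> coord (x(i := t)) = coord x + (t - x i) *\<^sub>R X i"
proof -
  assume i: "i < d"
  have "coord (x(i := t)) = (\<Sum>j<d. x j *\<^sub>R X j + (if j = i then (t - x i) *\<^sub>R X i else 0))"
    unfolding coord_def by (intro sum.cong refl) (auto simp: scaleR_diff_left)
  then show ?thesis
    using i by (simp add: sum.distrib coord_def)
qed

text \<open>By the resolvent identity the increment along coordinate \<open>i\<close> is exactly
  \<open>t - x i\<close> times a matrix \<open>k t\<close>, which is continuous because inversion
  is; its value at \<open>t = x i\<close> is the bracket.\<close>

lemma conj_chart_has_vector_derivative:
  assumes x: "norm (coord x) < \<rho>" and i: "i < d"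
  shows "((\<lambda>t. conj_chart (x(i := t))) has_vector_derivative lie_bracket (X i ** conj_inv x) (conj_chart x)) (at (x i))"
proof -
  define line where "line = (\<lambda>t. coord x + (t - x i) *\<^sub>R X i)"
  define T where "T = {t. norm (line t) < \<rho>}"
  have cont_line: "continuous_on UNIV line"
    unfolding line_def by (intro continuous_intros)
  have T: "open T" "x i \<in> T"
    unfolding T_def using x by (auto intro!: open_Collect_less continuous_intros cont_line) (simp add: line_def)
  define h where "h = (\<lambda>t. matrix_inv (mat 1 + line t))"
  have h0: "h (x i) = conj_inv x"
    by (simp add: h_def line_def conj_inv_def)
  have hT: "(mat 1 + line t) ** h t = mat 1" if "t \<in> T" for t
    using that matrix_inv_props[OF invertible_near] by (auto simp: h_def T_def)
  have "continuous_on T h"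
    unfolding h_def
    by (rule continuous_on_compose2[OF continuous_inv continuous_on_subset[OF cont_line subset_UNIV]])
      (auto simp: T_def)
  then have "isCont h (x i)"
    using T continuous_on_eq_continuous_at by blast
  define k where "k = (\<lambda>t. X i ** y ** h t - (mat 1 + coord x) ** y ** (h t ** X i ** conj_inv x))"
  have "isCont k (x i)"
    unfolding k_def using \<open>isCont h (x i)\<close>
    by (intro continuous_diff qmm.continuous continuous_const)
  then have "((\<lambda>t. conj_chart x + (t - x i) *\<^sub>R k t) has_vector_derivative k (x i)) (at (x i))"
    by (rule has_vector_derivative_scaleR_continuous)
  moreover have "conj_chart x + (t - x i) *\<^sub>R k t = conj_chart (x(i := t))" if t: "t \<in> T" for t
  proof -
    define g where "g = mat 1 + coord x"
    define s where "s = t - x i"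
    have lt: "mat 1 + line t = g + s *\<^sub>R X i"
      by (simp add: line_def g_def s_def)
    have "h t ** g + s *\<^sub>R (h t ** X i) = mat 1"
    proof -
      have "h t ** (mat 1 + line t) = mat 1"
        using t matrix_inv_props[OF invertible_near] by (auto simp: h_def T_def)
      then show ?thesis
        by (simp add: lt qmm_distribs)
    qed
    then have "h t ** g ** conj_inv x + s *\<^sub>R (h t ** X i ** conj_inv x) = conj_inv x"
      by (metis matrix_mul_lid qmm.add_left qmm.scaleR_left)
    moreover have "h t ** g ** conj_inv x = h t"
      using conj_inv(1)[OF x] by (simp add: g_def matrix_mul_assoc[symmetric])
    ultimately have ht: "conj_inv x = h t + s *\<^sub>R (h t ** X i ** conj_inv x)"
      by simp
    have "conj_chart x = g ** y ** conj_inv x"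
      by (simp add: conj_chart_def g_def)
    also have "\<dots> = g ** y ** h t + s *\<^sub>R (g ** y ** (h t ** X i ** conj_inv x))"
      by (subst ht) (simp only: qmm.add_right qmm.scaleR_right)
    finally have "conj_chart x + s *\<^sub>R k t = g ** y ** h t + s *\<^sub>R (X i ** y ** h t)"
      by (simp add: k_def g_def scaleR_diff_right)
    also have "\<dots> = (mat 1 + line t) ** y ** h t"
      by (simp add: lt qmm_distribs)
    finally show ?thesis
      using i by (simp add: s_def conj_chart_def coord_upd conj_inv_def h_def line_def)
  qed
  ultimately have "((\<lambda>t. conj_chart (x(i := t))) has_vector_derivative k (x i)) (at (x i))"
    by (rule has_vector_derivative_transform_within_open[OF _ T])
  moreover have "k (x i) = lie_bracket (X i ** conj_inv x) (conj_chart x)"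
  proof -
    have "X i ** conj_inv x ** conj_chart x = X i ** (conj_inv x ** (mat 1 + coord x)) ** y ** conj_inv x"
      by (simp add: conj_chart_def matrix_mul_assoc)
    then show ?thesis
      using conj_inv(2)[OF x] by (simp add: k_def h0 lie_bracket_def conj_chart_def matrix_mul_assoc)
  qed
  ultimately show ?thesis by simp
qed

lemma conj_chart_inj:
  assumes x: "norm (coord x) < \<rho>" and x': "norm (coord x') < \<rho>" and eq: "conj_chart x = conj_chart x'"
    and i: "i < d"
  shows "x i = x' i"
proof -
  define g where "g = mat 1 + coord x"
  define g' where "g' = mat 1 + coord x'"
  define h where "h = conj_inv x"
  define h' where "h' = conj_inv x'"
  have inv: "g ** h = mat 1" "h ** g = mat 1" "g' ** h' = mat 1" "h' ** g' = mat 1"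
    unfolding g_def h_def g'_def h'_def using conj_inv x x' by auto
  have "g ** y ** h = g' ** y ** h'"
    using eq by (simp add: conj_chart_def g_def h_def g'_def h'_def)
  then have "h' ** (g ** y ** h) ** g = h' ** (g' ** y ** h') ** g"
    by simp
  moreover have "h' ** (g ** y ** h) ** g = h' ** g ** y ** (h ** g)"
    "h' ** (g' ** y ** h') ** g = (h' ** g') ** y ** (h' ** g)"
    by (simp_all only: matrix_mul_assoc)
  ultimately have "h' ** g ** y = y ** (h' ** g)"
    by (simp add: inv)
  then have "lie_bracket (h' ** g - mat 1) y = 0"
    by (simp add: lie_bracket_def qmm_distribs)
  moreover have "g' ** (h' ** g - mat 1) = (\<Sum>i<d. (x i - x' i) *\<^sub>R X i)"
  proof -
    have "g' ** (h' ** g - mat 1) = g - g'"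
      by (simp add: qmm_distribs matrix_mul_assoc inv)
    then show ?thesis
      by (simp add: g_def g'_def coord_def scaleR_diff_left sum_subtractf)
  qed
  ultimately have "h' ** g - mat 1 = 0" "(\<Sum>i<d. (x i - x' i) *\<^sub>R X i) = g' ** (h' ** g - mat 1)"
    using transversal[OF x'] unfolding g'_def by metis+
  then have "(\<Sum>i<d. (x i - x' i) *\<^sub>R X i) = 0"
    by (simp add: qmm.zero_right)
  then show ?thesis
    using scalars_zero[of "\<lambda>i. x i - x' i"] i by auto
qed

lemma lie_bracket_sum_left: "lie_bracket (\<Sum>i\<in>I. a i *\<^sub>R f i) z = (\<Sum>i\<in>I. a i *\<^sub>R lie_bracket (f i) z)"
  by (simp add: lie_bracket_def qmm.sum_left qmm.sum_right qmm_distribs sum_subtractf scaleR_diff_right)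

text \<open>Each \<open>b i\<close> is the conjugate by \<open>g\<close> of
  \<open>lie_bracket (h ** X i) y\<close>. A vanishing combination gives an element
  \<open>h ** s\<close> of the centralizer with \<open>g ** (h ** s)\<close> in the span of the
  \<open>X i\<close>, so \<open>transversal\<close> makes it zero; spanning follows from
  \<open>complement\<close>.\<close>

lemma conj_chart_frame:
  assumes x: "norm (coord x) < \<rho>"
  defines "b \<equiv> (\<lambda>i. lie_bracket (X i ** conj_inv x) (conj_chart x))"
  shows "inj_on b {..<d}" "independent (b ` {..<d})" "span (b ` {..<d}) = orbit_tangent sl_quat (conj_chart x)"
proof -
  define g where "g = mat 1 + coord x"
  define h where "h = conj_inv x"
  have inv: "g ** h = mat 1" "h ** g = mat 1"
    unfolding g_def h_def using conj_inv x by auto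
  have chart: "conj_chart x = g ** y ** h"
    by (simp add: conj_chart_def g_def h_def)
  have sum_b: "(\<Sum>i<d. a i *\<^sub>R b i) = lie_bracket ((\<Sum>i<d. a i *\<^sub>R X i) ** h) (conj_chart x)" for a
    by (simp add: b_def h_def qmm.sum_left qmm.scaleR_left lie_bracket_sum_left)
  have zero: "a i = 0" if "(\<Sum>i<d. a i *\<^sub>R b i) = 0" "i < d" for a i
  proof -
    define s where "s = (\<Sum>i<d. a i *\<^sub>R X i)"
    have "s ** h = g ** (h ** s) ** h"
      by (simp add: matrix_mul_assoc inv)
    then have "g ** lie_bracket (h ** s) y ** h = 0"
      using that(1) lie_bracket_conjugate[OF inv(2,1), of "h ** s" y] by (simp add: sum_b s_def chart)
    then have "h ** (g ** lie_bracket (h ** s) y ** h) ** g = 0"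
      by (simp add: qmm.zero_left qmm.zero_right)
    moreover have "h ** (g ** lie_bracket (h ** s) y ** h) ** g = (h ** g) ** lie_bracket (h ** s) y ** (h ** g)"
      by (simp only: matrix_mul_assoc)
    ultimately have "lie_bracket (h ** s) y = 0"
      by (simp add: inv)
    moreover have "g ** (h ** s) = s"
      by (simp add: matrix_mul_assoc inv)
    ultimately have "h ** s = 0"
      using transversal[OF x] unfolding g_def s_def by blast
    then have "s = 0"
      using \<open>g ** (h ** s) = s\<close> by (simp add: qmm.zero_right)
    then show ?thesis
      using scalars_zero that(2) unfolding s_def by blast
  qed
  show "inj_on b {..<d}" "independent (b ` {..<d})"
    using inj_on_independent_if_scalars_zero[where d = d and b = b] zero by blast+
  show "span (b ` {..<d}) = orbit_tangent sl_quat (conj_chart x)"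
  proof
    have "subspace (range (\<lambda>X. lie_bracket X (conj_chart x)))"
      by (rule linear_subspace_image[OF _ subspace_UNIV])
        (rule linearI, simp_all add: lie_bracket_def qmm_distribs scaleR_diff_right)
    then show "span (b ` {..<d}) \<subseteq> orbit_tangent sl_quat (conj_chart x)"
      unfolding orbit_tangent_sl_quat by (intro span_minimal) (auto simp: b_def)
    show "orbit_tangent sl_quat (conj_chart x) \<subseteq> span (b ` {..<d})"
      unfolding orbit_tangent_sl_quat
    proof clarify
      fix u
      \<comment> \<open>Decomposing \<open>u ** g\<close> rather than \<open>u\<close> leaves, after
        multiplication by \<open>h\<close> on the right, a conjugate of \<open>w\<close>, which
        commutes with the chart point, and a combination of the \<open>X i ** h\<close>.\<close>
      obtain w a where w: "lie_bracket w y = 0" "u ** g = g ** w + (\<Sum>i<d. a i *\<^sub>R X i)"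
        using complement[OF x, of "u ** g"] unfolding g_def by blast
      have "u = u ** g ** h"
        by (simp add: matrix_mul_assoc[symmetric] inv)
      also have "\<dots> = g ** w ** h + (\<Sum>i<d. a i *\<^sub>R X i) ** h"
        by (simp add: w(2) qmm.add_left)
      finally have "lie_bracket u (conj_chart x)
          = lie_bracket (g ** w ** h) (conj_chart x) + lie_bracket ((\<Sum>i<d. a i *\<^sub>R X i) ** h) (conj_chart x)"
        by (simp add: lie_bracket_def qmm_distribs)
      also have "lie_bracket (g ** w ** h) (conj_chart x) = 0"
        unfolding chart lie_bracket_conjugate[OF inv(2,1)] by (simp add: w(1) qmm.zero_left qmm.zero_right)
      finally have "lie_bracket u (conj_chart x) = (\<Sum>i<d. a i *\<^sub>R b i)"
        by (simp add: sum_b)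
      then show "lie_bracket u (conj_chart x) \<in> span (b ` {..<d})"
        by (simp only:) (intro span_sum span_scale span_base imageI)
    qed
  qed
qed

text \<open>Continuity on the coordinate space is reduced to continuity in the single matrix
  variable \<open>Z = coord x\<close>.\<close>

lemma continuous_map_coord_compose:
  fixes F :: "quat^'n^'n \<Rightarrow> 'b::topological_space"
  assumes F: "continuous_on (ball 0 \<rho>) F" and U: "\<And>x. x \<in> U \<Longrightarrow> norm (coord x) < \<rho>"
  shows "continuous_map (subtopology (powertop_real {..<d}) U) euclidean (\<lambda>x. F (coord x))"
proof -
  have scale: "continuous_map (powertop_real {..<d}) euclidean (\<lambda>x. x i *\<^sub>R X i)" if "i < d" for i
  proof -
    have "continuous_map (powertop_real {..<d}) euclideanreal (\<lambda>x. x i)"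
      using that by (intro continuous_map_product_projection) simp
    moreover have "continuous_map euclideanreal euclidean (\<lambda>t. t *\<^sub>R X i)"
      by (simp add: continuous_intros)
    ultimately show ?thesis
      using continuous_map_compose[of _ euclideanreal "\<lambda>x. x i" euclidean "\<lambda>t. t *\<^sub>R X i"] by (simp add: comp_def)
  qed
  have "continuous_map (powertop_real {..<d}) euclidean coord"
    unfolding coord_def[abs_def] by (intro continuous_map_sum) (auto intro: scale)
  then have "continuous_map (subtopology (powertop_real {..<d}) U) (top_of_set (ball 0 \<rho>)) coord"
    using U by (intro continuous_map_into_subtopology continuous_map_from_subtopology) auto
  moreover have "continuous_map (top_of_set (ball 0 \<rho>)) euclidean F"
    using F by simp
  ultimately have "continuous_map (subtopology (powertop_real {..<d}) U) euclidean (F \<circ> coord)"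
    by (rule continuous_map_compose)
  then show ?thesis
    by (simp add: comp_def)
qed

lemma continuous_on_conj: "continuous_on (ball 0 \<rho>) (\<lambda>Z. (mat 1 + Z) ** y ** matrix_inv (mat 1 + Z))"
  by (intro qmm.continuous_on continuous_intros continuous_inv)

lemma orbit_chart_conj_chart:
  assumes U: "openin (powertop_real {..<d}) U" "\<And>x. x \<in> U \<Longrightarrow> norm (coord x) < \<rho>"
    and orbit: "\<And>x. x \<in> U \<Longrightarrow> conj_chart x \<in> \<O>"
  shows "orbit_chart sl_quat \<O> d U conj_chart"
proof -
  \<comment> \<open>Points of \<open>U\<close> are extensional, so their coordinates below
    \<open>d\<close> determine them.\<close>
  have ext: "x \<in> extensional {..<d}" if "x \<in> U" for x
    using openin_subset[OF U(1)] that by (auto simp: PiE_def)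
  have partial: "partial_deriv conj_chart i x = lie_bracket (X i ** conj_inv x) (conj_chart x)"
    if "x \<in> U" "i < d" for x i
    unfolding partial_deriv_def
    using conj_chart_has_vector_derivative[OF U(2)] that by (blast intro: vector_derivative_at)
  have "inj_on conj_chart U"
  proof (rule inj_onI)
    fix x x' assume "x \<in> U" "x' \<in> U" "conj_chart x = conj_chart x'"
    then show "x = x'"
      using conj_chart_inj[OF U(2) U(2)] ext by (intro extensionalityI[of _ "{..<d}"]) auto
  qed
  moreover have "continuous_map (subtopology (powertop_real {..<d}) U) euclidean conj_chart"
    using continuous_map_coord_compose[OF continuous_on_conj U(2)]
    by (simp add: conj_chart_def[abs_def] conj_inv_def)
  moreover have "(\<lambda>t. conj_chart (x(i := t))) differentiable at (x i)" if "x \<in> U" "i < d" for x i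
    using conj_chart_has_vector_derivative[OF U(2)] that differentiableI_vector by blast
  moreover have "continuous_map (subtopology (powertop_real {..<d}) U) euclidean (partial_deriv conj_chart i)"
    if "i < d" for i
  proof (rule continuous_map_eq)
    show "continuous_map (subtopology (powertop_real {..<d}) U) euclidean
        (\<lambda>x. lie_bracket (X i ** conj_inv x) (conj_chart x))"
      unfolding conj_chart_def conj_inv_def lie_bracket_def
      by (rule continuous_map_coord_compose[OF _ U(2)])
        (intro qmm.continuous_on continuous_intros continuous_inv)
  qed (use that partial in auto)
  ultimately show ?thesis
    unfolding orbit_chart_def
  proof (intro conjI allI impI ballI)
    fix x assume x: "x \<in> U"
    have eq: "partial_deriv conj_chart i x = lie_bracket (X i ** conj_inv x) (conj_chart x)" if "i \<in> {..<d}" for i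
      using partial x that by simp
    note frame = conj_chart_frame[OF U(2)[OF x]]
    show "inj_on (\<lambda>i. partial_deriv conj_chart i x) {..<d}"
      using frame(1) eq by (auto simp: inj_on_def)
    have "(\<lambda>i. partial_deriv conj_chart i x) ` {..<d}
      = (\<lambda>i. lie_bracket (X i ** conj_inv x) (conj_chart x)) ` {..<d}"
      by (intro image_cong refl eq)
    then show "independent ((\<lambda>i. partial_deriv conj_chart i x) ` {..<d})"
      "span ((\<lambda>i. partial_deriv conj_chart i x) ` {..<d}) = orbit_tangent sl_quat (conj_chart x)"
      using frame(2,3) by simp_all
  qed (use U(1) orbit in auto)
qed

end

section \<open>The Liouville density in a chart and the existence of charts\<close>

lemma two_form_power_cong:
  assumes "\<And>i j. i < 2 * m \<Longrightarrow> j < 2 * m \<Longrightarrow> \<omega> (v i) (v j) = \<omega>' (v' i) (v' j)"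
  shows "two_form_power \<omega> m v = two_form_power \<omega>' m v'"
proof -
  have "\<sigma> i < 2 * m" if "\<sigma> permutes {..<2 * m}" "i < 2 * m" for \<sigma> i
    using permutes_in_image[OF that(1), of i] that(2) by simp
  then show ?thesis
    unfolding two_form_power_def
    by (intro arg_cong2[where f = "(/)"] sum.cong prod.cong arg_cong2[where f = "(*)"] refl assms) auto
qed

lemma two_form_power_scale: "two_form_power (\<lambda>u v. t * \<omega> u v) m v = t ^ m * two_form_power \<omega> m v"
  by (simp add: two_form_power_def prod.distrib sum_distrib_left mult_ac)

lemma continuous_on_two_form_power:
  assumes "\<And>i j. i < 2 * m \<Longrightarrow> j < 2 * m \<Longrightarrow> continuous_on S (\<lambda>z. \<omega> z i j :: real)"
  shows "continuous_on S (\<lambda>z. two_form_power (\<omega> z) m (\<lambda>i. i))"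
proof -
  have "\<sigma> i < 2 * m" if "\<sigma> permutes {..<2 * m}" "i < 2 * m" for \<sigma> i
    using permutes_in_image[OF that(1), of i] that(2) by simp
  then show ?thesis
    unfolding two_form_power_def by (intro continuous_intros assms) auto
qed

lemma (in transversal_chart) partial_deriv_conj_chart:
  assumes "norm (coord x) < \<rho>" "i < d"
  shows "partial_deriv conj_chart i x = lie_bracket (X i ** conj_inv x) (conj_chart x)"
  unfolding partial_deriv_def by (intro vector_derivative_at conj_chart_has_vector_derivative assms)

text \<open>Evaluating the form on bare indices gathers the dependence on \<open>x\<close> in one
  coefficient matrix, in which continuity and scaling can be read off.\<close>

lemma (in transversal_chart) liouville_density_conj_chart:
  assumes x: "norm (coord x) < \<rho>" and d: "d = 2 * m"
  shows "liouville_density sl_quat d conj_chart x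
    = \<bar>two_form_power (\<lambda>i j. orbit_form (conj_chart x) (X i ** conj_inv x) (X j ** conj_inv x)) m (\<lambda>i. i)\<bar>"
proof -
  have "two_form_power (orbit_symplectic_form sl_quat (conj_chart x)) m (\<lambda>i. partial_deriv conj_chart i x)
    = two_form_power (\<lambda>i j. orbit_form (conj_chart x) (X i ** conj_inv x) (X j ** conj_inv x)) m (\<lambda>i. i)"
    by (rule two_form_power_cong)
      (simp add: d[symmetric] partial_deriv_conj_chart[OF x] orbit_symplectic_form_sl_quat)
  then show ?thesis
    by (simp add: liouville_density_def d)
qed

text \<open>The conditions see \<open>y\<close> only through its centralizer, which a nonzero factor
  does not change; all nonzero multiples of \<open>y\<close> share \<open>X\<close> and
  \<open>\<rho>\<close>.\<close>

lemma (in transversal_chart) transversal_chart_scaleR: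
  assumes "t \<noteq> 0"
  shows "transversal_chart (t *\<^sub>R y) X d \<rho>"
proof -
  have "lie_bracket w (t *\<^sub>R y) = t *\<^sub>R lie_bracket w y" for w
    by (simp add: lie_bracket_def qmm_distribs scaleR_diff_right)
  then have "lie_bracket w (t *\<^sub>R y) = 0 \<longleftrightarrow> lie_bracket w y = 0" for w
    using assms by simp
  then show ?thesis
    using transversal_chart_axioms unfolding transversal_chart_def by simp
qed

lemma orbit_form_scaleR: "orbit_form (t *\<^sub>R y) X Y = t * orbit_form y X Y"
  by (simp add: orbit_form_def qmm.scaleR_left retr_scaleR)

lemma bounded_bilinear_orbit_form: "bounded_bilinear (orbit_form y)"
proof -
  have "bilinear (orbit_form y)"
    unfolding bilinear_def
    by (intro conjI allI linearI)
      (simp_all add: orbit_form_def lie_bracket_def qmm_distribs retr_add retr_diff retr_scaleR algebra_simps)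
  then show ?thesis
    by (simp add: bilinear_conv_bounded_bilinear)
qed

lemma orbit_form_self: "orbit_form y X X = 0"
  by (simp add: orbit_form_def lie_bracket_def linear_0[OF linear_retr] qmm.zero_right)

text \<open>Tested against the conjugate transpose \<open>B\<close> of \<open>A\<close>, the pairing
  is the squared norm of \<open>A\<close>.\<close>

lemma retr_mult_nondegenerate:
  fixes A :: "quat^'n^'n"
  assumes "\<And>B. retr (A ** B) = 0"
  shows "A = 0"
proof -
  define B :: "quat^'n^'n" where
    "B = (\<chi> j i. Quat (qRe (A $ i $ j)) (- qI (A $ i $ j)) (- qJ (A $ i $ j)) (- qK (A $ i $ j)))"
  have "retr (A ** B) = (\<Sum>i\<in>UNIV. \<Sum>j\<in>UNIV. inner (A $ i $ j) (A $ i $ j))"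
    by (simp add: retr_def matrix_matrix_mult_def quat_sel_sum B_def inner_quat_def times_quat_def)
  then have "(\<Sum>i\<in>UNIV. \<Sum>j\<in>UNIV. inner (A $ i $ j) (A $ i $ j)) = 0"
    using assms by simp
  then have "inner (A $ i $ j) (A $ i $ j) = 0" for i j
    by (simp add: sum_nonneg_eq_0_iff sum_nonneg)
  then show ?thesis
    by (simp add: vec_eq_iff)
qed

text \<open>Together with \<open>orbit_form_centralizer\<close> this identifies the radical of
  \<open>orbit_form y\<close> with the centralizer of \<open>y\<close>.\<close>

lemma orbit_form_nondegenerate:
  assumes "\<And>u. orbit_form y v u = 0"
  shows "lie_bracket v y = 0"
proof (rule retr_mult_nondegenerate)
  show "retr (lie_bracket v y ** B) = 0" for B
    using assms[of B] retr_mult_lie_bracket(1)[of y v B] by (simp add: orbit_form_def)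
qed

lemma orbit_form_centralizer:
  assumes "lie_bracket w y = 0"
  shows "orbit_form y w u = 0"
  using retr_mult_lie_bracket(1)[of y w u] assms
  by (simp add: orbit_form_def qmm.zero_left linear_0[OF linear_retr])

text \<open>The remainder \<open>Q\<close> of the symplectic projection maps onto the centralizer of
  \<open>y\<close> and kills the \<open>X i\<close>, so centralizer and span are complementary for
  \<open>Z = 0\<close>; for small \<open>Z\<close> this persists by perturbation.\<close>

lemma transversal_chart_exists:
  fixes y :: "quat^'n^'n"
  obtains m X \<rho> where "0 < \<rho>" "transversal_chart y X (2 * m) \<rho>"
    "\<forall>i<2 * m. \<forall>j<2 * m. orbit_form y (X i) (X j) = std_symplectic i j"
    "m = 0 \<longrightarrow> (\<forall>v. lie_bracket v y = 0)"
proof -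
  interpret w: bounded_bilinear "orbit_form y"
    by (rule bounded_bilinear_orbit_form)
  obtain m X where X: "\<And>i j. i < 2 * m \<Longrightarrow> j < 2 * m \<Longrightarrow> orbit_form y (X i) (X j) = std_symplectic i j"
    and orth: "\<And>v u. orbit_form y (v - (\<Sum>i<2 * m. (parity_sign i * orbit_form y v (X (partner i))) *\<^sub>R X i)) u = 0"
    using symplectic_projection_exists[OF bounded_bilinear_orbit_form orbit_form_self] by blast
  define coef where "coef = (\<lambda>v i. parity_sign i * orbit_form y v (X (partner i)))"
  define Q where "Q = (\<lambda>v. v - (\<Sum>i<2 * m. coef v i *\<^sub>R X i))"
  have Q_centralizer: "lie_bracket (Q v) y = 0" for v
    by (rule orbit_form_nondegenerate) (simp add: Q_def coef_def orth)
  have Q_id: "Q v = v" if "lie_bracket v y = 0" for v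
    by (simp add: Q_def coef_def orbit_form_centralizer[OF that])
  have coef_sum: "coef (\<Sum>i<2 * m. a i *\<^sub>R X i) i = a i" if i: "i < 2 * m" for a i
  proof -
    have "orbit_form y (\<Sum>i<2 * m. a i *\<^sub>R X i) (X (partner i)) = (\<Sum>j<2 * m. if j = i then parity_sign i * a i else 0)"
      unfolding w.sum_left using X i
      by (intro sum.cong refl) (auto simp: w.scaleR_left std_symplectic_def dest: arg_cong[of _ _ partner])
    then show ?thesis
      using i by (simp add: coef_def mult.assoc[symmetric])
  qed
  have Q_sum: "Q (\<Sum>i<2 * m. a i *\<^sub>R X i) = 0" for a
    by (simp add: Q_def coef_sum)
  have linQ: "linear Q"
    by (rule linearI) (simp_all add: Q_def coef_def w.add_left w.scaleR_left algebra_simps sum.distrib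
        scaleR_sum_right)
  obtain B where B: "B > 0" "\<And>v. norm (Q v) \<le> B * norm v"
    using linear_bounded_pos[OF linQ] by blast
  obtain K where K: "K > 0" "\<And>(A :: quat^'n^'n) (B :: quat^'n^'n). norm (A ** B) \<le> norm A * norm B * K"
    using qmm.pos_bounded by metis
  obtain \<rho>0 where \<rho>0: "0 < \<rho>0" "\<And>Z :: quat^'n^'n. norm Z < \<rho>0 \<Longrightarrow> invertible (mat 1 + Z)"
    "continuous_on (ball 0 \<rho>0) (\<lambda>Z :: quat^'n^'n. matrix_inv (mat 1 + Z))"
    using matrix_inv_near_mat_1 by blast
  \<comment> \<open>\<open>B\<close> bounds \<open>Q\<close> and \<open>K\<close> the matrix
    product: a nonzero \<open>w\<close> violating transversality satisfies
    \<open>w = - Q (Z ** w)\<close>, whose norm would be less than that of \<open>w\<close>.\<close>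
  define \<rho> where "\<rho> = min \<rho>0 (1 / (B * K))"
  have transv: "w = 0" if Z: "norm Z < \<rho>" and w: "lie_bracket w y = 0"
    "(mat 1 + Z) ** w = (\<Sum>i<2 * m. a i *\<^sub>R X i)" for Z w a
  proof (rule ccontr)
    assume "w \<noteq> 0"
    have "0 = Q ((mat 1 + Z) ** w)"
      by (simp add: w(2) Q_sum)
    also have "\<dots> = w + Q (Z ** w)"
      by (simp add: qmm.add_left linear_add[OF linQ] Q_id[OF w(1)])
    finally have "w = - Q (Z ** w)"
      by (simp add: eq_neg_iff_add_eq_0)
    then have "norm w = norm (Q (Z ** w))"
      by (metis norm_minus_cancel)
    also have "\<dots> \<le> B * (norm Z * norm w * K)"
      using B(2)[of "Z ** w"] mult_left_mono[OF K(2)[of Z w], of B] B(1) by linarith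
    also have "\<dots> = norm Z * (B * K) * norm w"
      by (simp add: mult_ac)
    also have "\<dots> < 1 * norm w"
      using Z B(1) K(1) \<open>w \<noteq> 0\<close> by (intro mult_strict_right_mono) (auto simp: \<rho>_def field_simps)
    finally show False by simp
  qed
  have "transversal_chart y X (2 * m) \<rho>"
  proof
    show "invertible (mat 1 + Z)" if "norm Z < \<rho>" for Z :: "quat^'n^'n"
      using that by (intro \<rho>0(2)) (simp add: \<rho>_def)
    show "continuous_on (ball 0 \<rho>) (\<lambda>Z :: quat^'n^'n. matrix_inv (mat 1 + Z))"
      by (rule continuous_on_subset[OF \<rho>0(3)]) (auto simp: \<rho>_def)
    show "a i = 0" if "(\<Sum>i<2 * m. a i *\<^sub>R X i) = 0" "i < 2 * m" for a i
      using coef_sum[OF that(2), of a] by (simp add: that(1) coef_def w.zero_left)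
    show "w = 0" if "norm Z < \<rho>" "lie_bracket w y = 0" "(mat 1 + Z) ** w = (\<Sum>i<2 * m. a i *\<^sub>R X i)" for Z w a
      using transv that by blast
    show "\<exists>w a. lie_bracket w y = 0 \<and> u = (mat 1 + Z) ** w + (\<Sum>i<2 * m. a i *\<^sub>R X i)" if Z: "norm Z < \<rho>" for Z u
    proof -
      \<comment> \<open>\<open>(mat 1 + Z) ** Q v\<close> plus the \<open>X\<close>-component of
        \<open>v\<close> equals \<open>v + Z ** Q v\<close>. Decomposing \<open>u\<close> thus
        amounts to surjectivity of \<open>F\<close>, which in finite dimension follows from
        injectivity.\<close>
      define F where "F = (\<lambda>v. v + Z ** Q v)"
      have split: "F v = (mat 1 + Z) ** Q v + (\<Sum>i<2 * m. coef v i *\<^sub>R X i)" for v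
        by (simp add: F_def qmm.add_left Q_def)
      have linF: "linear F"
        by (rule linearI) (simp_all add: F_def linear_add[OF linQ] linear_scale[OF linQ] qmm_distribs scaleR_add_right)
      have "v = 0" if "F v = 0" for v
      proof -
        have "(mat 1 + Z) ** Q v = (\<Sum>i<2 * m. (- coef v i) *\<^sub>R X i)"
          using that split[of v] by (simp add: sum_negf eq_neg_iff_add_eq_0)
        then have "Q v = 0"
          by (rule transv[OF Z Q_centralizer])
        then show "v = 0"
          using that by (simp add: F_def qmm.zero_right)
      qed
      then have "inj F"
        unfolding linear_injective_0[OF linF] by blast
      then have "surj F"
        using linear_injective_imp_surjective[OF linF] by simp
      then obtain v where "u = F v"
        by (metis surjD)
      then show ?thesis
        using split Q_centralizer by blast
    qed
  qed
  moreover have "0 < \<rho>"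
    using \<rho>0(1) B(1) K(1) by (simp add: \<rho>_def)
  moreover have "lie_bracket v y = 0" if "m = 0" for v
    using Q_centralizer[of v] that by (simp add: Q_def)
  ultimately show thesis
    using X that by blast
qed

section \<open>The half space has infinite measure\<close>

lemma emeasure_box_pos:
  fixes \<epsilon> :: real
  assumes "0 < \<epsilon>"
  shows "0 < emeasure (\<Pi>\<^sub>M i\<in>{..<d::nat}. lborel) (\<Pi>\<^sub>E i\<in>{..<d}. {- \<epsilon><..<\<epsilon>})"
proof -
  interpret product_sigma_finite "\<lambda>_::nat. lborel :: real measure"
    by standard
  have "emeasure (\<Pi>\<^sub>M i\<in>{..<d::nat}. lborel) (\<Pi>\<^sub>E i\<in>{..<d}. {- \<epsilon><..<\<epsilon>})
      = (\<Prod>i<d. emeasure lborel {- \<epsilon><..<\<epsilon>})"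
    using emeasure_PiM[of "{..<d}" "\<lambda>_. {- \<epsilon><..<\<epsilon>}"] by simp
  also have "\<dots> = ennreal (2 * \<epsilon>) ^ d"
    using assms by simp
  finally show ?thesis
    using assms by (simp add: ennreal_power)
qed

lemma piece_volume_le_content:
  assumes "orbit_piece \<gg> \<O> p" "piece_image p \<subseteq> A"
  shows "piece_volume \<gg> p \<le> liouville_content \<gg> \<O> A"
proof -
  have "{p} \<in> piece_families \<gg> \<O> A"
    using assms by (simp add: piece_families_def disjoint_family_on_def)
  then show ?thesis
    unfolding liouville_content_def by (rule SUP_upper2) simp
qed

lemma liouville_content_halfspace:
  fixes y :: "quat^'n^'n" and \<beta> :: "quat^'n^'n \<Rightarrow> real"
  assumes y: "ad_nilpotent sl_quat y" "y \<noteq> 0" and \<beta>: "linear \<beta>"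
  shows "liouville_content sl_quat (adjoint_orbit SL_quat y) {x \<in> adjoint_orbit SL_quat y. \<beta> x \<le> 0} = \<infinity>"
proof -
  define \<O> where "\<O> = adjoint_orbit SL_quat y"
  obtain m X \<rho> where \<rho>: "0 < \<rho>" "transversal_chart y X (2 * m) \<rho>"
    and X: "\<forall>i<2 * m. \<forall>j<2 * m. orbit_form y (X i) (X j) = std_symplectic i j"
    and m0: "m = 0 \<longrightarrow> (\<forall>v. lie_bracket v y = 0)"
    by (rule transversal_chart_exists[of y])
  interpret C: transversal_chart y X "2 * m" \<rho>
    by (rule \<rho>(2))
  \<comment> \<open>With \<open>m = 0\<close> dilation would not increase the volume. In that case
    \<open>y\<close> would be central, and commuting with the \<open>g\<close> that satisfies
    \<open>g y = 2 y g\<close> forces \<open>y = 0\<close>.\<close>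
  have "m \<noteq> 0"
  proof
    assume "m = 0"
    obtain g where g: "invertible g" "g ** y = 2 *\<^sub>R (y ** g)"
      using ad_nilpotent_conjugate_scaled[OF y(1), of 2] by auto
    have "g ** y - y ** g = 0"
      using m0 \<open>m = 0\<close> by (simp add: lie_bracket_def)
    then have "y ** g = 0"
      unfolding g(2) by (simp add: scaleR_2)
    then have "y ** g ** matrix_inv g = 0"
      by (simp add: qmm.zero_left)
    then show False
      using y(2) matrix_inv_props(1)[OF g(1)] by (simp add: matrix_mul_assoc[symmetric])
  qed
  \<comment> \<open>The density before taking absolute values, as a function of
    \<open>Z = coord x\<close>. At \<open>Z = 0\<close> it is the value on a symplectic basis, hence
    positive; continuity gives a lower bound \<open>c\<close> nearby.\<close>
  define W where "W = (\<lambda>Z. two_form_power (\<lambda>i j. orbit_form ((mat 1 + Z) ** y ** matrix_inv (mat 1 + Z))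
    (X i ** matrix_inv (mat 1 + Z)) (X j ** matrix_inv (mat 1 + Z))) m (\<lambda>i. i))"
  have "continuous_on (ball 0 \<rho>) W"
    unfolding W_def
  proof (rule continuous_on_two_form_power)
    fix i j
    have retr: "bounded_linear (retr :: quat^'n^'n \<Rightarrow> real)"
      using linear_retr linear_conv_bounded_linear by blast
    show "continuous_on (ball 0 \<rho>) (\<lambda>Z. orbit_form ((mat 1 + Z) ** y ** matrix_inv (mat 1 + Z))
      (X i ** matrix_inv (mat 1 + Z)) (X j ** matrix_inv (mat 1 + Z)))"
      unfolding orbit_form_def lie_bracket_def
      by (intro continuous_intros bounded_linear.continuous_on[OF retr] qmm.continuous_on C.continuous_inv)
  qed
  then have cont: "isCont W 0"
    using \<rho>(1) continuous_on_eq_continuous_at[OF open_ball] by (metis centre_in_ball)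
  have inv1: "matrix_inv (mat 1 :: quat^'n^'n) = mat 1"
    by (rule matrix_inv_unique) simp_all
  define c where "c = W 0 / 2"
  have "W 0 > 0"
    unfolding W_def by (rule two_form_power_std_symplectic_pos) (simp add: inv1 X)
  then have c: "0 < c" "c < W 0"
    by (simp_all add: c_def)
  have "\<forall>\<^sub>F Z in nhds 0. c < W Z"
    using cont c(2) by (auto simp: isCont_def tendsto_at_iff_tendsto_nhds dest: order_tendstoD(1))
  then obtain \<delta> where \<delta>: "0 < \<delta>" "\<And>Z. norm Z < \<delta> \<Longrightarrow> c < W Z"
    unfolding eventually_nhds_metric by (auto simp: dist_norm)
  define L where "L = (\<Sum>i<2 * m. norm (X i))"
  have L: "0 \<le> L"
    by (simp add: L_def sum_nonneg)
  \<comment> \<open>On the box of half-width \<open>\<epsilon>\<close> the norm of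
    \<open>coord\<close> is at most \<open>\<epsilon> * L\<close>; the summand \<open>1\<close>
    makes the estimate strict and the denominator positive.\<close>
  define \<epsilon> where "\<epsilon> = min \<rho> \<delta> / (1 + L)"
  have \<epsilon>: "0 < \<epsilon>"
    using \<rho>(1) \<delta>(1) L by (simp add: \<epsilon>_def)
  define U where "U = (\<Pi>\<^sub>E i\<in>{..<2 * m}. {- \<epsilon><..<\<epsilon>})"
  have small: "norm (C.coord x) < \<rho>" "norm (C.coord x) < \<delta>" if "x \<in> U" for x
  proof -
    have "norm (C.coord x) \<le> (\<Sum>i<2 * m. norm (x i *\<^sub>R X i))"
      unfolding C.coord_def by (rule norm_sum)
    also have "\<dots> \<le> (\<Sum>i<2 * m. \<epsilon> * norm (X i))"
      using that by (intro sum_mono) (auto simp: U_def PiE_iff abs_le_iff intro!: mult_right_mono, force+)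
    also have "\<dots> = \<epsilon> * L"
      by (simp add: L_def sum_distrib_left)
    also have "\<dots> < \<epsilon> * (1 + L)"
      using \<epsilon> by simp
    also have "\<dots> = min \<rho> \<delta>"
      using L by (simp add: \<epsilon>_def)
    finally show "norm (C.coord x) < \<rho>" "norm (C.coord x) < \<delta>"
      by auto
  qed
  have U_open: "openin (powertop_real {..<2 * m}) U"
    by (simp add: U_def openin_PiE)
  have U_meas: "U \<in> sets (\<Pi>\<^sub>M i\<in>{..<2 * m}. lborel)"
    by (rule openin_powertop_imp_sets_PiM[OF U_open])
  have in_orbit: "t *\<^sub>R C.conj_chart x \<in> \<O>" if "x \<in> U" "t \<noteq> 0" for x t
  proof -
    have "C.conj_chart x \<in> \<O>"
      unfolding \<O>_def adjoint_orbit_SL_quat C.conj_chart_def C.conj_inv_def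
      using C.invertible_near[OF small(1)[OF that(1)]] by blast
    then show ?thesis
      unfolding \<O>_def using nilpotent_adjoint_orbit_scaleR[OF y(1) that(2)] by blast
  qed
  \<comment> \<open>\<open>t\<close> times the chart at \<open>y\<close> is the chart at
    \<open>t y\<close> with the same vectors \<open>X i\<close>. The form is linear in the base
    point, which accounts for the factor \<open>t ^ m\<close> in the density.\<close>
  have scaled_chart: "orbit_chart sl_quat \<O> (2 * m) U (\<lambda>x. t *\<^sub>R C.conj_chart x)"
    and scaled_density: "\<And>x. x \<in> U \<Longrightarrow> \<bar>t\<bar> ^ m * c \<le> liouville_density sl_quat (2 * m) (\<lambda>x. t *\<^sub>R C.conj_chart x) x"
    if t: "t \<noteq> 0" for t
  proof -
    interpret D: transversal_chart "t *\<^sub>R y" X "2 * m" \<rho>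
      by (rule C.transversal_chart_scaleR[OF t])
    have chart: "D.conj_chart x = t *\<^sub>R C.conj_chart x" for x
      by (simp add: C.conj_chart_def D.conj_chart_def qmm_distribs)
    then have eq: "D.conj_chart = (\<lambda>x. t *\<^sub>R C.conj_chart x)"
      by blast
    show "orbit_chart sl_quat \<O> (2 * m) U (\<lambda>x. t *\<^sub>R C.conj_chart x)"
      unfolding eq[symmetric] using U_open small in_orbit t by (intro D.orbit_chart_conj_chart) (auto simp: chart)
    show "\<bar>t\<bar> ^ m * c \<le> liouville_density sl_quat (2 * m) (\<lambda>x. t *\<^sub>R C.conj_chart x) x" if x: "x \<in> U" for x
    proof -
      have "liouville_density sl_quat (2 * m) (\<lambda>x. t *\<^sub>R C.conj_chart x) x = \<bar>t ^ m * W (C.coord x)\<bar>"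
        unfolding eq[symmetric] D.liouville_density_conj_chart[OF small(1)[OF x] refl]
        by (simp add: chart orbit_form_scaleR two_form_power_scale W_def C.conj_chart_def C.conj_inv_def)
      also have "\<dots> \<ge> \<bar>t\<bar> ^ m * c"
        using \<delta>(2)[OF small(2)[OF x]] c(1) by (auto simp: abs_mult power_abs intro!: mult_left_mono)
      finally show ?thesis .
    qed
  qed
  have vol: "ennreal (r * c) * emeasure (\<Pi>\<^sub>M i\<in>{..<2 * m}. lborel) S \<le> liouville_content sl_quat \<O> {x \<in> \<O>. \<beta> x \<le> 0}"
    if S: "S \<in> sets (\<Pi>\<^sub>M i\<in>{..<2 * m}. lborel)" "S \<subseteq> U" and t: "\<bar>t\<bar> = r" "1 \<le> r"
      and neg: "\<And>x. x \<in> S \<Longrightarrow> \<beta> (t *\<^sub>R C.conj_chart x) \<le> 0" for S t r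
  proof -
    have t0: "t \<noteq> 0" using t by auto
    \<comment> \<open>Linear growth in \<open>r\<close> is enough for unboundedness, and
      \<open>m \<ge> 1\<close> provides it.\<close>
    have "r \<le> \<bar>t\<bar> ^ m"
      using t power_increasing[of 1 m r] \<open>m \<noteq> 0\<close> by simp
    then have "r * c \<le> liouville_density sl_quat (2 * m) (\<lambda>x. t *\<^sub>R C.conj_chart x) x" if "x \<in> S" for x
      using scaled_density[OF t0, of x] S(2) that c(1) by (meson mult_right_mono less_imp_le order_trans subsetD)
    then have "(\<integral>\<^sup>+x. ennreal (r * c) * indicator S x \<partial>(\<Pi>\<^sub>M i\<in>{..<2 * m}. lborel))
        \<le> piece_volume sl_quat (2 * m, S, \<lambda>x. t *\<^sub>R C.conj_chart x)"
      by (auto intro!: nn_integral_mono ennreal_leI simp: indicator_def)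
    also have "\<dots> \<le> liouville_content sl_quat \<O> {x \<in> \<O>. \<beta> x \<le> 0}"
      using S scaled_chart[OF t0] neg in_orbit[OF _ t0]
      by (intro piece_volume_le_content) (auto intro!: exI[of _ U])
    finally show ?thesis
      using S(1) by (simp add: nn_integral_cmult_indicator)
  qed
  have scale: "\<beta> (t *\<^sub>R x) = t * \<beta> x" for t x
    using linear_scale[OF \<beta>] by simp
  have contb: "continuous_on UNIV \<beta>"
    using \<beta> by (simp add: linear_continuous_on linear_conv_bounded_linear)
  have meas: "{x. \<beta> x \<le> 0} \<in> sets borel" "{x. 0 \<le> \<beta> x} \<in> sets borel"
    using closed_Collect_le[OF contb continuous_on_const[of UNIV 0]]
      closed_Collect_le[OF continuous_on_const[of UNIV 0] contb] by auto
  have chart1: "continuous_map (subtopology (powertop_real {..<2 * m}) U) euclidean C.conj_chart"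
    using scaled_chart[of 1] by (simp add: orbit_chart_def)
  define Sn where "Sn = U \<inter> C.conj_chart -` {x. \<beta> x \<le> 0}"
  define Sp where "Sp = U \<inter> C.conj_chart -` {x. 0 \<le> \<beta> x}"
  have Sn: "Sn \<in> sets (\<Pi>\<^sub>M i\<in>{..<2 * m}. lborel)" and Sp: "Sp \<in> sets (\<Pi>\<^sub>M i\<in>{..<2 * m}. lborel)"
    unfolding Sn_def Sp_def by (intro chart_preimage_measurable[OF U_open chart1 U_meas subset_refl] meas)+
  have "U = Sn \<union> Sp"
    by (auto simp: Sn_def Sp_def)
  then have "emeasure (\<Pi>\<^sub>M i\<in>{..<2 * m}. lborel) U
      \<le> emeasure (\<Pi>\<^sub>M i\<in>{..<2 * m}. lborel) Sn + emeasure (\<Pi>\<^sub>M i\<in>{..<2 * m}. lborel) Sp"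
    using emeasure_subadditive[OF Sn Sp] by simp
  then have "emeasure (\<Pi>\<^sub>M i\<in>{..<2 * m}. lborel) Sn \<noteq> 0 \<or> emeasure (\<Pi>\<^sub>M i\<in>{..<2 * m}. lborel) Sp \<noteq> 0"
    using emeasure_box_pos[OF \<epsilon>, of "2 * m"] by (auto simp: U_def)
  \<comment> \<open>One of the two parts of the box has positive measure; on \<open>Sp\<close> the
    sign \<open>s = - 1\<close> reflects the chart into the half space.\<close>
  then obtain S s where S: "S \<in> sets (\<Pi>\<^sub>M i\<in>{..<2 * m}. lborel)" "S \<subseteq> U"
      "emeasure (\<Pi>\<^sub>M i\<in>{..<2 * m}. lborel) S \<noteq> 0"
    and s: "\<bar>s\<bar> = 1" "\<And>x. x \<in> S \<Longrightarrow> s * \<beta> (C.conj_chart x) \<le> 0"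
  proof
    assume "emeasure (\<Pi>\<^sub>M i\<in>{..<2 * m}. lborel) Sn \<noteq> 0"
    then show thesis
      using Sn by (intro that[of Sn 1]) (auto simp: Sn_def)
  next
    assume "emeasure (\<Pi>\<^sub>M i\<in>{..<2 * m}. lborel) Sp \<noteq> 0"
    then show thesis
      using Sp by (intro that[of Sp "-1"]) (auto simp: Sp_def)
  qed
  define e where "e = emeasure (\<Pi>\<^sub>M i\<in>{..<2 * m}. lborel) S"
  define V where "V = liouville_content sl_quat \<O> {x \<in> \<O>. \<beta> x \<le> 0}"
  \<comment> \<open>The dilation by \<open>n + 1\<close>, combined with the sign \<open>s\<close>,
    carries the same set \<open>S\<close> into the half space, with volume at least
    \<open>n + 1\<close> times a fixed positive number.\<close>
  have unbounded: "ennreal (real (Suc n)) * (ennreal c * e) \<le> V" for n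
  proof -
    have "ennreal (real (Suc n) * c) * e \<le> V"
      unfolding e_def V_def
    proof (rule vol[OF S(1,2)])
      show "\<bar>real (Suc n) * s\<bar> = real (Suc n)"
        using s(1) by (simp add: abs_mult)
      show "\<beta> ((real (Suc n) * s) *\<^sub>R C.conj_chart x) \<le> 0" if "x \<in> S" for x
        unfolding scale mult.assoc by (rule mult_nonneg_nonpos[OF of_nat_0_le_iff s(2)[OF that]])
    qed simp
    then show ?thesis
      using c(1) by (simp add: ennreal_mult mult.assoc)
  qed
  have "V = \<infinity>"
  proof (rule ccontr)
    assume V: "V \<noteq> \<infinity>"
    have ce: "ennreal c * e \<noteq> 0"
      using c(1) S(3) by (simp add: e_def)
    have "ennreal c * e \<le> V"
      using unbounded[of 0] by simp
    then have "ennreal c * e \<noteq> \<infinity>"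
      using V by (auto simp: top_unique)
    then obtain q where q: "ennreal c * e = ennreal q" "0 < q"
      using ce by (cases "ennreal c * e") (auto simp: order_less_le)
    obtain v where v: "V = ennreal v" "0 \<le> v"
      using V by (cases V) auto
    obtain n where "v < real n * q"
      using reals_Archimedean3[OF q(2)] by blast
    moreover have "real (Suc n) * q \<le> v"
      using unbounded[of n] q(2) v by (simp add: q(1) v(1) ennreal_mult[symmetric] del: of_nat_Suc)
    ultimately show False
      using q(2) by (simp add: algebra_simps)
  qed
  then show ?thesis
    by (simp add: V_def \<O>_def)
qed

theorem theorem4p9:
  fixes \<O> :: "(quat^'n^'n) set"
  assumes "nilpotent_orbit \<O>"
  shows "uminus ` \<O> = \<O> \<and> (\<O> \<noteq> {0} \<longrightarrow> \<not> admits_gibbs_states sl_quat \<O>)"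
proof
  obtain y where y: "ad_nilpotent sl_quat y" "\<O> = adjoint_orbit SL_quat y"
    using assms unfolding nilpotent_orbit_def by blast
  have neg: "- x \<in> \<O>" if "x \<in> \<O>" for x
    using nilpotent_adjoint_orbit_scaleR[OF y(1), of "- 1" x] that by (simp add: y(2))
  show "uminus ` \<O> = \<O>"
  proof (intro equalityI subsetI)
    fix x assume "x \<in> \<O>"
    then show "x \<in> uminus ` \<O>"
      using neg[of x] by (intro image_eqI[of _ _ "- x"]) auto
  qed (use neg in auto)
  show "\<O> \<noteq> {0} \<longrightarrow> \<not> admits_gibbs_states sl_quat \<O>"
  proof
    assume ne: "\<O> \<noteq> {0}"
    have "y \<noteq> 0"
    proof
      assume "y = 0"
      moreover have "mat 1 \<in> (SL_quat :: (quat^'n^'n) set)"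
        by (simp add: SL_quat_def complex_rep_mat_1 invertibleI_complex_rep)
      ultimately have "\<O> = {0}"
        unfolding y(2) adjoint_orbit_def by (auto simp: qmm.zero_left qmm.zero_right)
      then show False
        using ne by simp
    qed
    have "partition_function sl_quat \<O> \<beta> = \<infinity>" if \<beta>: "linear \<beta>" for \<beta> :: "quat^'n^'n \<Rightarrow> real"
    proof -
      define A where "A = {x \<in> \<O>. \<beta> x \<le> 0}"
      have "continuous_on UNIV \<beta>"
        using \<beta> by (simp add: linear_continuous_on linear_conv_bounded_linear)
      then have "{x. \<beta> x \<le> 0} \<in> sets borel"
        by (intro borel_closed closed_Collect_le continuous_on_const)
      moreover have "A = \<O> \<inter> {x. \<beta> x \<le> 0}"
        by (auto simp: A_def)
      ultimately have A: "A \<in> sets (restrict_space borel \<O>)"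
        unfolding sets_restrict_space by blast
      have "sets (restrict_space borel \<O>) \<subseteq> Pow \<O>"
        using sets.space_closed[of "restrict_space borel \<O>"] by (simp add: space_restrict_space)
      then have "sets (liouville_measure sl_quat \<O>) = sigma_sets \<O> (sets (restrict_space borel \<O>))"
        by (simp add: liouville_measure_def)
      then have A': "A \<in> sets (liouville_measure sl_quat \<O>)"
        using A by (simp add: sigma_sets.Basic)
      have "\<infinity> = emeasure (liouville_measure sl_quat \<O>) A"
        using emeasure_liouville_measure[OF A] liouville_content_halfspace[OF y(1) \<open>y \<noteq> 0\<close> \<beta>]
        by (simp add: A_def y(2))
      also have "\<dots> = (\<integral>\<^sup>+x. indicator A x \<partial>liouville_measure sl_quat \<O>)"
        using A' by simp
      also have "\<dots> \<le> partition_function sl_quat \<O> \<beta>"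
        unfolding partition_function_def
        by (intro nn_integral_mono) (auto simp: indicator_def A_def)
      finally show ?thesis
        by (simp add: top_unique)
    qed
    then show "\<not> admits_gibbs_states sl_quat \<O>"
      unfolding admits_gibbs_states_def by auto
  qed
qed

end
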